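(* Let $\delta=1$ (resp. $\delta=-1$) and let $\eta\in\mathbb{R}$. Consider a system $$z_{1,t}=F(z,z_1,y,y_1),\qquad y_{1,t}=G(z,z_1,y,y_1)\qquad (z=u,\ z_1=u_x,\ y=v,\ y_1=v_x),$$ with $F,G$ smooth, satisfying $F_z^2+F_y^2+G_z^2+G_y^2\neq 0$ up to a set of measure zero. Then the system describes pseudospherical surfaces (resp. spherical surfaces) with associated smooth functions $f_{ij}(z,z_1,y,y_1)$ such that $f_{31}=\eta$ if and only if one of the following two cases occurs (locally, i.e. after possibly shrinking the domain): (i) The system is $$z_{1,t}=\tfrac1W\big[-\delta a(bz_1+ay_1)\phi''(\xi)-\eta(\mu h_{y_1}+\lambda g_{y_1})\phi'(\xi)+\tfrac12(g^2+h^2)_{y_1}\phi(\xi)\big],$$ $$y_{1,t}=\tfrac1W\big[\delta b(bz_1+ay_1)\phi''(\xi)+\eta(\mu h_{z_1}+\lambda g_{z_1})\phi'(\xi)-\tfrac12(g^2+h^2)_{z_1}\phi(\xi)\big],$$ where $a,b,\lambda,\mu\in\mathbb{R}$, $a^2+b^2\ne0$, $\lambda^2+\mu^2\neq0$; $g(z_1,y_1),h(z_1,y_1)$ are smooth functions with $\mu g-\lambda h=\delta a y_1+\delta b z_1$ and $W:=g_{z_1}h_{y_1}-g_{y_1}h_{z_1}\neq0$; and $\phi(\xi)$ is a smooth strictly monotone function of $\xi=ay+bz$. In this case the associated functions are $$f_{11}=g,\ f_{12}=\lambda\phi'(\xi),\ f_{21}=h,\ f_{22}=\mu\phi'(\xi),\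 f_{31}=\eta,\ f_{32}=\phi(\xi).$$ (ii) The system is $$z_{1,t}=-\frac{z_1}{\gamma}(\delta p_{zy}-\tau p)+\frac{y_1}{\gamma}(-\delta p_{yy}+\beta p)+\frac{\delta\eta}{\gamma^2}(-\beta p_z+\tau p_y),$$ $$y_{1,t}=\frac{z_1}{\gamma}(\delta p_{zz}-\alpha p)+\frac{y_1}{\gamma}(\delta p_{zy}-\tau p)+\frac{\delta\eta}{\gamma^2}(\tau p_z-\alpha p_y),$$ where $a_1,b_1,a_2,b_2\in\mathbb{R}$, $\gamma:=a_1b_2-a_2b_1\neq0$, $\alpha:=a_1^2+a_2^2$, $\beta:=b_1^2+b_2^2$, $\tau:=a_1b_1+a_2b_2$, and $p(z,y)$ is a smooth function such that $p_z$ and $p_y$ are not proportional. In this case the associated functions are $$f_{11}=a_1z_1+b_1y_1,\quad f_{12}=\tfrac{\delta}{\gamma}(b_1p_z-a_1p_y),\quad f_{21}=a_2z_1+b_2y_1,\quad f_{22}=\tfrac{\delta}{\gamma}(b_2p_z-a_2p_y),\quad f_{31}=\eta,\quad f_{32}=p.$$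
   Context: Subscripts $z,z_1,y,y_1$ on functions denote partial derivatives, and $z,z_1,y,y_1$ are treated as independent variables on an open connected subset of $\mathbb{R}^4$; primes denote derivatives with respect to $\xi$. "$p_z$ and $p_y$ not proportional" means linearly independent over $\mathbb{R}$ as functions. Definition. A system of PDEs for $u(x,t),v(x,t)$ describes pseudospherical surfaces (take $\delta=1$), resp. spherical surfaces (take $\delta=-1$), with associated functions $f_{ij}$, $1\le i\le 3$, $1\le j\le 2$, if the system is equivalent to (i.e. has exactly the same solutions $(u,v)$ as) the structure equations $d\omega_1=\omega_3\wedge\omega_2$, $d\omega_2=\omega_1\wedge\omega_3$, $d\omega_3=\delta\,\omega_1\wedge\omega_2$ of a surface with Gaussian curvature $K=-\delta$, where $\omega_i=f_{i1}dx+f_{i2}dt$ and $f_{ij}$ are evaluated on $u,v$ and their derivatives, with $\omega_1\wedge\omega_2\ne 0$, i.e. $f_{11}f_{22}-f_{12}f_{21}\neq0$. Everything is local and generic: non-vanishing conditions (including $f_{11}f_{22}-f_{12}f_{21}\ne0$) are understood up to a set of measure zero, and the domain may be replaced by a smaller open connected set. *)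

theory Defs
  imports "HOL-Analysis.Analysis"
begin

definition dd :: "'a::real_normed_vector \<Rightarrow> ('a \<Rightarrow> real) \<Rightarrow> 'a \<Rightarrow> real" where
  "dd e f p = frechet_derivative f (at p) e"

abbreviation D1 :: "(real \<times> real \<Rightarrow> real) \<Rightarrow> real \<times> real \<Rightarrow> real" where
  "D1 \<equiv> dd (1, 0)"

abbreviation D2 :: "(real \<times> real \<Rightarrow> real) \<Rightarrow> real \<times> real \<Rightarrow> real" where
  "D2 \<equiv> dd (0, 1)"

text \<open>\<open>dd e f p\<close> is the derivative of \<open>f\<close> at \<open>p\<close> in direction \<open>e\<close>. \<open>Ck_on k S f\<close> and \<open>smooth_on S f\<close> are meant for open \<open>S\<close>; the values of
  \<open>f\<close> outside \<open>S\<close> are irrelevant.\<close>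

primrec Ck_on :: "nat \<Rightarrow> 'a::euclidean_space set \<Rightarrow> ('a \<Rightarrow> real) \<Rightarrow> bool" where
  "Ck_on 0 S f \<longleftrightarrow> continuous_on S f"
| "Ck_on (Suc k) S f \<longleftrightarrow>
     (\<forall>p\<in>S. f differentiable (at p)) \<and> (\<forall>e\<in>Basis. Ck_on k S (dd e f))"

definition smooth_on :: "'a::euclidean_space set \<Rightarrow> ('a \<Rightarrow> real) \<Rightarrow> bool" where
  "smooth_on S f \<longleftrightarrow> (\<forall>k. Ck_on k S f)"

text \<open>The coordinates \<open>(z, z1, y, y1)\<close>, in this order, stand for \<open>(u, u_x, v, v_x)\<close>.\<close>

type_synonym jet = "real \<times> real \<times> real \<times> real"

definition domain4 :: "jet set \<Rightarrow> bool" where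
  "domain4 V \<longleftrightarrow> open V \<and> connected V \<and> V \<noteq> {}"

text \<open>\<open>P\<close> holds, after shrinking, near the points of an open dense subset of \<open>U\<close>:
  every subdomain of \<open>U\<close> contains a subdomain on which \<open>P\<close> holds.\<close>

definition generically_locally :: "jet set \<Rightarrow> (jet set \<Rightarrow> bool) \<Rightarrow> bool" where
  "generically_locally U P \<longleftrightarrow>
     (\<forall>V'. domain4 V' \<and> V' \<subseteq> U \<longrightarrow> (\<exists>V. domain4 V \<and> V \<subseteq> V' \<and> P V))"

text \<open>A differential 1-form \<open>A dx + B dt\<close> on the \<open>(x, t)\<close>-plane is the pair \<open>(A, B)\<close>, and
  a 2-form is represented by its coefficient with respect to \<open>dx \<and> dt\<close>.\<close>

type_synonym one_form = "(real \<times> real \<Rightarrow> real) \<times> (real \<times> real \<Rightarrow> real)"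

definition ext_d :: "one_form \<Rightarrow> real \<times> real \<Rightarrow> real" where
  "ext_d \<omega> q = D1 (snd \<omega>) q - D2 (fst \<omega>) q"

definition wedge :: "one_form \<Rightarrow> one_form \<Rightarrow> real \<times> real \<Rightarrow> real" where
  "wedge \<omega> \<theta> q = fst \<omega> q * snd \<theta> q - snd \<omega> q * fst \<theta> q"

definition structure_equations ::
    "real \<Rightarrow> (real \<times> real) set \<Rightarrow> (nat \<Rightarrow> one_form) \<Rightarrow> bool" where
  "structure_equations \<delta> \<Omega> \<omega> \<longleftrightarrow>
     (\<forall>q\<in>\<Omega>. ext_d (\<omega> 1) q = wedge (\<omega> 3) (\<omega> 2) q
          \<and> ext_d (\<omega> 2) q = wedge (\<omega> 1) (\<omega> 3) q
          \<and> ext_d (\<omega> 3) q = \<delta> * wedge (\<omega> 1) (\<omega> 2) q)"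

definition jet_of ::
    "(real \<times> real \<Rightarrow> real) \<Rightarrow> (real \<times> real \<Rightarrow> real) \<Rightarrow> real \<times> real \<Rightarrow> jet" where
  "jet_of u v q = (u q, D1 u q, v q, D1 v q)"

definition solves_system ::
    "(jet \<Rightarrow> real) \<Rightarrow> (jet \<Rightarrow> real) \<Rightarrow> (real \<times> real) set
      \<Rightarrow> (real \<times> real \<Rightarrow> real) \<Rightarrow> (real \<times> real \<Rightarrow> real) \<Rightarrow> bool" where
  "solves_system F G \<Omega> u v \<longleftrightarrow>
     (\<forall>q\<in>\<Omega>. D2 (D1 u) q = F (jet_of u v q) \<and> D2 (D1 v) q = G (jet_of u v q))"

definition assoc_form ::
    "(nat \<Rightarrow> nat \<Rightarrow> jet \<Rightarrow> real) \<Rightarrow> (real \<times> real \<Rightarrow> real) \<Rightarrow> (real \<times> real \<Rightarrow> real)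
      \<Rightarrow> nat \<Rightarrow> one_form" where
  "assoc_form f u v i = (f i 1 \<circ> jet_of u v, f i 2 \<circ> jet_of u v)"

text \<open>Pseudospherical surfaces for \<open>\<delta> = 1\<close>, spherical surfaces for \<open>\<delta> = -1\<close>. The candidate
  solutions are all pairs \<open>(u, v)\<close> of smooth functions on an open subset of the \<open>(x, t)\<close>-plane
  whose jets \<open>(u, u_x, v, v_x)\<close> stay in \<open>V\<close>.\<close>

definition describes_surfaces ::
    "real \<Rightarrow> (jet \<Rightarrow> real) \<Rightarrow> (jet \<Rightarrow> real) \<Rightarrow> (nat \<Rightarrow> nat \<Rightarrow> jet \<Rightarrow> real)
      \<Rightarrow> jet set \<Rightarrow> bool" where
  "describes_surfaces \<delta> F G f V \<longleftrightarrow>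
     (\<forall>i\<in>{1, 2, 3}. \<forall>j\<in>{1, 2}. smooth_on V (f i j)) \<and>
     negligible {q\<in>V. f 1 1 q * f 2 2 q - f 1 2 q * f 2 1 q = 0} \<and>
     (\<forall>\<Omega> u v. open \<Omega> \<and> smooth_on \<Omega> u \<and> smooth_on \<Omega> v \<and> jet_of u v ` \<Omega> \<subseteq> V \<longrightarrow>
        (solves_system F G \<Omega> u v \<longleftrightarrow> structure_equations \<delta> \<Omega> (assoc_form f u v)))"

text \<open>The condition \<open>F_z^2 + F_y^2 + G_z^2 + G_y^2 \<noteq> 0\<close> up to a set of measure zero.\<close>

definition nondegenerate_on :: "jet set \<Rightarrow> (jet \<Rightarrow> real) \<Rightarrow> (jet \<Rightarrow> real) \<Rightarrow> bool" where
  "nondegenerate_on V F G \<longleftrightarrow>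
     negligible {q\<in>V. (dd (1, 0, 0, 0) F q)\<^sup>2 + (dd (0, 0, 1, 0) F q)\<^sup>2
                    + (dd (1, 0, 0, 0) G q)\<^sup>2 + (dd (0, 0, 1, 0) G q)\<^sup>2 = 0}"

definition proj_z1y1 :: "jet set \<Rightarrow> (real \<times> real) set" where
  "proj_z1y1 V = (\<lambda>(z, z1, y, y1). (z1, y1)) ` V"

definition proj_zy :: "jet set \<Rightarrow> (real \<times> real) set" where
  "proj_zy V = (\<lambda>(z, z1, y, y1). (z, y)) ` V"

definition xi_range :: "real \<Rightarrow> real \<Rightarrow> jet set \<Rightarrow> real set" where
  "xi_range a b V = (\<lambda>(z, z1, y, y1). a * y + b * z) ` V"

definition jac :: "(real \<times> real \<Rightarrow> real) \<Rightarrow> (real \<times> real \<Rightarrow> real) \<Rightarrow> real \<times> real \<Rightarrow> real" where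
  "jac g h w = D1 g w * D2 h w - D2 g w * D1 h w"

text \<open>Below, \<open>g\<close> and \<open>h\<close> take the argument \<open>(z1, y1)\<close> and \<open>p\<close> takes the argument \<open>(z, y)\<close>.\<close>

definition case_i ::
    "real \<Rightarrow> real \<Rightarrow> (jet \<Rightarrow> real) \<Rightarrow> (jet \<Rightarrow> real) \<Rightarrow> (nat \<Rightarrow> nat \<Rightarrow> jet \<Rightarrow> real)
      \<Rightarrow> jet set \<Rightarrow> bool" where
  "case_i \<delta> \<eta> F G f V \<longleftrightarrow>
    (\<exists>(a::real) b lam \<mu> g h \<phi>.
       a\<^sup>2 + b\<^sup>2 \<noteq> 0 \<and> lam\<^sup>2 + \<mu>\<^sup>2 \<noteq> 0 \<and>
       smooth_on (proj_z1y1 V) g \<and> smooth_on (proj_z1y1 V) h \<and>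
       (\<forall>(z1, y1) \<in> proj_z1y1 V.
          \<mu> * g (z1, y1) - lam * h (z1, y1) = \<delta> * a * y1 + \<delta> * b * z1 \<and>
          jac g h (z1, y1) \<noteq> 0) \<and>
       smooth_on (xi_range a b V) \<phi> \<and>
       (strict_mono_on (xi_range a b V) \<phi> \<or> strict_antimono_on (xi_range a b V) \<phi>) \<and>
       (\<forall>(z, z1, y, y1) \<in> V.
          let \<xi> = a * y + b * z; w = (z1, y1); W = jac g h w in
          F (z, z1, y, y1) = 1 / W *
            (- \<delta> * a * (b * z1 + a * y1) * deriv (deriv \<phi>) \<xi>
             - \<eta> * (\<mu> * D2 h w + lam * D2 g w) * deriv \<phi> \<xi>
             + 1 / 2 * D2 (\<lambda>w. (g w)\<^sup>2 + (h w)\<^sup>2) w * \<phi> \<xi>) \<and>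
          G (z, z1, y, y1) = 1 / W *
            (\<delta> * b * (b * z1 + a * y1) * deriv (deriv \<phi>) \<xi>
             + \<eta> * (\<mu> * D1 h w + lam * D1 g w) * deriv \<phi> \<xi>
             - 1 / 2 * D1 (\<lambda>w. (g w)\<^sup>2 + (h w)\<^sup>2) w * \<phi> \<xi>) \<and>
          f 1 1 (z, z1, y, y1) = g w \<and> f 1 2 (z, z1, y, y1) = lam * deriv \<phi> \<xi> \<and>
          f 2 1 (z, z1, y, y1) = h w \<and> f 2 2 (z, z1, y, y1) = \<mu> * deriv \<phi> \<xi> \<and>
          f 3 1 (z, z1, y, y1) = \<eta> \<and> f 3 2 (z, z1, y, y1) = \<phi> \<xi>))"

definition case_ii ::
    "real \<Rightarrow> real \<Rightarrow> (jet \<Rightarrow> real) \<Rightarrow> (jet \<Rightarrow> real) \<Rightarrow> (nat \<Rightarrow> nat \<Rightarrow> jet \<Rightarrow> real)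
      \<Rightarrow> jet set \<Rightarrow> bool" where
  "case_ii \<delta> \<eta> F G f V \<longleftrightarrow>
    (\<exists>(a1::real) b1 a2 b2 \<gamma> \<alpha> \<beta> \<tau> p.
       \<gamma> = a1 * b2 - a2 * b1 \<and> \<gamma> \<noteq> 0 \<and>
       \<alpha> = a1\<^sup>2 + a2\<^sup>2 \<and> \<beta> = b1\<^sup>2 + b2\<^sup>2 \<and> \<tau> = a1 * b1 + a2 * b2 \<and>
       smooth_on (proj_zy V) p \<and>
       (\<forall>c1 c2. (\<forall>w\<in>proj_zy V. c1 * D1 p w + c2 * D2 p w = 0) \<longrightarrow> c1 = 0 \<and> c2 = 0) \<and>
       (\<forall>(z, z1, y, y1) \<in> V.
          let w = (z, y) in
          F (z, z1, y, y1) =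
            - (z1 / \<gamma>) * (\<delta> * D2 (D1 p) w - \<tau> * p w)
            + y1 / \<gamma> * (- \<delta> * D2 (D2 p) w + \<beta> * p w)
            + \<delta> * \<eta> / \<gamma>\<^sup>2 * (- \<beta> * D1 p w + \<tau> * D2 p w) \<and>
          G (z, z1, y, y1) =
            z1 / \<gamma> * (\<delta> * D1 (D1 p) w - \<alpha> * p w)
            + y1 / \<gamma> * (\<delta> * D2 (D1 p) w - \<tau> * p w)
            + \<delta> * \<eta> / \<gamma>\<^sup>2 * (\<tau> * D1 p w - \<alpha> * D2 p w) \<and>
          f 1 1 (z, z1, y, y1) = a1 * z1 + b1 * y1 \<and>
          f 1 2 (z, z1, y, y1) = \<delta> / \<gamma> * (b1 * D1 p w - a1 * D2 p w) \<and>
          f 2 1 (z, z1, y, y1) = a2 * z1 + b2 * y1 \<and>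
          f 2 2 (z, z1, y, y1) = \<delta> / \<gamma> * (b2 * D1 p w - a2 * D2 p w) \<and>
          f 3 1 (z, z1, y, y1) = \<eta> \<and> f 3 2 (z, z1, y, y1) = p w))"

end

theory Submission
  imports Defs
begin

text \<open>Along a pair \<open>(u, v)\<close> with jet \<open>(z, z1, y, y1)\<close> the structure equations are affine in
\<open>u_xx, v_xx, u_t, v_t, u_xt, v_xt\<close>. Two different uses are made of this.

If the system \<open>u_xt = F, v_xt = G\<close> has the same solutions as the structure equations, then these
equations hold along every solution of the system. The system is a Goursat problem, so through each jet there is
a smooth local solution with prescribed values of \<open>u_xx, v_xx, u_t, v_t\<close>
(\<open>system_solution_with_data\<close>). Hence every coefficient of these four variables vanishes: \<open>f12, f22, f32\<close>
depend on \<open>w = (z, y)\<close> only and \<open>f11, f21\<close> on \<open>m = (z1, y1)\<close> only. What remains are two linear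
equations for \<open>F, G\<close>, with the Jacobian matrix of \<open>(f11, f21)\<close> as matrix, and one equation without
\<open>F, G\<close>. This is the relation \<open>separated\<close> below. The Jacobian is not identically zero on any open
set: a nonzero smooth field \<open>(k1, k2)\<close> in its kernel would make a solution of the perturbed system with
right-hand sides \<open>F + k1, G + k2\<close> solve the structure equations but not the system
(\<open>jacobian_nonzero_somewhere\<close>).

On a product of two discs, write \<open>f11 = g(m)\<close>, \<open>f21 = h(m)\<close>, \<open>f12 = A(w)\<close>,
\<open>f22 = B(w)\<close>, \<open>f32 = p(w)\<close>. The third equation reads
\<open>p_z z1 + p_y y1 = \<delta> (g B - h A)\<close>. If \<open>p_z, p_y\<close> are linearly independent, evaluating it at two
points \<open>w\<close> with independent gradients shows that \<open>g, h\<close> are linear forms in \<open>m\<close>; this gives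
the second family. If they are dependent, \<open>p = \<phi>(a y + b z)\<close>; one value of \<open>w\<close> with
\<open>\<phi>' \<noteq> 0\<close> yields \<open>\<mu> g - \<lambda> h = \<delta> (a y1 + b z1)\<close>, and independence of the differentials of
\<open>g, h\<close> forces \<open>A = \<lambda> \<phi>'\<close>, \<open>B = \<mu> \<phi>'\<close>; this gives the first family. In both cases
\<open>F, G\<close> come from solving the two linear equations.

Conversely both families have the separated form with invertible Jacobian, and then the structure equations and
the system are equivalent by linear algebra. It remains to see that
\<open>\<Delta> = f11 f22 - f12 f21\<close> vanishes only on a null set. The set where a \<open>C^1\<close> function vanishes but some
partial derivative does not is null (\<open>negligible_zero_set\<close>). So at almost every zero of \<open>\<Delta>\<close> all the
functions \<open>A, B\<close> and their derivatives up to second order vanish, and with them the \<open>z\<close>- and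
\<open>y\<close>-derivatives of \<open>F\<close> and \<open>G\<close>, which the nondegeneracy of the system excludes
(\<open>separated_generic_rank\<close>).

The existence theorem for the Goursat problem is proved by Picard iteration; smoothness of the solution follows
from Hadamard's form of Taylor's formula, which turns difference quotients into solutions of linear integral
equations with continuous parameters.\<close>

section \<open>Calculus of k times continuously differentiable functions\<close>

lemma dd_has_derivative: "(f has_derivative f') (at p) \<Longrightarrow> dd e f p = f' e"
  unfolding dd_def by (metis frechet_derivative_at)

lemma has_derivative_dd: "f differentiable (at p) \<Longrightarrow> (f has_derivative (\<lambda>e. dd e f p)) (at p)"
  unfolding dd_def by (simp add: frechet_derivative_works)

lemma dd_Basis_expansion:
  fixes f :: "'a::euclidean_space \<Rightarrow> real"
  assumes "f differentiable (at p)"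
  shows "dd v f p = (\<Sum>b\<in>Basis. (v \<bullet> b) * dd b f p)"
proof -
  interpret linear "\<lambda>e. dd e f p"
    using has_derivative_dd[OF assms] has_derivative_linear by blast
  have "dd v f p = dd (\<Sum>b\<in>Basis. (v \<bullet> b) *\<^sub>R b) f p"
    by (simp only: euclidean_representation)
  also have "\<dots> = (\<Sum>b\<in>Basis. (v \<bullet> b) * dd b f p)"
    by (simp add: sum scale)
  finally show ?thesis .
qed

lemma dd_cong_open:
  assumes "open S" "p \<in> S" "\<And>x. x \<in> S \<Longrightarrow> f x = g x"
  shows "dd e f p = dd e g p" and "f differentiable (at p) \<longleftrightarrow> g differentiable (at p)"
proof -
  have *: "(f has_derivative D) (at p) \<longleftrightarrow> (g has_derivative D) (at p)" for D
    using has_derivative_transform_within_open[of f D p UNIV S g]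
      has_derivative_transform_within_open[of g D p UNIV S f] assms by auto
  then show "dd e f p = dd e g p" by (simp add: dd_def frechet_derivative_def)
  show "f differentiable (at p) \<longleftrightarrow> g differentiable (at p)"
    using * by (simp add: differentiable_def)
qed

lemma Ck_on_cong:
  assumes "open S" "\<And>x. x \<in> S \<Longrightarrow> f x = g x" "Ck_on k S f"
  shows "Ck_on k S g"
  using assms(2,3)
proof (induction k arbitrary: f g)
  case 0
  then show ?case by (simp cong: continuous_on_cong)
next
  case (Suc k)
  have "Ck_on k S (dd e g)" if "e \<in> Basis" for e
    using Suc.IH[of "dd e f" "dd e g"] dd_cong_open(1)[OF assms(1) _ Suc.prems(1)] Suc.prems(2) that
    by auto
  moreover have "g differentiable (at p)" if "p \<in> S" for p
    using dd_cong_open(2)[OF assms(1) that Suc.prems(1)] Suc.prems(2) that by auto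
  ultimately show ?case by simp
qed

lemma Ck_on_subset: "Ck_on k S f \<Longrightarrow> T \<subseteq> S \<Longrightarrow> Ck_on k T f"
  by (induction k arbitrary: f) (auto intro: continuous_on_subset)

lemma Ck_on_SucD: "Ck_on (Suc k) S f \<Longrightarrow> Ck_on k S f"
proof (induction k arbitrary: f)
  case 0
  then show ?case
    by (auto intro!: differentiable_imp_continuous_on differentiable_at_imp_differentiable_on)
qed auto

lemma Ck_on_imp_continuous: "Ck_on k S f \<Longrightarrow> continuous_on S f"
proof (induction k)
  case (Suc k)
  then show ?case using Ck_on_SucD by blast
qed simp

lemma Ck_on_const [simp]: "Ck_on k S (\<lambda>_. c)"
proof (induction k arbitrary: c)
  case (Suc k)
  have "dd e (\<lambda>_. c) = (\<lambda>_. 0)" for e :: 'a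
    by (rule ext, subst dd_has_derivative) (auto intro!: derivative_eq_intros)
  then show ?case using Suc by simp
qed simp

lemma Ck_on_add:
  assumes "open S" "Ck_on k S f" "Ck_on k S g"
  shows "Ck_on k S (\<lambda>x. f x + g x)"
  using assms(2,3)
proof (induction k arbitrary: f g)
  case (Suc k)
  have "dd e (\<lambda>x. f x + g x) p = dd e f p + dd e g p" if "p \<in> S" for e p
    using Suc.prems that by (subst dd_has_derivative)
      (auto intro!: derivative_eq_intros has_derivative_dd)
  then have "Ck_on k S (dd e (\<lambda>x. f x + g x))" if "e \<in> Basis" for e
    using Ck_on_cong[OF assms(1) _ Suc.IH[of "dd e f" "dd e g"]] Suc.prems that by auto
  then show ?case using Suc.prems by auto
qed (auto intro: continuous_intros)

lemma Ck_on_mult: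
  assumes "open S" "Ck_on k S f" "Ck_on k S g"
  shows "Ck_on k S (\<lambda>x. f x * g x)"
  using assms(2,3)
proof (induction k arbitrary: f g)
  case (Suc k)
  have "dd e (\<lambda>x. f x * g x) p = f p * dd e g p + dd e f p * g p" if "p \<in> S" for e p
    using Suc.prems that by (subst dd_has_derivative)
      (auto intro!: derivative_eq_intros has_derivative_dd)
  moreover have "Ck_on k S (\<lambda>p. f p * dd e g p + dd e f p * g p)" if "e \<in> Basis" for e
    using Suc.prems that Ck_on_SucD[OF Suc.prems(1)] Ck_on_SucD[OF Suc.prems(2)]
    by (intro Ck_on_add Suc.IH assms(1)) auto
  ultimately have "Ck_on k S (dd e (\<lambda>x. f x * g x))" if "e \<in> Basis" for e
    using Ck_on_cong[OF assms(1), of "\<lambda>p. f p * dd e g p + dd e f p * g p"] that by simp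
  then show ?case using Suc.prems by auto
qed (auto intro: continuous_intros)

lemma Ck_on_sum:
  assumes "open S" "\<And>i. i \<in> I \<Longrightarrow> Ck_on k S (f i)"
  shows "Ck_on k S (\<lambda>x. \<Sum>i\<in>I. f i x)"
  using assms(2) by (induction I rule: infinite_finite_induct) (auto intro!: Ck_on_add assms(1))

lemma Ck_on_linear:
  fixes l :: "'a::euclidean_space \<Rightarrow> real"
  assumes "linear l"
  shows "Ck_on k S l"
proof (cases k)
  case 0
  then show ?thesis using assms by (simp add: linear_continuous_on linear_linear)
next
  case (Suc j)
  have D: "(l has_derivative l) (at p)" for p
    using assms linear_imp_has_derivative by blast
  then have "dd e l = (\<lambda>_. l e)" for e
    by (auto simp: dd_has_derivative)
  then show ?thesis using Suc D by (auto simp: differentiable_def)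
qed

text \<open>Induction on \<open>k\<close> through the chain rule: the partial derivatives of the composition are sums of products of
\<open>C^k\<close> functions, to which the induction hypothesis applies one order lower.\<close>

lemma Ck_on_compose:
  fixes g :: "'a::euclidean_space \<Rightarrow> 'b::euclidean_space"
  assumes "open S" "g ` S \<subseteq> T" "Ck_on k T f" "\<And>b. b \<in> Basis \<Longrightarrow> Ck_on k S (\<lambda>x. g x \<bullet> b)"
  shows "Ck_on k S (\<lambda>x. f (g x))"
  using assms(3,4)
proof (induction k arbitrary: f)
  case 0
  have "continuous_on S g"
    using 0 by (intro continuous_on_componentwise[THEN iffD2]) auto
  then show ?case using 0 assms(2) by (auto intro: continuous_on_compose2)
next
  case (Suc k)
  have gd: "(g has_derivative (\<lambda>e. \<Sum>b\<in>Basis. dd e (\<lambda>x. g x \<bullet> b) p *\<^sub>R b)) (at p)" if "p \<in> S" for p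
  proof (rule has_derivative_componentwise_within[THEN iffD2], intro ballI)
    fix b :: 'b assume b: "b \<in> Basis"
    have "(\<Sum>c\<in>Basis. dd e (\<lambda>x. g x \<bullet> c) p *\<^sub>R c) \<bullet> b = dd e (\<lambda>x. g x \<bullet> b) p" for e
      using b by simp
    then show "((\<lambda>x. g x \<bullet> b) has_derivative
        (\<lambda>x. (\<Sum>c\<in>Basis. dd x (\<lambda>x. g x \<bullet> c) p *\<^sub>R c) \<bullet> b)) (at p)"
      using Suc.prems(2)[OF b] that by (auto intro!: has_derivative_dd)
  qed
  have fd: "((\<lambda>x. f (g x)) has_derivative
      (\<lambda>e. dd (\<Sum>b\<in>Basis. dd e (\<lambda>x. g x \<bullet> b) p *\<^sub>R b) f (g p))) (at p)" if "p \<in> S" for p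
    using has_derivative_compose[OF gd[OF that] has_derivative_dd[of f "g p"]] Suc.prems(1) assms(2) that
    by auto
  have dd_eq: "dd e (\<lambda>x. f (g x)) p = (\<Sum>b\<in>Basis. dd e (\<lambda>x. g x \<bullet> b) p * dd b f (g p))"
    if "p \<in> S" for e p
  proof -
    let ?v = "\<Sum>b\<in>Basis. dd e (\<lambda>x. g x \<bullet> b) p *\<^sub>R b"
    have "f differentiable (at (g p))" using Suc.prems(1) assms(2) that by auto
    then have "dd ?v f (g p) = (\<Sum>b\<in>Basis. (?v \<bullet> b) * dd b f (g p))"
      by (rule dd_Basis_expansion)
    then show ?thesis by (simp add: dd_has_derivative[OF fd[OF that]])
  qed
  have "Ck_on k S (\<lambda>p. \<Sum>b\<in>Basis. dd e (\<lambda>x. g x \<bullet> b) p * dd b f (g p))" if "e \<in> Basis" for e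
  proof (rule Ck_on_sum[OF assms(1)], rule Ck_on_mult[OF assms(1)])
    fix b :: 'b assume b: "b \<in> Basis"
    show "Ck_on k S (\<lambda>p. dd e (\<lambda>x. g x \<bullet> b) p)"
      using Suc.prems(2)[OF b] that by simp
    show "Ck_on k S (\<lambda>p. dd b f (g p))"
    proof (rule Suc.IH)
      show "Ck_on k T (dd b f)" using Suc.prems(1) b by simp
      show "Ck_on k S (\<lambda>x. g x \<bullet> c)" if "c \<in> Basis" for c
        using Ck_on_SucD[OF Suc.prems(2)[OF that]] .
    qed
  qed
  then have "Ck_on k S (dd e (\<lambda>x. f (g x)))" if "e \<in> Basis" for e
    by (rule Ck_on_cong[OF assms(1), rotated]) (simp_all add: dd_eq that)
  then show ?case using fd by (auto simp: differentiable_def)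
qed

lemma differentiable_from_partials:
  fixes f :: "real \<times> real \<Rightarrow> real"
  assumes "open \<Omega>" "q \<in> \<Omega>"
    and d1: "\<And>x t. (x, t) \<in> \<Omega> \<Longrightarrow> ((\<lambda>x. f (x, t)) has_real_derivative f1 (x, t)) (at x)"
    and d2: "\<And>x t. (x, t) \<in> \<Omega> \<Longrightarrow> ((\<lambda>t. f (x, t)) has_real_derivative f2 (x, t)) (at t)"
    and c2: "continuous_on \<Omega> f2"
  shows "(f has_derivative (\<lambda>(h, k). f1 q * h + f2 q * k)) (at q)"
proof -
  obtain x t where q: "q = (x, t)" by (cases q)
  obtain X Y where XY: "open X" "open Y" "q \<in> X \<times> Y" "X \<times> Y \<subseteq> \<Omega>"
    using assms(1,2) by (rule open_prod_elim)
  obtain e where e: "e > 0" "ball t e \<subseteq> Y" using XY(2,3) q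
    by (auto simp: open_contains_ball)
  let ?Y = "ball t e"
  have sub: "X \<times> ?Y \<subseteq> \<Omega>" using e XY by blast
  have "((\<lambda>(x, y). f (x, y)) has_derivative
     (\<lambda>(tx, ty). f1 (x, t) * tx + blinfun_apply (blinfun_mult_right (f2 (x, t))) ty)) (at (x, t) within X \<times> ?Y)"
  proof (rule has_derivative_partialsI[where fy="\<lambda>x y. blinfun_mult_right (f2 (x, y))"])
    have "((\<lambda>x. f (x, t)) has_real_derivative f1 (x, t)) (at x within X)"
      using d1[of x t] assms(2) q by (simp add: has_field_derivative_at_within)
    then show "((\<lambda>x. f (x, t)) has_derivative (*) (f1 (x, t))) (at x within X)"
      by (simp add: has_field_derivative_def)
    show "((\<lambda>y. f (x', y)) has_derivative blinfun_apply (blinfun_mult_right (f2 (x', y)))) (at y within ?Y)"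
      if "x' \<in> X" "y \<in> ?Y" for x' y
    proof -
      have "((\<lambda>y. f (x', y)) has_real_derivative f2 (x', y)) (at y within ?Y)"
        using sub that by (intro has_field_derivative_at_within[OF d2]) auto
      then show ?thesis by (simp add: has_field_derivative_def)
    qed
    have "continuous_on (X \<times> ?Y) (\<lambda>q. blinfun_mult_right (f2 q))"
      by (intro continuous_intros continuous_on_subset[OF c2 sub])
    moreover have "(x, t) \<in> X \<times> ?Y" using XY(3) e(1) q by simp
    ultimately have "continuous (at (x, t) within X \<times> ?Y) (\<lambda>q. blinfun_mult_right (f2 q))"
      unfolding continuous_on_eq_continuous_within by blast
    then show "continuous (at (x, t) within X \<times> ?Y) (\<lambda>(x, y). blinfun_mult_right (f2 (x, y)))"
      by (simp add: split_def)
    show "t \<in> ?Y" "convex ?Y" using e by auto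
  qed
  moreover have "at (x, t) within X \<times> ?Y = at q"
    unfolding q using XY(1,3) e(1) q by (intro at_within_open open_Times) simp_all
  moreover have "(\<lambda>(x, y). f (x, y)) = f" by simp
  moreover have "(\<lambda>(tx, ty). f1 (x, t) * tx + blinfun_apply (blinfun_mult_right (f2 (x, t))) ty)
      = (\<lambda>(h, k). f1 q * h + f2 q * k)"
    by (simp add: q)
  ultimately show ?thesis by (simp only:)
qed

text \<open>The way in which regularity is established for the Goursat problem: one-dimensional derivatives in \<open>x\<close> and in
\<open>t\<close> are computed by separate arguments, and their continuity makes the function differentiable.\<close>

lemma Ck_on_SucI_partials:
  fixes f :: "real \<times> real \<Rightarrow> real"
  assumes "open \<Omega>"
    and d1: "\<And>x t. (x, t) \<in> \<Omega> \<Longrightarrow> ((\<lambda>x. f (x, t)) has_real_derivative f1 (x, t)) (at x)"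
    and d2: "\<And>x t. (x, t) \<in> \<Omega> \<Longrightarrow> ((\<lambda>t. f (x, t)) has_real_derivative f2 (x, t)) (at t)"
    and c: "Ck_on k \<Omega> f1" "Ck_on k \<Omega> f2"
  shows "Ck_on (Suc k) \<Omega> f"
proof -
  have D: "(f has_derivative (\<lambda>(h, k). f1 q * h + f2 q * k)) (at q)" if "q \<in> \<Omega>" for q
    using differentiable_from_partials[OF assms(1) that d1 d2] c(2) Ck_on_imp_continuous by blast
  have "Ck_on k \<Omega> (D1 f)" "Ck_on k \<Omega> (D2 f)"
    by (rule Ck_on_cong[OF assms(1) _ c(1)], simp add: dd_has_derivative[OF D])
      (rule Ck_on_cong[OF assms(1) _ c(2)], simp add: dd_has_derivative[OF D])
  then show ?thesis using D by (auto simp: differentiable_def Basis_prod_def)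
qed

lemma Ck_on_partials:
  fixes f :: "real \<times> real \<Rightarrow> real"
  assumes "f differentiable (at (x, t))"
  shows "((\<lambda>x. f (x, t)) has_real_derivative D1 f (x, t)) (at x)"
    and "((\<lambda>t. f (x, t)) has_real_derivative D2 f (x, t)) (at t)"
proof -
  have lin: "linear (\<lambda>e. dd e f (x, t))"
    using has_derivative_dd[OF assms] has_derivative_linear by blast
  have "((\<lambda>x. f (x, t)) has_derivative (\<lambda>h. dd (h, 0) f (x, t))) (at x)"
    by (rule has_derivative_compose[of "\<lambda>x. (x, t)", OF _ has_derivative_dd[OF assms]])
      (intro derivative_intros)
  moreover have "(\<lambda>h. dd (h, 0) f (x, t)) = (*) (D1 f (x, t))"
  proof (rule ext)
    fix h show "dd (h, 0) f (x, t) = D1 f (x, t) * h"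
      using linear_scale[OF lin, of h "(1, 0)"] by (simp add: mult.commute)
  qed
  ultimately show "((\<lambda>x. f (x, t)) has_real_derivative D1 f (x, t)) (at x)"
    unfolding has_field_derivative_def by (rule has_derivative_eq_rhs)
  have "((\<lambda>t. f (x, t)) has_derivative (\<lambda>h. dd (0, h) f (x, t))) (at t)"
    by (rule has_derivative_compose[of "\<lambda>t. (x, t)", OF _ has_derivative_dd[OF assms]])
      (intro derivative_intros)
  moreover have "(\<lambda>h. dd (0, h) f (x, t)) = (*) (D2 f (x, t))"
  proof (rule ext)
    fix h show "dd (0, h) f (x, t) = D2 f (x, t) * h"
      using linear_scale[OF lin, of h "(0, 1)"] by (simp add: mult.commute)
  qed
  ultimately show "((\<lambda>t. f (x, t)) has_real_derivative D2 f (x, t)) (at t)"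
    unfolding has_field_derivative_def by (rule has_derivative_eq_rhs)
qed

section \<open>Hadamard increments and linear integral equations\<close>

lemma theta_in:
  fixes \<theta> t r :: real
  assumes "\<theta> \<in> {0..1}"
  shows "t \<in> {-r<..<r} \<Longrightarrow> \<theta> * t \<in> {-r<..<r}" and "t \<in> {-r..r} \<Longrightarrow> \<theta> * t \<in> {-r..r}"
proof -
  have "\<bar>\<theta> * t\<bar> \<le> \<bar>t\<bar>"
    using assms mult_right_mono[of \<theta> 1 "\<bar>t\<bar>"] by (simp add: abs_mult)
  then show "t \<in> {-r<..<r} \<Longrightarrow> \<theta> * t \<in> {-r<..<r}" and "t \<in> {-r..r} \<Longrightarrow> \<theta> * t \<in> {-r..r}"
    by (simp_all add: abs_le_iff abs_less_iff) linarith+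
qed

lemma continuous_on_theta_integral:
  fixes f :: "'p::topological_space \<Rightarrow> real \<Rightarrow> real"
  assumes "continuous_on (S \<times> {0..1}) (\<lambda>(p, \<theta>). f p \<theta>)"
  shows "continuous_on S (\<lambda>p. integral {0..1} (f p))"
  using integral_continuous_on_param[of S 0 1 f] assms by (simp add: box_real)

lemma abs_theta_integral_le:
  fixes f :: "real \<Rightarrow> real"
  assumes "continuous_on {0..1} f" "\<And>\<theta>. \<theta> \<in> {0..1} \<Longrightarrow> \<bar>f \<theta>\<bar> \<le> B"
  shows "\<bar>integral {0..1} f\<bar> \<le> B"
  using integral_bound[of 0 1 f B] assms by auto

text \<open>Integrals over a segment are normalised to \<open>{0..1}\<close>. This treats both orientations of the segment alike and
turns the dependence on the end points into a dependence on parameters of the integrand.\<close>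

lemma diff_eq_theta_integral:
  fixes \<Lambda> \<psi> :: "real \<Rightarrow> real"
  assumes "\<And>\<theta>. \<theta> \<in> {0..1} \<Longrightarrow> (\<Lambda> has_real_derivative \<psi> (a + \<theta> * (b - a))) (at (a + \<theta> * (b - a)))"
  shows "\<Lambda> b - \<Lambda> a = (b - a) * integral {0..1} (\<lambda>\<theta>. \<psi> (a + \<theta> * (b - a)))"
proof -
  have "((\<lambda>\<theta>. (b - a) * \<psi> (a + \<theta> * (b - a))) has_integral
      (\<Lambda> (a + 1 * (b - a)) - \<Lambda> (a + 0 * (b - a)))) {0..1}"
  proof (rule fundamental_theorem_of_calculus)
    fix \<theta> :: real assume th: "\<theta> \<in> {0..1}"
    have "((\<lambda>\<theta>. \<Lambda> (a + \<theta> * (b - a))) has_real_derivative \<psi> (a + \<theta> * (b - a)) * (b - a)) (at \<theta>)"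
      by (rule DERIV_chain2[where f=\<Lambda> and g="\<lambda>\<theta>. a + \<theta> * (b - a)", OF assms[OF th]])
        (auto intro!: derivative_eq_intros)
    then show "((\<lambda>\<theta>. \<Lambda> (a + \<theta> * (b - a))) has_vector_derivative (b - a) * \<psi> (a + \<theta> * (b - a)))
        (at \<theta> within {0..1})"
      unfolding has_real_derivative_iff_has_vector_derivative
      by (simp add: mult.commute has_vector_derivative_at_within)
  qed simp
  then have "integral {0..1} (\<lambda>\<theta>. (b - a) * \<psi> (a + \<theta> * (b - a))) = \<Lambda> b - \<Lambda> a"
    by (intro integral_unique) simp
  then show ?thesis by simp
qed

lemma theta_integral_has_derivative:
  fixes \<psi> :: "real \<Rightarrow> real"
  assumes "continuous_on {-r<..<r} \<psi>" "t \<in> {-r<..<r}"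
  shows "((\<lambda>t. t * integral {0..1} (\<lambda>\<theta>. \<psi> (\<theta> * t))) has_real_derivative \<psi> t) (at t)"
proof -
  obtain \<rho> where \<rho>: "\<bar>t\<bar> < \<rho>" "\<rho> < r"
    using assms(2) dense[of "\<bar>t\<bar>" r] by (auto simp: abs_less_iff)
  define \<Lambda> where "\<Lambda> s = integral {-\<rho>..s} \<psi>" for s
  have D: "(\<Lambda> has_real_derivative \<psi> s) (at s)" if "s \<in> {-\<rho><..<\<rho>}" for s
  proof -
    have "continuous_on {-\<rho>..\<rho>} \<psi>"
      using \<rho> by (intro continuous_on_subset[OF assms(1)]) auto
    then have "(\<Lambda> has_real_derivative \<psi> s) (at s within {-\<rho>..\<rho>})"
      unfolding \<Lambda>_def using that by (intro integral_has_real_derivative) auto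
    moreover have "at s within {-\<rho>..\<rho>} = at s"
      using that by (intro at_within_interior) auto
    ultimately show ?thesis by simp
  qed
  have "\<Lambda> s - \<Lambda> 0 = s * integral {0..1} (\<lambda>\<theta>. \<psi> (\<theta> * s))" if "s \<in> {-\<rho><..<\<rho>}" for s
  proof -
    have "(\<Lambda> has_real_derivative \<psi> (0 + \<theta> * (s - 0))) (at (0 + \<theta> * (s - 0)))" if "\<theta> \<in> {0..1}" for \<theta>
      using theta_in(1)[OF that \<open>s \<in> _\<close>] by (intro D) simp
    from diff_eq_theta_integral[OF this] show ?thesis by simp
  qed
  moreover have "((\<lambda>s. \<Lambda> s - \<Lambda> 0) has_real_derivative \<psi> t) (at t)"
    using D[of t] \<rho> by (auto intro!: derivative_eq_intros simp: abs_less_iff)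
  ultimately show ?thesis
    using \<rho> has_field_derivative_transform_within_open[of "\<lambda>s. \<Lambda> s - \<Lambda> 0" "\<psi> t" t "{-\<rho><..<\<rho>}"
        "\<lambda>t. t * integral {0..1} (\<lambda>\<theta>. \<psi> (\<theta> * t))"]
    by (auto simp: abs_less_iff)
qed

text \<open>The coefficient functions in Hadamard's formula for increments: averages of the partial derivatives along the segment
from \<open>q\<close> to \<open>q'\<close>.\<close>

definition mean_dd :: "'a::euclidean_space \<Rightarrow> ('a \<Rightarrow> real) \<Rightarrow> 'a \<times> 'a \<Rightarrow> real" where
  "mean_dd e f = (\<lambda>(q, q'). integral {0..1} (\<lambda>\<theta>. dd e f (q + \<theta> *\<^sub>R (q' - q))))"

lemma segment_in_convex:
  fixes q q' :: "'a::real_vector"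
  assumes "convex S" "q \<in> S" "q' \<in> S" "\<theta> \<in> {0..1}"
  shows "q + \<theta> *\<^sub>R (q' - q) \<in> S"
proof -
  have "(1 - \<theta>) *\<^sub>R q + \<theta> *\<^sub>R q' \<in> S"
    using assms convexD_alt[of S q q' \<theta>] by auto
  then show ?thesis by (simp add: algebra_simps)
qed

lemma continuous_on_dd_segment:
  assumes "convex S" "continuous_on S (dd e f)"
  shows "continuous_on ((S \<times> S) \<times> {0..1}) (\<lambda>(p, \<theta>). dd e f (fst p + \<theta> *\<^sub>R (snd p - fst p)))"
  unfolding split_def
  by (rule continuous_on_compose2[OF assms(2)]) (auto intro!: continuous_intros segment_in_convex[OF assms(1)])

lemma continuous_on_mean_dd:
  assumes "convex S" "continuous_on S (dd e f)"
  shows "continuous_on (S \<times> S) (mean_dd e f)"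
  using continuous_on_theta_integral[OF continuous_on_dd_segment[OF assms]]
  by (simp add: mean_dd_def split_def)

lemma mean_dd_diagonal: "mean_dd e f (q, q) = dd e f q"
  by (simp add: mean_dd_def)

lemma continuous_on_dd_segment1:
  assumes "convex S" "continuous_on S (dd e f)" "q \<in> S" "q' \<in> S"
  shows "continuous_on {0..1} (\<lambda>\<theta>. dd e f (q + \<theta> *\<^sub>R (q' - q)))"
  by (rule continuous_on_compose2[OF assms(2)])
    (auto intro!: continuous_intros segment_in_convex[OF assms(1,3,4)])

lemma abs_mean_dd_le:
  assumes "convex S" "continuous_on S (dd e f)" "q \<in> S" "q' \<in> S" "\<And>p. p \<in> S \<Longrightarrow> \<bar>dd e f p\<bar> \<le> K"
  shows "\<bar>mean_dd e f (q, q')\<bar> \<le> K"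
  using abs_theta_integral_le[OF continuous_on_dd_segment1[OF assms(1-4)]] assms(5)
    segment_in_convex[OF assms(1,3,4)]
  by (simp add: mean_dd_def)

text \<open>Unlike the mean value theorem, this exact formula has coefficients that depend continuously on both end points. That
is why it can be used to pass to the limit in difference quotients.\<close>

lemma hadamard_increment:
  assumes "convex S" "q \<in> S" "q' \<in> S"
    and diff: "\<And>p. p \<in> S \<Longrightarrow> f differentiable (at p)"
    and cont: "\<And>e. e \<in> Basis \<Longrightarrow> continuous_on S (dd e f)"
  shows "f q' - f q = (\<Sum>e\<in>Basis. ((q' - q) \<bullet> e) * mean_dd e f (q, q'))"
proof -
  let ?c = "\<lambda>\<theta>. q + \<theta> *\<^sub>R (q' - q)"
  have D: "((\<lambda>\<theta>. f (?c \<theta>)) has_real_derivative (\<Sum>e\<in>Basis. ((q' - q) \<bullet> e) * dd e f (?c \<theta>))) (at \<theta>)"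
    if "\<theta> \<in> {0..1}" for \<theta>
  proof -
    have fd: "f differentiable (at (?c \<theta>))"
      using diff segment_in_convex[OF assms(1-3) that] by blast
    interpret lin: linear "\<lambda>e. dd e f (?c \<theta>)"
      using has_derivative_dd[OF fd] has_derivative_linear by blast
    have "((\<lambda>\<theta>. f (?c \<theta>)) has_derivative (\<lambda>h. dd (h *\<^sub>R (q' - q)) f (?c \<theta>))) (at \<theta>)"
      by (rule has_derivative_compose[of ?c, OF _ has_derivative_dd[OF fd]])
        (auto intro!: derivative_eq_intros)
    moreover have "(\<lambda>h. dd (h *\<^sub>R (q' - q)) f (?c \<theta>)) = (*) (dd (q' - q) f (?c \<theta>))"
    proof (rule ext)
      fix h show "dd (h *\<^sub>R (q' - q)) f (?c \<theta>) = dd (q' - q) f (?c \<theta>) * h"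
        unfolding lin.scale by simp
    qed
    ultimately have "((\<lambda>\<theta>. f (?c \<theta>)) has_real_derivative dd (q' - q) f (?c \<theta>)) (at \<theta>)"
      unfolding has_field_derivative_def by (rule has_derivative_eq_rhs)
    then show ?thesis unfolding dd_Basis_expansion[OF fd, of "q' - q"] .
  qed
  have "f (?c 1) - f (?c 0)
      = (1 - 0) * integral {0..1} (\<lambda>\<theta>. \<Sum>e\<in>Basis. ((q' - q) \<bullet> e) * dd e f (?c (0 + \<theta> * (1 - 0))))"
    by (rule diff_eq_theta_integral) (use D in simp)
  also have "\<dots> = (\<Sum>e\<in>Basis. integral {0..1} (\<lambda>\<theta>. ((q' - q) \<bullet> e) * dd e f (?c \<theta>)))"
    by (simp del: integral_mult_right, rule integral_sum)
      (auto intro!: integrable_continuous_real continuous_intros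
        continuous_on_dd_segment1[OF assms(1) cont assms(2,3)])
  finally show ?thesis by (simp add: mean_dd_def)
qed

text \<open>Banach's theorem for finite families of continuous functions with values in closed sets, in the supremum norm on
\<open>K\<close>. The iterates converge uniformly because their increments are dominated by a geometric series.\<close>

lemma contraction_fixpoint:
  fixes T :: "('i::finite \<Rightarrow> 'p::topological_space \<Rightarrow> real) \<Rightarrow> 'i \<Rightarrow> 'p \<Rightarrow> real"
    and K :: "'p set" and B :: "'i \<Rightarrow> real set"
  defines "adm \<equiv> \<lambda>y. \<forall>i. continuous_on K (y i) \<and> (\<forall>p\<in>K. y i p \<in> B i)"
  assumes "\<And>i. closed (B i)" and y0: "adm y0" and T: "\<And>y. adm y \<Longrightarrow> adm (T y)"
    and c: "0 \<le> c" "c < 1"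
    and contr: "\<And>y z D. adm y \<Longrightarrow> adm z \<Longrightarrow> 0 \<le> D \<Longrightarrow> (\<And>i p. p \<in> K \<Longrightarrow> \<bar>y i p - z i p\<bar> \<le> D)
        \<Longrightarrow> \<forall>i. \<forall>p\<in>K. \<bar>T y i p - T z i p\<bar> \<le> c * D"
    and D0: "\<And>i p. p \<in> K \<Longrightarrow> \<bar>T y0 i p - y0 i p\<bar> \<le> D0"
  shows "\<exists>y. adm y \<and> (\<forall>i. \<forall>p\<in>K. y i p = T y i p)"
proof -
  define Y where "Y n = (T ^^ n) y0" for n
  have Y0: "Y 0 = y0" and YS: "Y (Suc n) = T (Y n)" for n by (simp_all add: Y_def)
  have admY: "adm (Y n)" for n by (induction n) (auto simp: Y0 YS y0 T)
  have D0': "0 \<le> \<bar>D0\<bar>" "\<And>i p. p \<in> K \<Longrightarrow> \<bar>T y0 i p - y0 i p\<bar> \<le> \<bar>D0\<bar>"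
    by (simp, metis D0 abs_ge_self order_trans)
  have step: "\<forall>i. \<forall>p\<in>K. \<bar>Y (Suc n) i p - Y n i p\<bar> \<le> c ^ n * \<bar>D0\<bar>" for n
  proof (induction n)
    case 0
    then show ?case using D0' by (simp add: Y0 YS)
  next
    case (Suc n)
    then show ?case
      using contr[of "Y (Suc n)" "Y n" "c ^ n * \<bar>D0\<bar>"] admY[of n] admY[of "Suc n"] c
      by (simp add: YS mult.assoc)
  qed
  define y where "y i p = y0 i p + (\<Sum>n. Y (Suc n) i p - Y n i p)" for i p
  have lim: "uniform_limit K (\<lambda>n. Y n i) (y i) sequentially" for i
  proof -
    have *: "uniform_limit K (\<lambda>n p. \<Sum>m<n. Y (Suc m) i p - Y m i p) (\<lambda>p. \<Sum>m. Y (Suc m) i p - Y m i p) sequentially"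
      by (rule Weierstrass_m_test[where M="\<lambda>n. c ^ n * \<bar>D0\<bar>"])
        (use step c in \<open>auto intro!: summable_mult2 summable_geometric\<close>)
    have "uniform_limit K (\<lambda>n p. Y n i p - y0 i p) (\<lambda>p. \<Sum>m. Y (Suc m) i p - Y m i p) sequentially"
    proof -
      have "(\<Sum>m<n. Y (Suc m) i p - Y m i p) = Y n i p - y0 i p" for n p
        using sum_lessThan_telescope[of "\<lambda>m. Y m i p" n] by (simp add: Y0)
      with * show ?thesis by simp
    qed
    then have "uniform_limit K (\<lambda>n p. y0 i p + (Y n i p - y0 i p))
        (\<lambda>p. y0 i p + (\<Sum>m. Y (Suc m) i p - Y m i p)) sequentially"
      by (intro uniform_limit_add) (simp_all add: uniform_limit_const)
    then show ?thesis by (simp add: y_def[abs_def])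
  qed
  have "continuous_on K (y i)" for i
    using admY by (intro uniform_limit_theorem[OF _ lim]) (auto simp: adm_def)
  moreover have "y i p \<in> B i" if "p \<in> K" for i p
  proof (rule closed_sequentially[OF assms(2), of "\<lambda>n. Y n i p"])
    show "Y n i p \<in> B i" for n using admY[of n] that by (simp add: adm_def)
    show "(\<lambda>n. Y n i p) \<longlonglongrightarrow> y i p" by (rule tendsto_uniform_limitI[OF lim that])
  qed
  ultimately have adm: "adm y" by (auto simp: adm_def)
  have "\<bar>y i p - T y i p\<bar> \<le> e" if "e > 0" "p \<in> K" for i p e
  proof -
    let ?e = "e / 2"
    have "\<forall>\<^sub>F n in sequentially. \<forall>i. \<forall>p\<in>K. \<bar>Y n i p - y i p\<bar> < ?e"
      using uniform_limitD[OF lim, of ?e] that by (intro eventually_all_finite) (auto simp: dist_real_def)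
    then obtain N where N: "\<And>n. n \<ge> N \<Longrightarrow> \<forall>i. \<forall>p\<in>K. \<bar>Y n i p - y i p\<bar> < ?e"
      by (auto simp: eventually_sequentially)
    have "\<bar>T (Y N) i p - T y i p\<bar> \<le> c * ?e"
      using contr[OF admY adm, of ?e N] N[of N] that by (force intro: less_imp_le)
    moreover have "c * ?e \<le> ?e" using c that by (simp add: mult_le_cancel_right1)
    moreover have "\<bar>Y (Suc N) i p - y i p\<bar> < ?e" using N[of "Suc N"] that by auto
    ultimately show ?thesis unfolding YS by linarith
  qed
  then have "y i p = T y i p" if "p \<in> K" for i p
    using that by (metis abs_le_zero_iff dense_ge eq_iff_diff_eq_0)
  with adm show ?thesis by blast
qed

lemma zero_if_contracted:
  fixes y :: "'i::finite \<Rightarrow> 'p::topological_space \<Rightarrow> real"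
  assumes "compact K" "\<And>i. continuous_on K (y i)" "0 \<le> c" "c < 1"
    and contr: "\<And>D. 0 \<le> D \<Longrightarrow> (\<And>i p. p \<in> K \<Longrightarrow> \<bar>y i p\<bar> \<le> D) \<Longrightarrow> \<forall>i. \<forall>p\<in>K. \<bar>y i p\<bar> \<le> c * D"
    and "p \<in> K"
  shows "y i p = 0"
proof -
  have "\<forall>i. \<exists>C. \<forall>p\<in>K. \<bar>y i p\<bar> \<le> C"
    using compact_imp_bounded[OF compact_continuous_image[OF assms(2,1)]] by (auto simp: bounded_iff)
  then obtain C where C: "\<And>i p. p \<in> K \<Longrightarrow> \<bar>y i p\<bar> \<le> C i" by metis
  define D where "D = (\<Sum>i\<in>UNIV. \<bar>C i\<bar>)"
  have "\<bar>C i\<bar> \<le> D" for i unfolding D_def by (intro member_le_sum) auto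
  then have D: "\<And>i p. p \<in> K \<Longrightarrow> \<bar>y i p\<bar> \<le> D"
    using C by (meson abs_ge_self order_trans)
  have "D \<ge> 0" by (simp add: D_def sum_nonneg)
  have "\<forall>i. \<forall>p\<in>K. \<bar>y i p\<bar> \<le> c ^ n * D" for n
  proof (induction n)
    case (Suc n)
    then show ?case using contr[of "c ^ n * D"] \<open>D \<ge> 0\<close> assms(3) by (simp add: mult.assoc)
  qed (use D in simp)
  then have "\<bar>y i p\<bar> \<le> c ^ n * D" for n using assms(6) by blast
  moreover have "(\<lambda>n. c ^ n * D) \<longlonglongrightarrow> 0 * D"
    using assms(3,4) by (intro tendsto_mult_right LIMSEQ_power_zero) auto
  ultimately have "\<bar>y i p\<bar> \<le> 0 * D"
    by (intro LIMSEQ_le_const[of "\<lambda>n. c ^ n * D"]) auto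
  then show ?thesis by simp
qed


lemma linear_integral_contraction:
  fixes M :: "'i::finite \<Rightarrow> 'i \<Rightarrow> real \<Rightarrow> real" and v :: "'i \<Rightarrow> real \<Rightarrow> real"
  assumes "\<And>i j. continuous_on {-\<rho>..\<rho>} (M i j)" "\<And>j. continuous_on {-\<rho>..\<rho>} (v j)"
    and "\<And>i t. t \<in> {-\<rho>..\<rho>} \<Longrightarrow> (\<Sum>j\<in>UNIV. \<bar>M i j t\<bar>) \<le> \<kappa>"
    and "\<And>j t. t \<in> {-\<rho>..\<rho>} \<Longrightarrow> \<bar>v j t\<bar> \<le> D" and "0 \<le> D" "0 \<le> \<kappa>" "t \<in> {-\<rho>..\<rho>}"
  shows "\<bar>t * integral {0..1} (\<lambda>\<theta>. \<Sum>j\<in>UNIV. M i j (\<theta> * t) * v j (\<theta> * t))\<bar> \<le> \<rho> * \<kappa> * D"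
proof -
  have "\<bar>integral {0..1} (\<lambda>\<theta>. \<Sum>j\<in>UNIV. M i j (\<theta> * t) * v j (\<theta> * t))\<bar> \<le> \<kappa> * D"
  proof (rule abs_theta_integral_le)
    show "continuous_on {0..1} (\<lambda>\<theta>. \<Sum>j\<in>UNIV. M i j (\<theta> * t) * v j (\<theta> * t))"
      using theta_in(2)[OF _ assms(7)]
      by (intro continuous_intros continuous_on_compose2[OF assms(1)] continuous_on_compose2[OF assms(2)]) auto
    fix \<theta> :: real assume th: "\<theta> \<in> {0..1}"
    have in_r: "\<theta> * t \<in> {-\<rho>..\<rho>}" using theta_in(2)[OF th assms(7)] .
    have "\<bar>\<Sum>j\<in>UNIV. M i j (\<theta> * t) * v j (\<theta> * t)\<bar> \<le> (\<Sum>j\<in>UNIV. \<bar>M i j (\<theta> * t)\<bar> * D)"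
      by (rule order_trans[OF sum_abs sum_mono])
        (simp add: abs_mult mult_left_mono assms(4)[OF in_r])
    also have "\<dots> = (\<Sum>j\<in>UNIV. \<bar>M i j (\<theta> * t)\<bar>) * D" by (simp add: sum_distrib_right)
    also have "\<dots> \<le> \<kappa> * D" using assms(3)[OF in_r] assms(5) by (rule mult_right_mono)
    finally show "\<bar>\<Sum>j\<in>UNIV. M i j (\<theta> * t) * v j (\<theta> * t)\<bar> \<le> \<kappa> * D" .
  qed
  moreover have "\<bar>t\<bar> \<le> \<rho>" "0 \<le> \<rho>" using assms(7) by auto
  ultimately show ?thesis
    using mult_mono[of "\<bar>t\<bar>" \<rho> "\<bar>integral {0..1} (\<lambda>\<theta>. \<Sum>j\<in>UNIV. M i j (\<theta> * t) * v j (\<theta> * t))\<bar>" "\<kappa> * D"]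
    by (simp add: abs_mult mult.assoc)
qed

lemma continuous_on_param_theta_integral:
  fixes g :: "'p::topological_space \<times> real \<Rightarrow> real"
  assumes "continuous_on (P \<times> {-\<rho>..\<rho>}) g"
  shows "continuous_on (P \<times> {-\<rho>..\<rho>}) (\<lambda>(p, t). integral {0..1} (\<lambda>\<theta>. g (p, \<theta> * t)))"
  unfolding split_def
proof (rule continuous_on_theta_integral)
  show "continuous_on ((P \<times> {-\<rho>..\<rho>}) \<times> {0..1}) (\<lambda>(q, \<theta>). g (fst q, \<theta> * snd q))"
    unfolding split_def
    by (rule continuous_on_compose2[OF assms])
      (use theta_in(2) in \<open>auto intro!: continuous_intros\<close>)
qed

lemma linear_integral_equation_solvable:
  fixes M :: "'i::finite \<Rightarrow> 'i \<Rightarrow> 'p::topological_space \<times> real \<Rightarrow> real"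
  assumes "compact P" "0 < \<rho>"
    and M: "\<And>i j. continuous_on (P \<times> {-\<rho>..\<rho>}) (M i j)"
    and b: "\<And>i. continuous_on (P \<times> {-\<rho>..\<rho>}) (b i)"
    and \<kappa>: "\<And>i q. q \<in> P \<times> {-\<rho>..\<rho>} \<Longrightarrow> (\<Sum>j\<in>UNIV. \<bar>M i j q\<bar>) \<le> \<kappa>" "0 \<le> \<kappa>" "\<rho> * \<kappa> < 1"
  shows "\<exists>y. (\<forall>i. continuous_on (P \<times> {-\<rho>..\<rho>}) (y i)) \<and>
     (\<forall>i. \<forall>p\<in>P. \<forall>t\<in>{-\<rho>..\<rho>}. y i (p, t) = d i + t * integral {0..1}
        (\<lambda>\<theta>. (\<Sum>j\<in>UNIV. M i j (p, \<theta> * t) * y j (p, \<theta> * t)) + b i (p, \<theta> * t)))"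
proof -
  let ?K = "P \<times> {-\<rho>..\<rho>}"
  define G where "G y i q = (\<Sum>j\<in>UNIV. M i j q * y j q) + b i q" for y i q
  define T where "T y i = (\<lambda>(p, t). d i + t * integral {0..1} (\<lambda>\<theta>. G y i (p, \<theta> * t)))" for y i
  have cG: "continuous_on ?K (G y i)" if "\<forall>i. continuous_on ?K (y i)" for y i
    unfolding G_def using that by (intro continuous_intros M b) auto
  have cT: "continuous_on ?K (T y i)" if "\<forall>i. continuous_on ?K (y i)" for y i
    using continuous_on_param_theta_integral[OF cG[OF that]]
    unfolding T_def split_def by (intro continuous_intros) auto
  have row: "continuous_on {-\<rho>..\<rho>} (\<lambda>t. g (p, t))" if "continuous_on ?K g" "p \<in> P" for g :: "'p \<times> real \<Rightarrow> real" and p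
    by (rule continuous_on_compose2[OF that(1)]) (use that(2) in \<open>auto intro!: continuous_intros\<close>)
  have rowth: "continuous_on {0..1} (\<lambda>\<theta>. g (p, \<theta> * t))"
    if "continuous_on ?K g" "p \<in> P" "t \<in> {-\<rho>..\<rho>}" for g :: "'p \<times> real \<Rightarrow> real" and p t
    by (rule continuous_on_compose2[OF row[OF that(1,2)]])
      (use theta_in(2)[OF _ that(3)] in \<open>auto intro!: continuous_intros\<close>)
  have "compact (T (\<lambda>_ _. 0) i ` ?K)" for i
    using assms(1) by (intro compact_continuous_image cT compact_Times) auto
  then have "\<forall>i. \<exists>C. \<forall>q\<in>?K. \<bar>T (\<lambda>_ _. 0) i q\<bar> \<le> C"
    using compact_imp_bounded by (fastforce simp: bounded_iff)
  then obtain C where C: "\<And>i q. q \<in> ?K \<Longrightarrow> \<bar>T (\<lambda>_ _. 0) i q\<bar> \<le> C i" by metis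
  have CD: "C i \<le> (\<Sum>i\<in>UNIV. \<bar>C i\<bar>)" for i
    by (rule order_trans[OF abs_ge_self]) (intro member_le_sum, auto)
  have "\<exists>y. (\<forall>i. continuous_on ?K (y i) \<and> (\<forall>q\<in>?K. y i q \<in> UNIV)) \<and> (\<forall>i. \<forall>q\<in>?K. y i q = T y i q)"
  proof (rule contraction_fixpoint[where ?y0.0="\<lambda>_ _. 0" and c="\<rho> * \<kappa>" and ?D0.0="\<Sum>i\<in>UNIV. \<bar>C i\<bar>"])
    fix y z :: "'i \<Rightarrow> 'p \<times> real \<Rightarrow> real" and D :: real
    assume y: "\<forall>i. continuous_on ?K (y i) \<and> (\<forall>q\<in>?K. y i q \<in> UNIV)"
      and z: "\<forall>i. continuous_on ?K (z i) \<and> (\<forall>q\<in>?K. z i q \<in> UNIV)"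
      and D: "0 \<le> D" "\<And>i q. q \<in> ?K \<Longrightarrow> \<bar>y i q - z i q\<bar> \<le> D"
    show "\<forall>i. \<forall>q\<in>?K. \<bar>T y i q - T z i q\<bar> \<le> \<rho> * \<kappa> * D"
    proof (intro allI ballI)
      fix i q assume "q \<in> ?K"
      then obtain p t where q: "q = (p, t)" "p \<in> P" "t \<in> {-\<rho>..\<rho>}" by auto
      have "T y i q - T z i q = t * (integral {0..1} (\<lambda>\<theta>. G y i (p, \<theta> * t)) - integral {0..1} (\<lambda>\<theta>. G z i (p, \<theta> * t)))"
        by (simp add: T_def q algebra_simps)
      also have "\<dots> = t * integral {0..1} (\<lambda>\<theta>. G y i (p, \<theta> * t) - G z i (p, \<theta> * t))"
        using y z q by (subst integral_diff) (auto intro!: integrable_continuous_real rowth cG)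
      also have "(\<lambda>\<theta>. G y i (p, \<theta> * t) - G z i (p, \<theta> * t))
          = (\<lambda>\<theta>. \<Sum>j\<in>UNIV. M i j (p, \<theta> * t) * (y j (p, \<theta> * t) - z j (p, \<theta> * t)))"
        by (simp add: G_def fun_eq_iff sum_subtractf algebra_simps)
      finally have eq: "T y i q - T z i q = t * integral {0..1}
          (\<lambda>\<theta>. \<Sum>j\<in>UNIV. M i j (p, \<theta> * t) * (y j (p, \<theta> * t) - z j (p, \<theta> * t)))" .
      show "\<bar>T y i q - T z i q\<bar> \<le> \<rho> * \<kappa> * D"
        unfolding eq
      proof (rule linear_integral_contraction[of \<rho> "\<lambda>i j t. M i j (p, t)" "\<lambda>j t. y j (p, t) - z j (p, t)" \<kappa> D t i])
        show "continuous_on {-\<rho>..\<rho>} (\<lambda>t. M i j (p, t))" for i j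
          using row[OF M q(2)] .
        show "continuous_on {-\<rho>..\<rho>} (\<lambda>t. y j (p, t) - z j (p, t))" for j
          using y z q(2) by (intro continuous_intros row) auto
      qed (use q D \<kappa> in auto)
    qed
  next
    fix i q assume "q \<in> ?K"
    then show "\<bar>T (\<lambda>_ _. 0) i q - 0\<bar> \<le> (\<Sum>i\<in>UNIV. \<bar>C i\<bar>)"
      using order_trans[OF C CD] by simp
  qed (use assms cT in \<open>auto intro!: mult_nonneg_nonneg\<close>)
  then obtain y where y: "\<forall>i. continuous_on ?K (y i)" "\<And>i q. q \<in> ?K \<Longrightarrow> y i q = T y i q" by blast
  have "y i (p, t) = d i + t * integral {0..1}
        (\<lambda>\<theta>. (\<Sum>j\<in>UNIV. M i j (p, \<theta> * t) * y j (p, \<theta> * t)) + b i (p, \<theta> * t))"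
    if "p \<in> P" "t \<in> {-\<rho>..\<rho>}" for i p t
    using y(2)[of "(p, t)" i] that unfolding T_def G_def by simp
  with y(1) show ?thesis by blast
qed

text \<open>Differentiability with respect to the parameter \<open>x\<close> for the solution of an integral equation in \<open>t\<close>.
If the increment of \<open>y\<close> between \<open>x\<close> and \<open>x'\<close> solves a linear equation whose coefficients are
continuous in \<open>(x, x', t)\<close> up to the diagonal, as Hadamard's formula provides, then so does the difference
quotient for \<open>x \<noteq> x'\<close>. The linear equation has a solution \<open>Q\<close> that is continuous in all variables,
including the diagonal, and uniqueness identifies \<open>Q\<close> with the difference quotient. So the derivative exists
and is the value of \<open>Q\<close> on the diagonal.\<close>

lemma parameter_derivative_of_integral_equation:
  fixes y :: "'i::finite \<Rightarrow> real \<times> real \<Rightarrow> real" and r :: real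
    and M :: "'i \<Rightarrow> 'i \<Rightarrow> (real \<times> real) \<times> real \<Rightarrow> real"
  defines "I \<equiv> {-r<..<r}"
  assumes y: "\<And>i. continuous_on (I \<times> I) (y i)"
    and M: "\<And>i j. continuous_on ((I \<times> I) \<times> I) (M i j)"
    and b: "\<And>i. continuous_on ((I \<times> I) \<times> I) (b i)"
    and \<kappa>: "\<And>i q. q \<in> (I \<times> I) \<times> I \<Longrightarrow> (\<Sum>j\<in>UNIV. \<bar>M i j q\<bar>) \<le> \<kappa>" "0 \<le> \<kappa>" "r * \<kappa> < 1"
    and incr: "\<And>i x x' t. x \<in> I \<Longrightarrow> x' \<in> I \<Longrightarrow> t \<in> I \<Longrightarrow>
        y i (x', t) - y i (x, t) = (x' - x) * \<alpha> i + t * integral {0..1}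
          (\<lambda>\<theta>. (\<Sum>j\<in>UNIV. M i j ((x, x'), \<theta> * t) * (y j (x', \<theta> * t) - y j (x, \<theta> * t)))
                + (x' - x) * b i ((x, x'), \<theta> * t))"
  shows "\<exists>S. (\<forall>i. continuous_on (I \<times> I) (S i)) \<and>
    (\<forall>i. \<forall>x\<in>I. \<forall>t\<in>I. ((\<lambda>x. y i (x, t)) has_real_derivative S i (x, t)) (at x) \<and>
       S i (x, t) = \<alpha> i + t * integral {0..1}
          (\<lambda>\<theta>. (\<Sum>j\<in>UNIV. M i j ((x, x), \<theta> * t) * S j (x, \<theta> * t)) + b i ((x, x), \<theta> * t)))"
proof -
  define S where "S i = (\<lambda>(x, t). deriv (\<lambda>x. y i (x, t)) x)" for i
  have main: "\<exists>Q. (\<forall>i. continuous_on (({-\<rho>..\<rho>} \<times> {-\<rho>..\<rho>}) \<times> {-\<rho>..\<rho>}) (Q i)) \<and>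
     (\<forall>i. \<forall>x\<in>{-\<rho><..<\<rho>}. \<forall>t\<in>{-\<rho><..<\<rho>}.
        ((\<lambda>x. y i (x, t)) has_real_derivative Q i ((x, x), t)) (at x) \<and>
        Q i ((x, x), t) = \<alpha> i + t * integral {0..1}
          (\<lambda>\<theta>. (\<Sum>j\<in>UNIV. M i j ((x, x), \<theta> * t) * Q j ((x, x), \<theta> * t)) + b i ((x, x), \<theta> * t)))"
    if \<rho>: "0 < \<rho>" "\<rho> < r" for \<rho>
  proof -
    let ?C = "{-\<rho>..\<rho>}"
    have CI: "?C \<subseteq> I" using \<rho> by (auto simp: I_def)
    have CI3: "(?C \<times> ?C) \<times> ?C \<subseteq> (I \<times> I) \<times> I" using CI by blast
    have \<rho>\<kappa>: "\<rho> * \<kappa> < 1" using \<kappa>(2,3) \<rho> by (meson less_imp_le mult_right_mono order_le_less_trans)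
    have "\<exists>Q. (\<forall>i. continuous_on ((?C \<times> ?C) \<times> ?C) (Q i)) \<and>
     (\<forall>i. \<forall>p\<in>?C \<times> ?C. \<forall>t\<in>?C. Q i (p, t) = \<alpha> i + t * integral {0..1}
        (\<lambda>\<theta>. (\<Sum>j\<in>UNIV. M i j (p, \<theta> * t) * Q j (p, \<theta> * t)) + b i (p, \<theta> * t)))"
      by (rule linear_integral_equation_solvable[where \<kappa>=\<kappa>])
        (use \<rho> \<rho>\<kappa> \<kappa>(2) \<kappa>(1)[OF subsetD[OF CI3]] in
          \<open>auto intro!: compact_Times continuous_on_subset[OF M CI3] continuous_on_subset[OF b CI3]\<close>)
    then obtain Q where Q: "\<And>i. continuous_on ((?C \<times> ?C) \<times> ?C) (Q i)"
      and Qeq: "\<And>i x x' t. x \<in> ?C \<Longrightarrow> x' \<in> ?C \<Longrightarrow> t \<in> ?C \<Longrightarrow> Q i ((x, x'), t) = \<alpha> i + t * integral {0..1}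
        (\<lambda>\<theta>. (\<Sum>j\<in>UNIV. M i j ((x, x'), \<theta> * t) * Q j ((x, x'), \<theta> * t)) + b i ((x, x'), \<theta> * t))"
      by blast
    have row: "continuous_on ?C (\<lambda>t. g ((x, x'), t))" if "continuous_on ((?C \<times> ?C) \<times> ?C) g" "x \<in> ?C" "x' \<in> ?C"
      for g :: "(real \<times> real) \<times> real \<Rightarrow> real" and x x'
      by (rule continuous_on_compose2[OF that(1)]) (use that(2,3) in \<open>auto intro!: continuous_intros\<close>)
    have rowy: "continuous_on ?C (\<lambda>t. y i (x, t))" if "x \<in> ?C" for x i
      by (rule continuous_on_compose2[OF y]) (use that CI in \<open>auto intro!: continuous_intros\<close>)
    have th: "continuous_on {0..1} (\<lambda>\<theta>. g (\<theta> * t))" if "continuous_on ?C g" "t \<in> ?C" for g :: "real \<Rightarrow> real" and t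
      by (rule continuous_on_compose2[OF that(1)])
        (use theta_in(2)[OF _ that(2)] in \<open>auto intro!: continuous_intros\<close>)
    have M': "continuous_on ((?C \<times> ?C) \<times> ?C) (M i j)" "continuous_on ((?C \<times> ?C) \<times> ?C) (b i)" for i j
      using CI by (auto intro!: continuous_on_subset[OF M] continuous_on_subset[OF b])
    have quot: "y i (x', t) - y i (x, t) = (x' - x) * Q i ((x, x'), t)"
      if x: "x \<in> ?C" "x' \<in> ?C" "t \<in> ?C" for i x x' t
    proof -
      \<comment> \<open>The defect \<open>E\<close> of the claimed identity solves a homogeneous linear equation.\<close>
      define E where "E i t = (y i (x', t) - y i (x, t)) - (x' - x) * Q i ((x, x'), t)" for i t
      have cE: "continuous_on ?C (E i)" for i
        unfolding E_def by (intro continuous_intros rowy row Q x)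
      have Eeq: "E i t = t * integral {0..1} (\<lambda>\<theta>. \<Sum>j\<in>UNIV. M i j ((x, x'), \<theta> * t) * E j (\<theta> * t))"
        if t: "t \<in> ?C" for i t
      proof -
        let ?A = "\<lambda>\<theta>. (\<Sum>j\<in>UNIV. M i j ((x, x'), \<theta> * t) * (y j (x', \<theta> * t) - y j (x, \<theta> * t)))
                + (x' - x) * b i ((x, x'), \<theta> * t)"
        let ?B = "\<lambda>\<theta>. (\<Sum>j\<in>UNIV. M i j ((x, x'), \<theta> * t) * Q j ((x, x'), \<theta> * t)) + b i ((x, x'), \<theta> * t)"
        note cont = th[OF row[OF M'(1) x(1,2)] t] th[OF row[OF M'(2) x(1,2)] t]
          th[OF row[OF Q x(1,2)] t] th[OF rowy[OF x(1)] t] th[OF rowy[OF x(2)] t]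
        have int: "?A integrable_on {0..1}"
          by (intro integrable_continuous_real continuous_intros cont)
        have int': "(\<lambda>\<theta>. (x' - x) * ?B \<theta>) integrable_on {0..1}"
          by (intro integrable_continuous_real continuous_intros cont)
        have "E i t = t * (integral {0..1} ?A - (x' - x) * integral {0..1} ?B)"
          unfolding E_def 
          using incr[OF subsetD[OF CI x(1)] subsetD[OF CI x(2)] subsetD[OF CI t], of i] Qeq[OF x(1,2) t, of i]
          by (simp add: algebra_simps)
        also have "\<dots> = t * integral {0..1} (\<lambda>\<theta>. ?A \<theta> - (x' - x) * ?B \<theta>)"
          using integral_diff[OF int int'] by (simp only: integral_mult_right)
        also have "(\<lambda>\<theta>. ?A \<theta> - (x' - x) * ?B \<theta>) = (\<lambda>\<theta>. \<Sum>j\<in>UNIV. M i j ((x, x'), \<theta> * t) * E j (\<theta> * t))"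
          by (simp add: fun_eq_iff E_def algebra_simps sum_subtractf sum.distrib sum_distrib_left)
        finally show ?thesis .
      qed
      have "E i t = 0"
      proof (rule zero_if_contracted[where y=E and p=t and K="?C" and c="\<rho> * \<kappa>"])
        fix D :: real assume D: "0 \<le> D" "\<And>i t. t \<in> ?C \<Longrightarrow> \<bar>E i t\<bar> \<le> D"
        show "\<forall>i. \<forall>t\<in>?C. \<bar>E i t\<bar> \<le> \<rho> * \<kappa> * D"
        proof (intro allI ballI)
          fix i t assume t: "t \<in> ?C"
          show "\<bar>E i t\<bar> \<le> \<rho> * \<kappa> * D"
            unfolding Eeq[OF t]
            by (rule linear_integral_contraction[of \<rho> "\<lambda>i j t. M i j ((x, x'), t)" E \<kappa> D t i])
              (use row[OF M'(1) x(1,2)] cE \<kappa>(2) \<kappa>(1)[OF subsetD[OF CI3]] x D t in auto)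
        qed
      qed (use cE \<rho> \<kappa> \<rho>\<kappa> x in auto)
      then show ?thesis by (simp add: E_def)
    qed
    have der: "((\<lambda>x. y i (x, t)) has_real_derivative Q i ((x, x), t)) (at x)"
      if x: "x \<in> {-\<rho><..<\<rho>}" "t \<in> {-\<rho><..<\<rho>}" for i x t
    proof -
      have "continuous_on ?C (\<lambda>x'. Q i ((x, x'), t))"
        by (rule continuous_on_compose2[OF Q]) (use x in \<open>auto intro!: continuous_intros\<close>)
      then have "isCont (\<lambda>x'. Q i ((x, x'), t)) x"
        using x by (auto intro!: continuous_on_interior)
      then have "((\<lambda>x'. Q i ((x, x'), t)) \<longlongrightarrow> Q i ((x, x), t)) (at x)"
        by (simp add: isCont_def)
      then have "((\<lambda>x'. (y i (x', t) - y i (x, t)) / (x' - x)) \<longlongrightarrow> Q i ((x, x), t)) (at x)"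
        by (rule Lim_transform_within_open[where s="{-\<rho><..<\<rho>}"]) (use x quot in auto)
      then show ?thesis by (simp add: has_field_derivative_iff)
    qed
    show ?thesis
      by (intro exI[of _ Q] conjI allI ballI Q der Qeq) auto
  qed
  have S_eq: "(\<forall>i. continuous_on ({-\<rho><..<\<rho>} \<times> {-\<rho><..<\<rho>}) (S i)) \<and>
     (\<forall>i. \<forall>x\<in>{-\<rho><..<\<rho>}. \<forall>t\<in>{-\<rho><..<\<rho>}.
        ((\<lambda>x. y i (x, t)) has_real_derivative S i (x, t)) (at x) \<and>
        S i (x, t) = \<alpha> i + t * integral {0..1}
          (\<lambda>\<theta>. (\<Sum>j\<in>UNIV. M i j ((x, x), \<theta> * t) * S j (x, \<theta> * t)) + b i ((x, x), \<theta> * t)))"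
    if \<rho>: "0 < \<rho>" "\<rho> < r" for \<rho>
  proof -
    let ?J = "{-\<rho><..<\<rho>}"
    obtain Q where Q: "\<And>i. continuous_on (({-\<rho>..\<rho>} \<times> {-\<rho>..\<rho>}) \<times> {-\<rho>..\<rho>}) (Q i)"
      and Qd: "\<And>i x t. x \<in> ?J \<Longrightarrow> t \<in> ?J \<Longrightarrow> ((\<lambda>x. y i (x, t)) has_real_derivative Q i ((x, x), t)) (at x)"
      and Qe: "\<And>i x t. x \<in> ?J \<Longrightarrow> t \<in> ?J \<Longrightarrow> Q i ((x, x), t) = \<alpha> i + t * integral {0..1}
          (\<lambda>\<theta>. (\<Sum>j\<in>UNIV. M i j ((x, x), \<theta> * t) * Q j ((x, x), \<theta> * t)) + b i ((x, x), \<theta> * t))"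
      using main[OF \<rho>] by blast
    have SQ: "S i (x, t) = Q i ((x, x), t)" if "x \<in> ?J" "t \<in> ?J" for i x t
      using DERIV_imp_deriv[OF Qd[OF that]] by (simp add: S_def)
    have "continuous_on (?J \<times> ?J) (\<lambda>q. Q i ((fst q, fst q), snd q))" for i
      by (rule continuous_on_compose2[OF Q]) (auto intro!: continuous_intros)
    then have "continuous_on (?J \<times> ?J) (S i)" for i
      by (rule continuous_on_eq) (auto simp: SQ)
    moreover have "S i (x, t) = \<alpha> i + t * integral {0..1}
          (\<lambda>\<theta>. (\<Sum>j\<in>UNIV. M i j ((x, x), \<theta> * t) * S j (x, \<theta> * t)) + b i ((x, x), \<theta> * t))"
      if "x \<in> ?J" "t \<in> ?J" for i x t
      unfolding SQ[OF that] Qe[OF that]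
      by (intro arg_cong2[where f="(+)"] arg_cong2[where f="(*)"] refl Henstock_Kurzweil_Integration.integral_cong)
        (simp add: SQ[OF that(1) theta_in(1)[OF _ that(2)]])
    ultimately show ?thesis using Qd SQ by auto
  qed
  have ex: "\<exists>\<rho>. 0 < \<rho> \<and> \<rho> < r \<and> x \<in> {-\<rho><..<\<rho>} \<and> t \<in> {-\<rho><..<\<rho>}" if "x \<in> I" "t \<in> I" for x t
  proof -
    have "max \<bar>x\<bar> \<bar>t\<bar> < r" using that by (simp add: I_def abs_less_iff)
    then obtain \<rho> where \<rho>: "max \<bar>x\<bar> \<bar>t\<bar> < \<rho>" "\<rho> < r" using dense by blast
    then have "\<bar>x\<bar> < \<rho>" "\<bar>t\<bar> < \<rho>" by auto
    then have "0 < \<rho>" "x \<in> {-\<rho><..<\<rho>}" "t \<in> {-\<rho><..<\<rho>}" by auto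
    with \<rho>(2) show ?thesis by blast
  qed
  have "continuous (at q) (S i)" if qI: "q \<in> I \<times> I" for q i
  proof -
    obtain x t where q: "q = (x, t)" "x \<in> I" "t \<in> I" using qI by auto
    obtain \<rho> where \<rho>: "0 < \<rho>" "\<rho> < r" "x \<in> {-\<rho><..<\<rho>}" "t \<in> {-\<rho><..<\<rho>}" using ex q by blast
    show ?thesis
      using S_eq[OF \<rho>(1,2)] \<rho>(3,4) q
      by (auto simp: continuous_on_eq_continuous_at open_Times)
  qed
  then have "\<forall>i. continuous_on (I \<times> I) (S i)"
    by (simp add: continuous_at_imp_continuous_on)
  moreover have "\<forall>i. \<forall>x\<in>I. \<forall>t\<in>I. ((\<lambda>x. y i (x, t)) has_real_derivative S i (x, t)) (at x) \<and>
       S i (x, t) = \<alpha> i + t * integral {0..1}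
          (\<lambda>\<theta>. (\<Sum>j\<in>UNIV. M i j ((x, x), \<theta> * t) * S j (x, \<theta> * t)) + b i ((x, x), \<theta> * t))"
  proof (intro allI ballI)
    fix i x t assume "x \<in> I" "t \<in> I"
    then obtain \<rho> where \<rho>: "0 < \<rho>" "\<rho> < r" "x \<in> {-\<rho><..<\<rho>}" "t \<in> {-\<rho><..<\<rho>}" using ex by blast
    from bspec[OF bspec[OF spec[OF conjunct2[OF S_eq[OF \<rho>(1,2)]], of i] \<rho>(3)] \<rho>(4)]
    show "((\<lambda>x. y i (x, t)) has_real_derivative S i (x, t)) (at x) \<and>
       S i (x, t) = \<alpha> i + t * integral {0..1}
          (\<lambda>\<theta>. (\<Sum>j\<in>UNIV. M i j ((x, x), \<theta> * t) * S j (x, \<theta> * t)) + b i ((x, x), \<theta> * t))" .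
  qed
  ultimately show ?thesis by blast
qed

section \<open>Regularity of linear integral equations with a parameter\<close>

text \<open>Averages along segments from 0 stay inside such a set; both open and closed intervals around 0 are used.\<close>

definition theta_closed :: "real set \<Rightarrow> bool" where
  "theta_closed I \<longleftrightarrow> (\<forall>\<theta>\<in>{0..1}. \<forall>s\<in>I. \<theta> * s \<in> I)"

lemma theta_closed_intervals [simp]: "theta_closed {-r<..<r}" "theta_closed {-r..r}"
  using theta_in by (auto simp: theta_closed_def)

text \<open>\<open>x * mean_x f (x, t)\<close> is the primitive of \<open>f\<close> in \<open>x\<close> that vanishes at \<open>x = 0\<close>.\<close>

definition mean_x :: "(real \<times> real \<Rightarrow> real) \<Rightarrow> real \<times> real \<Rightarrow> real" where
  "mean_x f = (\<lambda>(x, t). integral {0..1} (\<lambda>\<theta>. f (\<theta> * x, t)))"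

definition mean_t :: "(real \<times> real \<Rightarrow> real) \<Rightarrow> real \<times> real \<Rightarrow> real" where
  "mean_t f = (\<lambda>(x, t). integral {0..1} (\<lambda>\<theta>. f (x, \<theta> * t)))"

lemma continuous_on_mean:
  assumes "theta_closed I" "continuous_on (I \<times> I) f"
  shows "continuous_on (I \<times> I) (mean_x f)" "continuous_on (I \<times> I) (mean_t f)"
  unfolding mean_x_def mean_t_def split_def using assms(1)
  by (auto intro!: continuous_on_theta_integral continuous_intros continuous_on_compose2[OF assms(2)]
      simp: split_def theta_closed_def)

lemma continuous_on_theta_slice:
  assumes "theta_closed I" "continuous_on (I \<times> I) f" "x \<in> I" "t \<in> I"
  shows "continuous_on {0..1} (\<lambda>\<theta>. f (\<theta> * x, t))" "continuous_on {0..1} (\<lambda>\<theta>. f (x, \<theta> * t))"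
  using assms(1,3,4) by (auto intro!: continuous_intros continuous_on_compose2[OF assms(2)] simp: theta_closed_def)

lemma abs_mean_le:
  assumes "theta_closed I" "continuous_on (I \<times> I) f" "q \<in> I \<times> I" "\<And>q. q \<in> I \<times> I \<Longrightarrow> \<bar>f q\<bar> \<le> D"
  shows "\<bar>mean_x f q\<bar> \<le> D" "\<bar>mean_t f q\<bar> \<le> D"
proof -
  obtain x t where q: "q = (x, t)" "x \<in> I" "t \<in> I" using assms(3) by auto
  show "\<bar>mean_x f q\<bar> \<le> D" unfolding mean_x_def q(1) split
    using assms(1,4) q by (intro abs_theta_integral_le continuous_on_theta_slice(1)[OF assms(1,2)])
      (auto simp: theta_closed_def)
  show "\<bar>mean_t f q\<bar> \<le> D" unfolding mean_t_def q(1) split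
    using assms(1,4) q by (intro abs_theta_integral_le continuous_on_theta_slice(2)[OF assms(1,2)])
      (auto simp: theta_closed_def)
qed

lemma mean_diff:
  assumes "theta_closed I" "continuous_on (I \<times> I) f" "continuous_on (I \<times> I) g" "q \<in> I \<times> I"
  shows "mean_x f q - mean_x g q = mean_x (\<lambda>q. f q - g q) q"
    and "mean_t f q - mean_t g q = mean_t (\<lambda>q. f q - g q) q"
proof -
  obtain x t where q: "q = (x, t)" "x \<in> I" "t \<in> I" using assms(4) by auto
  show "mean_x f q - mean_x g q = mean_x (\<lambda>q. f q - g q) q"
    and "mean_t f q - mean_t g q = mean_t (\<lambda>q. f q - g q) q"
    unfolding mean_x_def mean_t_def q(1) split
    by (simp_all add: integral_diff integrable_continuous_real
        continuous_on_theta_slice[OF assms(1,2) q(2,3)] continuous_on_theta_slice[OF assms(1,3) q(2,3)])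
qed

lemma primitive_has_derivative:
  fixes f :: "real \<times> real \<Rightarrow> real" and r :: real
  defines "I \<equiv> {-r<..<r}"
  assumes "continuous_on (I \<times> I) f" "x \<in> I" "t \<in> I"
  shows "((\<lambda>x. x * mean_x f (x, t)) has_real_derivative f (x, t)) (at x)"
    and "((\<lambda>t. t * mean_t f (x, t)) has_real_derivative f (x, t)) (at t)"
proof -
  have "continuous_on I (\<lambda>x. f (x, t))" "continuous_on I (\<lambda>t. f (x, t))"
    by (rule continuous_on_compose2[OF assms(2)]; use assms(3,4) in \<open>auto intro!: continuous_intros\<close>)+
  then show "((\<lambda>x. x * mean_x f (x, t)) has_real_derivative f (x, t)) (at x)"
    and "((\<lambda>t. t * mean_t f (x, t)) has_real_derivative f (x, t)) (at t)"
    using theta_integral_has_derivative[of r "\<lambda>x. f (x, t)" x]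
      theta_integral_has_derivative[of r "\<lambda>t. f (x, t)" t] assms(3,4)
    by (simp_all add: mean_x_def mean_t_def I_def)
qed

lemma mean_x_has_t_derivative:
  fixes f g :: "real \<times> real \<Rightarrow> real" and r :: real
  defines "I \<equiv> {-r<..<r}"
  assumes f: "continuous_on (I \<times> I) f" and g: "continuous_on (I \<times> I) g"
    and d: "\<And>x t. x \<in> I \<Longrightarrow> t \<in> I \<Longrightarrow> ((\<lambda>t. f (x, t)) has_real_derivative g (x, t)) (at t)"
    and "x \<in> I" "t \<in> I"
  shows "((\<lambda>t. mean_x f (x, t)) has_real_derivative mean_x g (x, t)) (at t)"
proof -
  have th: "\<theta> * x \<in> I" if "\<theta> \<in> {0..1}" for \<theta>
    using theta_in(1)[OF that] assms(5) by (simp add: I_def)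
  have star: "theta_closed I" by (simp add: I_def)
  have "((\<lambda>t. integral (cbox 0 1) (\<lambda>\<theta>. f (\<theta> * x, t))) has_real_derivative
      integral (cbox 0 1) (\<lambda>\<theta>. g (\<theta> * x, t))) (at t within I)"
  proof (rule leibniz_rule_field_derivative)
    fix t' \<theta> :: real assume "t' \<in> I" "\<theta> \<in> cbox 0 1"
    then show "((\<lambda>t. f (\<theta> * x, t)) has_real_derivative g (\<theta> * x, t')) (at t' within I)"
      using d[OF th] by (simp add: has_field_derivative_at_within)
  next
    fix t' assume "t' \<in> I"
    then show "(\<lambda>\<theta>. f (\<theta> * x, t')) integrable_on cbox 0 1"
      using continuous_on_theta_slice(1)[OF star f assms(5)] by (simp add: integrable_continuous_real)
  next
    show "continuous_on (I \<times> cbox 0 1) (\<lambda>(t, \<theta>). g (\<theta> * x, t))"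
      unfolding split_def using th by (auto intro!: continuous_intros continuous_on_compose2[OF g])
  qed (use assms(6) in \<open>auto simp: I_def\<close>)
  moreover have "at t within I = at t"
    using assms(6) unfolding I_def by (intro at_within_open) auto
  ultimately show ?thesis by (simp add: mean_x_def)
qed

lemma Ck_on_x_primitive:
  fixes f :: "real \<times> real \<Rightarrow> real" and r :: real
  defines "I \<equiv> {-r<..<r}"
  assumes "Ck_on k (I \<times> I) f"
  shows "Ck_on k (I \<times> I) (\<lambda>(x, t). x * mean_x f (x, t))"
  using assms(2)
proof (induction k arbitrary: f)
  case 0
  then show ?case
    using continuous_on_mean(1)[of I f] unfolding split_def
    by (auto intro!: continuous_intros simp: I_def)
next
  case (Suc k)
  have op: "open (I \<times> I)" by (simp add: I_def open_Times)
  have cf: "continuous_on (I \<times> I) f" using Ck_on_imp_continuous[OF Suc.prems] .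
  have cg: "Ck_on k (I \<times> I) (D2 f)" using Suc.prems by (auto simp: Basis_prod_def)
  have d: "((\<lambda>t. f (x, t)) has_real_derivative D2 f (x, t)) (at t)" if "x \<in> I" "t \<in> I" for x t
    using Ck_on_partials(2)[of f x t] Suc.prems that by auto
  show ?case
  proof (rule Ck_on_SucI_partials[OF op, where ?f1.0=f and ?f2.0="\<lambda>(x, t). x * mean_x (D2 f) (x, t)"])
    fix x t assume "(x, t) \<in> I \<times> I"
    then have xt: "x \<in> I" "t \<in> I" by auto
    show "((\<lambda>x. case (x, t) of (x, t) \<Rightarrow> x * mean_x f (x, t)) has_real_derivative f (x, t)) (at x)"
      using primitive_has_derivative(1)[of r f x t] cf xt by (simp add: I_def)
    show "((\<lambda>t. case (x, t) of (x, t) \<Rightarrow> x * mean_x f (x, t)) has_real_derivative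
        (case (x, t) of (x, t) \<Rightarrow> x * mean_x (D2 f) (x, t))) (at t)"
      using mean_x_has_t_derivative[of r f "D2 f" x t] cf Ck_on_imp_continuous[OF cg] d xt
      by (auto intro!: derivative_eq_intros simp: I_def)
  qed (use Suc.IH[OF cg] Ck_on_SucD[OF Suc.prems] in auto)
qed

lemma Basis_real2: "(Basis :: (real \<times> real) set) = {(1, 0), (0, 1)}"
  by (auto simp: Basis_prod_def)

lemma convex_square: "convex ({-r<..<r::real} \<times> {-r<..<r::real})"
  by (intro convex_Times) auto

lemma x_increment:
  fixes f :: "real \<times> real \<Rightarrow> real" and r :: real
  defines "I \<equiv> {-r<..<r}"
  assumes "Ck_on (Suc 0) (I \<times> I) f" "x \<in> I" "x' \<in> I" "t \<in> I"
  shows "f (x', t) - f (x, t) = (x' - x) * mean_dd (1, 0) f ((x, t), (x', t))"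
proof -
  have "f (x', t) - f (x, t)
      = (\<Sum>e\<in>Basis. (((x', t) - (x, t)) \<bullet> e) * mean_dd e f ((x, t), (x', t)))"
    by (rule hadamard_increment[where S="I \<times> I"]) (use assms convex_square[of r] in auto)
  then show ?thesis by (simp add: Basis_real2)
qed

text \<open>A linear equation in \<open>t\<close> with \<open>C^k\<close> coefficients depending on \<open>x\<close> has \<open>C^k\<close> solutions.
The derivative in \<open>x\<close> solves an equation with the same matrix \<open>M\<close>, so the smallness condition on
\<open>r\<close> is inherited and the whole induction takes place on one square.\<close>

lemma linear_integral_equation_Ck:
  fixes M :: "'i::finite \<Rightarrow> 'i \<Rightarrow> real \<times> real \<Rightarrow> real" and r :: real
  defines "I \<equiv> {-r<..<r}"
  assumes M: "\<And>i j. Ck_on k (I \<times> I) (M i j)" and b: "\<And>i. Ck_on k (I \<times> I) (b i)"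
    and \<kappa>: "\<And>i q. q \<in> I \<times> I \<Longrightarrow> (\<Sum>j\<in>UNIV. \<bar>M i j q\<bar>) \<le> \<kappa>" "0 \<le> \<kappa>" "r * \<kappa> < 1"
    and S: "\<And>i. continuous_on (I \<times> I) (S i)"
    and eq: "\<And>i x t. x \<in> I \<Longrightarrow> t \<in> I \<Longrightarrow>
        S i (x, t) = d i + t * mean_t (\<lambda>q. (\<Sum>j\<in>UNIV. M i j q * S j q) + b i q) (x, t)"
  shows "Ck_on k (I \<times> I) (S i)"
  using M b S eq
proof (induction k arbitrary: b d S i)
  case 0
  then show ?case by simp
next
  case (Suc k)
  have op: "open (I \<times> I)" by (simp add: I_def open_Times)
  have cvx: "convex (I \<times> I)" unfolding I_def by (rule convex_square)
  have Mk: "\<And>i j. Ck_on k (I \<times> I) (M i j)" and bk: "\<And>i. Ck_on k (I \<times> I) (b i)"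
    using Ck_on_SucD Suc.prems by blast+
  have Sk: "Ck_on k (I \<times> I) (S i)" for i
    by (rule Suc.IH[OF Mk bk Suc.prems(3,4)])
  have C1: "Ck_on (Suc 0) (I \<times> I) f" if "Ck_on (Suc k) (I \<times> I) f" for f
    using that by (simp, blast intro: Ck_on_imp_continuous)
  have D1k: "Ck_on k (I \<times> I) (D1 f)" if "Ck_on (Suc k) (I \<times> I) f" for f
    using that by (simp add: Basis_real2)
  define m where "m f = (\<lambda>q. mean_dd (1, 0) f ((fst (fst q), snd q), (snd (fst q), snd q)))"
    for f :: "real \<times> real \<Rightarrow> real"
  have m_diag: "m f ((x, x), t) = D1 f (x, t)" for f x t
    by (simp add: m_def mean_dd_diagonal)
  have cm: "continuous_on ((I \<times> I) \<times> I) (m f)" if "Ck_on (Suc k) (I \<times> I) f" for f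
    unfolding m_def
    by (rule continuous_on_compose2[OF continuous_on_mean_dd[OF cvx Ck_on_imp_continuous[OF D1k[OF that]]]])
      (auto intro!: continuous_intros)
  have m_incr: "f (x', t) - f (x, t) = (x' - x) * m f ((x, x'), t)"
    if "Ck_on (Suc k) (I \<times> I) f" "x \<in> I" "x' \<in> I" "t \<in> I" for f x x' t
    using x_increment[of r f x x' t] C1[OF that(1)] that(2-4) by (simp add: m_def I_def)
  have "\<exists>S'. (\<forall>i. continuous_on (I \<times> I) (S' i)) \<and>
    (\<forall>i. \<forall>x\<in>I. \<forall>t\<in>I. ((\<lambda>x. S i (x, t)) has_real_derivative S' i (x, t)) (at x) \<and>
       S' i (x, t) = 0 + t * integral {0..1}
          (\<lambda>\<theta>. (\<Sum>j\<in>UNIV. M i j (x, \<theta> * t) * S' j (x, \<theta> * t))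
             + ((\<Sum>j\<in>UNIV. m (M i j) ((x, x), \<theta> * t) * S j (x, \<theta> * t)) + m (b i) ((x, x), \<theta> * t))))"
    unfolding I_def
  proof (rule parameter_derivative_of_integral_equation[where \<kappa>=\<kappa> and r=r and y=S
        and M="\<lambda>i j q. M i j (snd (fst q), snd q)" and \<alpha>="\<lambda>_. 0"
        and b="\<lambda>i q. (\<Sum>j\<in>UNIV. m (M i j) q * S j (fst (fst q), snd q)) + m (b i) q", unfolded fst_conv snd_conv],
      unfold I_def[symmetric])
    show "continuous_on ((I \<times> I) \<times> I) (\<lambda>q. M i j (snd (fst q), snd q))" for i j
      unfolding split_def
      by (rule continuous_on_compose2[OF Ck_on_imp_continuous[OF Mk]]) (auto intro!: continuous_intros)
    have "continuous_on ((I \<times> I) \<times> I) (\<lambda>q. S j (fst (fst q), snd q))" for j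
      by (rule continuous_on_compose2[OF Suc.prems(3)]) (auto intro!: continuous_intros)
    then show "continuous_on ((I \<times> I) \<times> I) (\<lambda>q. (\<Sum>j\<in>UNIV. m (M i j) q * S j (fst (fst q), snd q)) + m (b i) q)" for i
      by (intro continuous_intros cm Suc.prems(1,2))
    show "(\<Sum>j\<in>UNIV. \<bar>M i j (snd (fst q), snd q)\<bar>) \<le> \<kappa>" if "q \<in> (I \<times> I) \<times> I" for i q
      using \<kappa>(1) that by (auto simp: split_def)
    fix i x x' t assume x: "x \<in> I" "x' \<in> I" "t \<in> I"
    let ?R = "\<lambda>q. (\<Sum>j\<in>UNIV. M i j q * S j q) + b i q"
    have cR: "continuous_on (I \<times> I) ?R"
      by (intro continuous_intros Suc.prems(3) Ck_on_imp_continuous[OF Mk] Ck_on_imp_continuous[OF bk])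
    have star: "theta_closed I" by (simp add: I_def)
    have "S i (x', t) - S i (x, t) = t * (integral {0..1} (\<lambda>\<theta>. ?R (x', \<theta> * t)) - integral {0..1} (\<lambda>\<theta>. ?R (x, \<theta> * t)))"
      using Suc.prems(4)[of x' t i] Suc.prems(4)[of x t i] x by (simp add: mean_t_def algebra_simps)
    also have "\<dots> = t * integral {0..1} (\<lambda>\<theta>. ?R (x', \<theta> * t) - ?R (x, \<theta> * t))"
      using continuous_on_theta_slice(2)[OF star cR x(1,3)] continuous_on_theta_slice(2)[OF star cR x(2,3)]
      by (subst integral_diff) (auto intro!: integrable_continuous_real)
    also have "integral {0..1} (\<lambda>\<theta>. ?R (x', \<theta> * t) - ?R (x, \<theta> * t))
       = integral {0..1} (\<lambda>\<theta>. (\<Sum>j\<in>UNIV. M i j (x', \<theta> * t) * (S j (x', \<theta> * t) - S j (x, \<theta> * t)))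
          + (x' - x) * ((\<Sum>j\<in>UNIV. m (M i j) ((x, x'), \<theta> * t) * S j (x, \<theta> * t)) + m (b i) ((x, x'), \<theta> * t)))"
    proof (rule Henstock_Kurzweil_Integration.integral_cong)
      fix \<theta> :: real assume "\<theta> \<in> {0..1}"
      then have th: "\<theta> * t \<in> I" using star x(3) by (simp add: theta_closed_def)
      have "M i j (x', \<theta> * t) * S j (x', \<theta> * t) - M i j (x, \<theta> * t) * S j (x, \<theta> * t)
         = M i j (x', \<theta> * t) * (S j (x', \<theta> * t) - S j (x, \<theta> * t))
          + (x' - x) * (m (M i j) ((x, x'), \<theta> * t) * S j (x, \<theta> * t))" for j
      proof -
        have "M i j (x', \<theta> * t) * S j (x', \<theta> * t) - M i j (x, \<theta> * t) * S j (x, \<theta> * t)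
           = M i j (x', \<theta> * t) * (S j (x', \<theta> * t) - S j (x, \<theta> * t))
            + (M i j (x', \<theta> * t) - M i j (x, \<theta> * t)) * S j (x, \<theta> * t)"
          by (simp add: algebra_simps)
        then show ?thesis unfolding m_incr[OF Suc.prems(1) x(1,2) th] by (simp only: mult.assoc)
      qed
      then have "(\<Sum>j\<in>UNIV. M i j (x', \<theta> * t) * S j (x', \<theta> * t)) - (\<Sum>j\<in>UNIV. M i j (x, \<theta> * t) * S j (x, \<theta> * t))
         = (\<Sum>j\<in>UNIV. M i j (x', \<theta> * t) * (S j (x', \<theta> * t) - S j (x, \<theta> * t)))
          + (x' - x) * (\<Sum>j\<in>UNIV. m (M i j) ((x, x'), \<theta> * t) * S j (x, \<theta> * t))"
        by (simp only: sum_subtractf[symmetric] sum.distrib sum_distrib_left)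
      moreover have "b i (x', \<theta> * t) - b i (x, \<theta> * t) = (x' - x) * m (b i) ((x, x'), \<theta> * t)"
        by (rule m_incr[OF Suc.prems(2) x(1,2) th])
      ultimately show "?R (x', \<theta> * t) - ?R (x, \<theta> * t)
        = (\<Sum>j\<in>UNIV. M i j (x', \<theta> * t) * (S j (x', \<theta> * t) - S j (x, \<theta> * t)))
          + (x' - x) * ((\<Sum>j\<in>UNIV. m (M i j) ((x, x'), \<theta> * t) * S j (x, \<theta> * t)) + m (b i) ((x, x'), \<theta> * t))"
        by (simp only: distrib_left)
    qed
    finally show "S i (x', t) - S i (x, t) = (x' - x) * 0 + t * integral {0..1}
          (\<lambda>\<theta>. (\<Sum>j\<in>UNIV. M i j (x', \<theta> * t) * (S j (x', \<theta> * t) - S j (x, \<theta> * t)))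
            + (x' - x) * ((\<Sum>j\<in>UNIV. m (M i j) ((x, x'), \<theta> * t) * S j (x, \<theta> * t))
              + m (b i) ((x, x'), \<theta> * t)))"
      by simp
  qed (use \<kappa> Suc.prems(3) in auto)
  then obtain S' where S': "\<And>i. continuous_on (I \<times> I) (S' i)"
    and S'd: "\<And>i x t. x \<in> I \<Longrightarrow> t \<in> I \<Longrightarrow> ((\<lambda>x. S i (x, t)) has_real_derivative S' i (x, t)) (at x)"
    and S'e: "\<And>i x t. x \<in> I \<Longrightarrow> t \<in> I \<Longrightarrow> S' i (x, t) = 0 + t * mean_t
      (\<lambda>q. (\<Sum>j\<in>UNIV. M i j q * S' j q) + ((\<Sum>j\<in>UNIV. D1 (M i j) q * S j q) + D1 (b i) q)) (x, t)"
    unfolding mean_t_def m_diag prod.case by blast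
  have S'k: "Ck_on k (I \<times> I) (S' i)" for i
  proof (rule Suc.IH[OF Mk _ S' S'e])
    show "Ck_on k (I \<times> I) (\<lambda>q. (\<Sum>j\<in>UNIV. D1 (M i j) q * S j q) + D1 (b i) q)" for i
      using Suc.prems(1,2) by (intro Ck_on_add[OF op] Ck_on_sum[OF op] Ck_on_mult[OF op] D1k Sk)
  qed
  let ?R = "\<lambda>i q. (\<Sum>j\<in>UNIV. M i j q * S j q) + b i q"
  have Rk: "Ck_on k (I \<times> I) (?R i)" for i
    by (intro Ck_on_add[OF op] Ck_on_sum[OF op] Ck_on_mult[OF op] Mk Sk bk)
  show ?case
  proof (rule Ck_on_SucI_partials[OF op _ _ S'k Rk])
    fix x t assume "(x, t) \<in> I \<times> I"
    then have xt: "x \<in> I" "t \<in> I" by auto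
    show "((\<lambda>x. S i (x, t)) has_real_derivative S' i (x, t)) (at x)" by (rule S'd[OF xt])
    have "((\<lambda>t. d i + t * mean_t (?R i) (x, t)) has_real_derivative ?R i (x, t)) (at t)"
      using DERIV_add[OF DERIV_const primitive_has_derivative(2)[of r "?R i" x t], of "d i"]
        Ck_on_imp_continuous[OF Rk[of i]] xt
      unfolding I_def by simp
    then show "((\<lambda>t. S i (x, t)) has_real_derivative ?R i (x, t)) (at t)"
      by (rule has_field_derivative_transform_within_open[where S=I])
        (use xt Suc.prems(4) in \<open>auto simp: I_def\<close>)
  qed
qed

section \<open>Smooth solutions of the Goursat problem\<close>

lemma Basis_jet: "(Basis :: jet set) = {(1,0,0,0), (0,1,0,0), (0,0,1,0), (0,0,0,1)}"
proof -
  have *: "(Basis :: (real \<times> real \<times> real) set) = {(1,0,0), (0,1,0), (0,0,1)}"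
    unfolding Basis_prod_def[where 'a=real and 'b="real \<times> real"] Basis_real2
    by (simp add: zero_prod_def) blast
  show ?thesis
    unfolding Basis_prod_def[where 'a=real and 'b="real \<times> real \<times> real"] *
    by (simp add: zero_prod_def) blast
qed

lemma sum_Basis_jet: "(\<Sum>e\<in>(Basis :: jet set). h e) = h (1,0,0,0) + h (0,1,0,0) + h (0,0,1,0) + h (0,0,0,1)"
  by (simp add: Basis_jet add.assoc)

text \<open>The two unknown functions of the system are indexed by \<open>bool\<close>: \<open>True\<close> stands for \<open>u\<close> and
\<open>False\<close> for \<open>v\<close>. In the Goursat problem \<open>X i\<close> is the unknown and \<open>P i\<close> its
\<open>x\<close>-derivative.\<close>

definition pack :: "(bool \<Rightarrow> real \<times> real \<Rightarrow> real) \<Rightarrow> (bool \<Rightarrow> real \<times> real \<Rightarrow> real) \<Rightarrow> real \<times> real \<Rightarrow> jet" where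
  "pack X P q = (X True q, P True q, X False q, P False q)"

text \<open>The coordinate directions of \<open>X i\<close> and of \<open>P i\<close> in the space of jets are \<open>ev i\<close> and \<open>ep i\<close>.\<close>

definition ev :: "bool \<Rightarrow> jet" where "ev i = (if i then (1,0,0,0) else (0,0,1,0))"
definition ep :: "bool \<Rightarrow> jet" where "ep i = (if i then (0,1,0,0) else (0,0,0,1))"

lemma ev_ep_Basis [simp]: "ev i \<in> Basis" "ep i \<in> Basis"
  by (simp_all add: ev_def ep_def Basis_jet)

lemma sum_Basis_jet': "(\<Sum>e\<in>(Basis :: jet set). h e) = (\<Sum>j\<in>UNIV. h (ep j)) + (\<Sum>j\<in>UNIV. h (ev j))"
  by (simp add: sum_Basis_jet UNIV_bool ev_def ep_def ac_simps)

lemma pack_inner: "pack X P q \<bullet> ev j = X j q" "pack X P q \<bullet> ep j = P j q"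
  by (auto simp: pack_def ev_def ep_def)

lemma continuous_on_pack:
  "(\<And>i. continuous_on S (X i)) \<Longrightarrow> (\<And>i. continuous_on S (P i)) \<Longrightarrow> continuous_on S (pack X P)"
  unfolding pack_def by (intro continuous_intros)

lemma Ck_on_compose_pack:
  assumes "open S" "\<And>i. Ck_on k S (X i)" "\<And>i. Ck_on k S (P i)" "pack X P ` S \<subseteq> V" "Ck_on k V f"
  shows "Ck_on k S (\<lambda>q. f (pack X P q))"
proof (rule Ck_on_compose[OF assms(1,4,5)])
  fix e :: jet assume "e \<in> Basis"
  then have "e \<in> range ev \<union> range ep"
    by (auto simp: Basis_jet ev_def ep_def image_iff)
  then show "Ck_on k S (\<lambda>q. pack X P q \<bullet> e)"
    using assms(2,3) by (auto simp: pack_inner)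
qed

lemma norm_jet_le: "norm (a, b, c, d) \<le> \<bar>a\<bar> + \<bar>b\<bar> + \<bar>c\<bar> + \<bar>d\<bar>" for a b c d :: real
  using norm_Pair_le[of a "(b, c, d)"] norm_Pair_le[of b "(c, d)"] norm_Pair_le[of c d] by simp

lemma abs_mult_le:
  fixes x m r M :: real
  assumes "\<bar>x\<bar> \<le> r" "\<bar>m\<bar> \<le> M"
  shows "\<bar>x * m\<bar> \<le> r * M"
proof -
  have "0 \<le> r" using assms(1) by linarith
  then show ?thesis unfolding abs_mult using assms by (intro mult_mono) auto
qed

text \<open>The data are affine: \<open>X i\<close> is prescribed as \<open>x0 i + c i * t\<close> on \<open>x = 0\<close> and \<open>P i\<close> as
\<open>p0 i + \<alpha> i * x\<close> on \<open>t = 0\<close>. Since \<open>X\<close> is recovered from \<open>P\<close> by integration in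
\<open>x\<close>, the problem is a fixed point equation for \<open>P\<close> alone; on a small square the right-hand side is a
contraction that keeps the jets in a ball around the initial jet.\<close>

lemma goursat_continuous_solution:
  fixes \<Phi> :: "bool \<Rightarrow> jet \<Rightarrow> real" and x0 p0 \<alpha> c :: "bool \<Rightarrow> real"
  assumes "open V" and q0: "(x0 True, p0 True, x0 False, p0 False) \<in> V"
    and sm: "\<And>i. smooth_on V (\<Phi> i)"
  obtains B r \<kappa> P X where "convex B" "B \<subseteq> V" "0 < r" "0 \<le> \<kappa>" "r * (2 * \<kappa>) < 1"
    "\<And>i e p. p \<in> B \<Longrightarrow> e \<in> Basis \<Longrightarrow> \<bar>dd e (\<Phi> i) p\<bar> \<le> \<kappa>"
    "\<And>i. continuous_on ({-r<..<r} \<times> {-r<..<r}) (P i)"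
    "pack X P ` ({-r<..<r} \<times> {-r<..<r}) \<subseteq> B"
    "\<And>i x t. x \<in> {-r<..<r} \<Longrightarrow> t \<in> {-r<..<r} \<Longrightarrow>
        P i (x, t) = p0 i + \<alpha> i * x + t * mean_t (\<lambda>q. \<Phi> i (pack X P q)) (x, t)"
    "\<And>i x t. X i (x, t) = x0 i + c i * t + x * mean_x (P i) (x, t)"
proof -
  define a :: jet where "a = (x0 True, p0 True, x0 False, p0 False)"
  obtain e where e: "e > 0" "cball a e \<subseteq> V" using assms(1) q0 by (auto simp: open_contains_cball a_def)
  define B where "B = cball a e"
  have B: "convex B" "compact B" "B \<subseteq> V" "a \<in> B" using e by (auto simp: B_def)
  have diff: "\<Phi> i differentiable (at p)" if "p \<in> B" for i p
    using sm[of i] that B(3) unfolding smooth_on_def by (metis Ck_on.simps(2) subsetD)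
  have cdd: "continuous_on B (dd e (\<Phi> i))" if "e \<in> Basis" for e i
    using sm[of i] that B(3) unfolding smooth_on_def
    by (metis Ck_on.simps(2) Ck_on_imp_continuous continuous_on_subset)
  have c\<Phi>: "continuous_on B (\<Phi> i)" for i
    using sm[of i] B(3) unfolding smooth_on_def by (metis Ck_on_imp_continuous continuous_on_subset)
  have bnd: "\<exists>C. \<forall>p\<in>B. \<bar>f p\<bar> \<le> C" if "continuous_on B f" for f :: "jet \<Rightarrow> real"
    using compact_imp_bounded[OF compact_continuous_image[OF that B(2)]] by (auto simp: bounded_iff)
  obtain m where m: "\<And>i p. p \<in> B \<Longrightarrow> \<bar>\<Phi> i p\<bar> \<le> m i"
    using bnd[OF c\<Phi>] by metis
  obtain \<kappa>0 where \<kappa>0: "\<And>i e p. e \<in> Basis \<Longrightarrow> p \<in> B \<Longrightarrow> \<bar>dd e (\<Phi> i) p\<bar> \<le> \<kappa>0 i e"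
  proof -
    have "\<forall>i e. \<exists>C. e \<in> Basis \<longrightarrow> (\<forall>p\<in>B. \<bar>dd e (\<Phi> i) p\<bar> \<le> C)"
      using bnd[OF cdd] by blast
    then show ?thesis using that by metis
  qed
  define \<kappa> where "\<kappa> = (\<Sum>(i, e)\<in>UNIV \<times> Basis. \<bar>\<kappa>0 i e\<bar>)"
  have "\<bar>\<kappa>0 i e\<bar> \<le> \<kappa>" if "e \<in> Basis" for i e
    unfolding \<kappa>_def using member_le_sum[of "(i, e)" "UNIV \<times> Basis" "\<lambda>(i, e). \<bar>\<kappa>0 i e\<bar>"] that by auto
  then have \<kappa>: "\<And>i e p. p \<in> B \<Longrightarrow> e \<in> Basis \<Longrightarrow> \<bar>dd e (\<Phi> i) p\<bar> \<le> \<kappa>"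
    using \<kappa>0 by (meson abs_ge_self order_trans)
  have \<kappa>_nn: "0 \<le> \<kappa>" unfolding \<kappa>_def by (intro sum_nonneg) auto
  \<comment> \<open>Four coordinates within \<open>\<epsilon>\<close> of the initial jet keep the jet in the ball of radius \<open>e\<close>.\<close>
  define \<epsilon> where "\<epsilon> = e / 4"
  have \<epsilon>: "\<epsilon> > 0" using e by (simp add: \<epsilon>_def)
  \<comment> \<open>One constant \<open>A\<close> dominates all quantities that the side length \<open>r\<close> has to beat.\<close>
  define A where "A = 1 + 4 * \<kappa> + (\<Sum>i\<in>UNIV. \<bar>m i\<bar> + \<bar>\<alpha> i\<bar> + \<bar>c i\<bar> + \<bar>p0 i\<bar> + \<epsilon>)"
  have Ai: "\<bar>m i\<bar> + \<bar>\<alpha> i\<bar> + \<bar>c i\<bar> + \<bar>p0 i\<bar> + \<epsilon> \<le> A - 1 - 4 * \<kappa>" for i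
    unfolding A_def using member_le_sum[of i UNIV "\<lambda>i. \<bar>m i\<bar> + \<bar>\<alpha> i\<bar> + \<bar>c i\<bar> + \<bar>p0 i\<bar> + \<epsilon>"] \<epsilon> by auto
  have A: "1 \<le> A" "4 * \<kappa> < A" "\<And>i. \<bar>m i\<bar> + \<bar>\<alpha> i\<bar> \<le> A" "\<And>i. \<bar>c i\<bar> + (\<bar>p0 i\<bar> + \<epsilon>) \<le> A"
    using Ai[of True] \<kappa>_nn \<epsilon> Ai by (smt (verit))+
  define r where "r = min 1 (min \<epsilon> (1/2) / A)"
  have r: "0 < r" "r \<le> 1" "r * A \<le> \<epsilon>" "r * A \<le> 1/2"
  proof -
    have "r * A \<le> min \<epsilon> (1/2)"
      using A(1) unfolding r_def by (simp add: min_def field_simps)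
    then show "r * A \<le> \<epsilon>" "r * A \<le> 1/2" by auto
  qed (use A \<epsilon> in \<open>auto simp: r_def\<close>)
  have r4\<kappa>: "r * (4 * \<kappa>) \<le> 1/2" "r * (2 * \<kappa>) < 1"
  proof -
    have *: "4 * (r * \<kappa>) \<le> r * A" using mult_left_mono[of "4 * \<kappa>" A r] r(1) A(2) by simp
    show "r * (4 * \<kappa>) \<le> 1/2" "r * (2 * \<kappa>) < 1"
      using * r(4) by (simp_all only: mult.left_commute[of r])
  qed
  let ?C = "{-r..r}" let ?K = "?C \<times> ?C"
  define Xf where "Xf P i = (\<lambda>(x, t). x0 i + c i * t + x * mean_x (P i) (x, t))" for P :: "bool \<Rightarrow> real \<times> real \<Rightarrow> real" and i
  define J where "J P = pack (Xf P) P" for P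
  define T where "T P i = (\<lambda>(x, t). p0 i + \<alpha> i * x + t * mean_t (\<lambda>q. \<Phi> i (J P q)) (x, t))" for P i
  define Bi where "Bi i = {p0 i - \<epsilon>..p0 i + \<epsilon>}" for i
  let ?adm = "\<lambda>P. \<forall>i. continuous_on ?K (P i) \<and> (\<forall>q\<in>?K. P i q \<in> Bi i)"
  have Pclose: "\<bar>P i q - p0 i\<bar> \<le> \<epsilon>" if "?adm P" "q \<in> ?K" for P i q
  proof -
    have "P i q \<in> Bi i" using that by blast
    then show ?thesis by (simp add: Bi_def abs_le_iff)
  qed
  have admX: "\<bar>Xf P i q - x0 i\<bar> \<le> \<epsilon>" if adm: "?adm P" and qK: "q \<in> ?K" for P i q
  proof -
    obtain x t where q: "q = (x, t)" "x \<in> ?C" "t \<in> ?C" using qK by (cases q) auto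
    have "\<bar>P i q\<bar> \<le> \<bar>p0 i\<bar> + \<epsilon>" if "q \<in> ?K" for q
      using Pclose[OF adm that, of i] by linarith
    then have "\<bar>mean_x (P i) q\<bar> \<le> \<bar>p0 i\<bar> + \<epsilon>"
      using adm qK by (intro abs_mean_le(1)[of ?C]) auto
    then have "\<bar>x * mean_x (P i) q\<bar> \<le> r * (\<bar>p0 i\<bar> + \<epsilon>)"
      using q by (intro abs_mult_le) auto
    moreover have "\<bar>t * c i\<bar> \<le> r * \<bar>c i\<bar>" using q by (intro abs_mult_le) auto
    moreover have "r * \<bar>c i\<bar> + r * (\<bar>p0 i\<bar> + \<epsilon>) \<le> r * A"
      using A(4)[of i] r by (simp flip: distrib_left)
    ultimately show ?thesis using r(3) by (simp add: Xf_def q mult.commute[of t])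
  qed
  have admJ: "J P q \<in> B" if "?adm P" "q \<in> ?K" for P q
  proof -
    have "norm (J P q - a) \<le> \<bar>Xf P True q - x0 True\<bar> + \<bar>P True q - p0 True\<bar>
        + \<bar>Xf P False q - x0 False\<bar> + \<bar>P False q - p0 False\<bar>"
      unfolding J_def pack_def a_def by (simp add: norm_jet_le)
    then have "norm (J P q - a) \<le> 4 * \<epsilon>"
      using Pclose[OF that, of True] Pclose[OF that, of False] admX[OF that, of True] admX[OF that, of False]
      by linarith
    then show ?thesis by (simp add: B_def dist_norm norm_minus_commute \<epsilon>_def)
  qed
  have cX: "continuous_on ?K (Xf P i)" if "?adm P" for P i
    using continuous_on_mean(1)[of ?C "P i"] that unfolding Xf_def split_def by (auto intro!: continuous_intros)
  have cJ: "continuous_on ?K (J P)" if "?adm P" for P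
    unfolding J_def using cX[OF that] that by (intro continuous_on_pack) auto
  have c\<Phi>J: "continuous_on ?K (\<lambda>q. \<Phi> i (J P q))" if "?adm P" for P i
    by (rule continuous_on_compose2[OF c\<Phi> cJ[OF that]]) (use admJ[OF that] in auto)
  have "\<exists>P. ?adm P \<and> (\<forall>i. \<forall>q\<in>?K. P i q = T P i q)"
  proof (rule contraction_fixpoint[where T=T and ?y0.0="\<lambda>i q. p0 i" and c="1/2" and ?D0.0="\<epsilon>"])
    have T_close: "\<bar>T P i q - p0 i\<bar> \<le> \<epsilon>" if adm: "?adm P" and qK: "q \<in> ?K" for P i q
    proof -
      obtain x t where q: "q = (x, t)" "x \<in> ?C" "t \<in> ?C" using qK by (cases q) auto
      have "\<bar>mean_t (\<lambda>q. \<Phi> i (J P q)) q\<bar> \<le> \<bar>m i\<bar>"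
        using qK c\<Phi>J[OF adm] order_trans[OF m[OF admJ[OF adm]] abs_ge_self]
        by (intro abs_mean_le(2)[of ?C]) auto
      then have "\<bar>t * mean_t (\<lambda>q. \<Phi> i (J P q)) q\<bar> \<le> r * \<bar>m i\<bar>"
        using q by (intro abs_mult_le) auto
      moreover have "\<bar>x * \<alpha> i\<bar> \<le> r * \<bar>\<alpha> i\<bar>" using q by (intro abs_mult_le) auto
      moreover have "r * \<bar>m i\<bar> + r * \<bar>\<alpha> i\<bar> \<le> r * A"
        using A(3)[of i] r by (simp flip: distrib_left)
      ultimately show ?thesis using r(3) by (simp add: T_def q mult.commute[of x])
    qed
    show "?adm (T P)" if "?adm P" for P
    proof (intro allI conjI ballI)
      show "continuous_on ?K (T P i)" for i
        using continuous_on_mean(2)[OF _ c\<Phi>J[OF that], of i] unfolding T_def split_def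
        by (auto intro!: continuous_intros)
      show "T P i q \<in> Bi i" if "q \<in> ?K" for i q
        using T_close[OF \<open>?adm P\<close> that, of i] by (auto simp: Bi_def abs_le_iff)
    qed
    have adm0: "?adm (\<lambda>i q. p0 i)" using \<epsilon> by (auto simp: Bi_def)
    then show "?adm (\<lambda>i q. p0 i)" .
    show "\<bar>T (\<lambda>i q. p0 i) i q - p0 i\<bar> \<le> \<epsilon>" if "q \<in> ?K" for i q
      using T_close[OF adm0 that] .
    fix P P' :: "bool \<Rightarrow> real \<times> real \<Rightarrow> real" and D :: real
    assume P: "?adm P" and P': "?adm P'" and D: "0 \<le> D" "\<And>i q. q \<in> ?K \<Longrightarrow> \<bar>P i q - P' i q\<bar> \<le> D"
    show "\<forall>i. \<forall>q\<in>?K. \<bar>T P i q - T P' i q\<bar> \<le> 1/2 * D"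
    proof (intro allI ballI)
      fix i q assume "q \<in> ?K"
      then obtain x t where q: "q = (x, t)" "x \<in> ?C" "t \<in> ?C" "(x, t) \<in> ?K" by (cases q) auto
      have dX: "\<bar>Xf P j s - Xf P' j s\<bar> \<le> D" if s: "s \<in> ?K" for s j
      proof -
        have "Xf P j s - Xf P' j s = fst s * mean_x (\<lambda>q. P j q - P' j q) s"
          using mean_diff(1)[of ?C "P j" "P' j" s] P P' s
          by (simp add: Xf_def split_def algebra_simps)
        moreover have "\<bar>mean_x (\<lambda>q. P j q - P' j q) s\<bar> \<le> D"
          using P P' D(2) s by (intro abs_mean_le(1)[of ?C]) (auto intro!: continuous_intros)
        moreover have "\<bar>fst s\<bar> \<le> 1" using s r by auto
        ultimately show ?thesis
          using mult_mono[of "\<bar>fst s\<bar>" 1 "\<bar>mean_x (\<lambda>q. P j q - P' j q) s\<bar>" D] by (simp add: abs_mult)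
      qed
      have d\<Phi>: "\<bar>\<Phi> i (J P s) - \<Phi> i (J P' s)\<bar> \<le> 4 * \<kappa> * D" if s: "s \<in> ?K" for s
      proof -
        have "\<Phi> i (J P s) - \<Phi> i (J P' s) = (\<Sum>e\<in>Basis. ((J P s - J P' s) \<bullet> e) * mean_dd e (\<Phi> i) (J P' s, J P s))"
          by (rule hadamard_increment[OF B(1) admJ[OF P' s] admJ[OF P s] diff cdd])
        also have "\<bar>\<dots>\<bar> \<le> (\<Sum>e\<in>(Basis::jet set). D * \<kappa>)"
        proof (rule order_trans[OF sum_abs sum_mono])
          fix e :: jet assume e: "e \<in> Basis"
          have "\<bar>(J P s - J P' s) \<bullet> e\<bar> \<le> D"
            using e dX[OF s] D(2)[OF s] by (auto simp: Basis_jet J_def pack_def)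
          then show "\<bar>((J P s - J P' s) \<bullet> e) * mean_dd e (\<Phi> i) (J P' s, J P s)\<bar> \<le> D * \<kappa>"
            unfolding abs_mult
            by (intro mult_mono abs_mean_dd_le[OF B(1) cdd[OF e] admJ[OF P' s] admJ[OF P s] \<kappa>[OF _ e]] D) auto
        qed
        also have "\<dots> = 4 * \<kappa> * D" by (subst sum_Basis_jet) simp
        finally show ?thesis .
      qed
      have "T P i q - T P' i q = t * mean_t (\<lambda>q. \<Phi> i (J P q) - \<Phi> i (J P' q)) (x, t)"
        using mean_diff(2)[of ?C, OF _ c\<Phi>J[OF P] c\<Phi>J[OF P'] q(4), of i i]
        by (simp add: T_def q(1) algebra_simps)
      moreover have "\<bar>mean_t (\<lambda>q. \<Phi> i (J P q) - \<Phi> i (J P' q)) (x, t)\<bar> \<le> 4 * \<kappa> * D"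
        by (rule abs_mean_le(2)[of ?C]) (use c\<Phi>J[OF P] c\<Phi>J[OF P'] q(4) d\<Phi> in \<open>auto intro!: continuous_intros\<close>)
      moreover have "\<bar>t\<bar> \<le> r" using q(3) by auto
      ultimately have "\<bar>T P i q - T P' i q\<bar> \<le> r * (4 * \<kappa> * D)"
        by (simp only:) (rule abs_mult_le)
      also have "\<dots> \<le> 1/2 * D" using mult_right_mono[OF r4\<kappa>(1) D(1)] by (simp add: mult.assoc)
      finally show "\<bar>T P i q - T P' i q\<bar> \<le> 1/2 * D" .
    qed
  qed (auto simp: Bi_def)
  then obtain P where P: "?adm P" "\<And>i q. q \<in> ?K \<Longrightarrow> P i q = T P i q" by blast
  let ?I = "{-r<..<r}"
  have sub: "?I \<times> ?I \<subseteq> ?K" by auto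
  show thesis
  proof (rule that[of B r \<kappa> P "Xf P"])
    show "convex B" "B \<subseteq> V" "0 < r" "0 \<le> \<kappa>" "r * (2 * \<kappa>) < 1" by fact+
    show "\<And>i e p. p \<in> B \<Longrightarrow> e \<in> Basis \<Longrightarrow> \<bar>dd e (\<Phi> i) p\<bar> \<le> \<kappa>" by (rule \<kappa>)
    show "continuous_on (?I \<times> ?I) (P i)" for i
      using P(1) continuous_on_subset[OF _ sub] by blast
    show "pack (Xf P) P ` (?I \<times> ?I) \<subseteq> B" using admJ[OF P(1)] sub by (auto simp: J_def)
    show "P i (x, t) = p0 i + \<alpha> i * x + t * mean_t (\<lambda>q. \<Phi> i (pack (Xf P) P q)) (x, t)"
      if "x \<in> ?I" "t \<in> ?I" for i x t
      using P(2)[of "(x, t)" i] that by (simp add: T_def J_def)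
    show "Xf P i (x, t) = x0 i + c i * t + x * mean_x (P i) (x, t)" for i x t
      by (simp add: Xf_def)
  qed
qed

text \<open>Regularity is gained by bootstrapping. If \<open>P\<close> and \<open>X\<close> are \<open>C^k\<close>, then \<open>X\<close> is
\<open>C^(k+1)\<close> because both its derivatives are expressed by \<open>P\<close> and by integrals of \<open>\<Phi>\<close>;
\<open>P_t = \<Phi>\<close> is \<open>C^k\<close>; and \<open>P_x\<close> exists and solves a linear integral equation with
\<open>C^k\<close> coefficients, hence is \<open>C^k\<close> as well.\<close>

lemma goursat_smooth_solution:
  fixes \<Phi> :: "bool \<Rightarrow> jet \<Rightarrow> real" and x0 p0 \<alpha> c :: "bool \<Rightarrow> real"
  assumes V: "open V" "(x0 True, p0 True, x0 False, p0 False) \<in> V"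
    and sm: "\<And>i. smooth_on V (\<Phi> i)"
  obtains r P X where "0 < r"
    "\<And>i. smooth_on ({-r<..<r} \<times> {-r<..<r}) (P i)" "\<And>i. smooth_on ({-r<..<r} \<times> {-r<..<r}) (X i)"
    "pack X P ` ({-r<..<r} \<times> {-r<..<r}) \<subseteq> V"
    "\<And>i q. q \<in> {-r<..<r} \<times> {-r<..<r} \<Longrightarrow> D1 (X i) q = P i q"
    "\<And>i q. q \<in> {-r<..<r} \<times> {-r<..<r} \<Longrightarrow> D2 (P i) q = \<Phi> i (pack X P q)"
    "\<And>i. X i (0, 0) = x0 i" "\<And>i. P i (0, 0) = p0 i"
    "\<And>i. D1 (P i) (0, 0) = \<alpha> i" "\<And>i. D2 (X i) (0, 0) = c i"
proof -
  show thesis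
  proof (rule goursat_continuous_solution[where \<Phi>=\<Phi> and \<alpha>=\<alpha> and c=c, OF V sm])
  fix B r \<kappa> P X
  assume B: "convex B" "B \<subseteq> V" and r: "0 < r" and \<kappa>: "0 \<le> \<kappa>" "r * (2 * \<kappa>) < 1"
      "\<And>i e p. p \<in> B \<Longrightarrow> e \<in> Basis \<Longrightarrow> \<bar>dd e (\<Phi> i) p\<bar> \<le> \<kappa>"
    and P: "\<And>i. continuous_on ({-r<..<r} \<times> {-r<..<r}) (P i)"
    and JB: "pack X P ` ({-r<..<r} \<times> {-r<..<r}) \<subseteq> B"
    and Peq: "\<And>i x t. x \<in> {-r<..<r} \<Longrightarrow> t \<in> {-r<..<r} \<Longrightarrow>
        P i (x, t) = p0 i + \<alpha> i * x + t * mean_t (\<lambda>q. \<Phi> i (pack X P q)) (x, t)"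
    and Xeq: "\<And>i x t. X i (x, t) = x0 i + c i * t + x * mean_x (P i) (x, t)"
  define I where "I = {-r<..<r}"
  note P = P[folded I_def] and JB = JB[folded I_def] and Peq = Peq[folded I_def]
  define J where "J = pack X P"
  have op: "open (I \<times> I)" by (simp add: I_def open_Times)
  have star: "theta_closed I" by (simp add: I_def)
  have zero: "0 \<in> I" using r by (simp add: I_def)
  have JB': "J q \<in> B" if "q \<in> I \<times> I" for q using JB that by (auto simp: J_def)
  have \<Phi>k: "Ck_on k V (\<Phi> i)" for k i using sm by (simp add: smooth_on_def)
  have dd\<Phi>k: "Ck_on k V (dd e (\<Phi> i))" if "e \<in> Basis" for k i e
    using \<Phi>k[of "Suc k" i] that by simp
  have cX: "continuous_on (I \<times> I) (X i)" for i
  proof -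
    have "X i = (\<lambda>q. x0 i + c i * snd q + fst q * mean_x (P i) q)" by (auto simp: Xeq fun_eq_iff)
    then show ?thesis using continuous_on_mean(1)[OF star P, of i] by (auto intro!: continuous_intros)
  qed
  have cJ: "continuous_on (I \<times> I) J" unfolding J_def by (rule continuous_on_pack[OF cX P])
  have comp: "continuous_on (I \<times> I) (\<lambda>q. f (J q))" if "Ck_on k V f" for f k
    by (rule continuous_on_compose2[OF Ck_on_imp_continuous[OF that] cJ]) (use JB' B(2) in auto)
  have c\<Phi>J: "continuous_on (I \<times> I) (\<lambda>q. \<Phi> i (J q))" for i by (rule comp[OF \<Phi>k[of 0]])
  have Pt: "((\<lambda>t. P i (x, t)) has_real_derivative \<Phi> i (J (x, t))) (at t)" if "x \<in> I" "t \<in> I" for i x t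
  proof -
    have "((\<lambda>t. p0 i + \<alpha> i * x + t * mean_t (\<lambda>q. \<Phi> i (J q)) (x, t)) has_real_derivative \<Phi> i (J (x, t))) (at t)"
      using DERIV_add[OF DERIV_const primitive_has_derivative(2)[of r "\<lambda>q. \<Phi> i (J q)" x t], of "p0 i + \<alpha> i * x"]
        c\<Phi>J[of i] that unfolding I_def by simp
    then show ?thesis
      by (rule has_field_derivative_transform_within_open[where S=I])
        (use that Peq in \<open>auto simp: I_def J_def\<close>)
  qed
  have Xx: "((\<lambda>x. X i (x, t)) has_real_derivative P i (x, t)) (at x)" if "x \<in> I" "t \<in> I" for i x t
    unfolding Xeq
    using DERIV_add[OF DERIV_const primitive_has_derivative(1)[of r "P i" x t], of "x0 i + c i * t"] P[of i] that
    by (simp add: I_def)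
  have Xt: "((\<lambda>t. X i (x, t)) has_real_derivative c i + x * mean_x (\<lambda>q. \<Phi> i (J q)) (x, t)) (at t)"
    if "x \<in> I" "t \<in> I" for i x t
  proof -
    have "((\<lambda>t. mean_x (P i) (x, t)) has_real_derivative mean_x (\<lambda>q. \<Phi> i (J q)) (x, t)) (at t)"
      using mean_x_has_t_derivative[of r "P i" "\<lambda>q. \<Phi> i (J q)" x t] P[of i] c\<Phi>J[of i] Pt that
      by (simp add: I_def)
    then show ?thesis unfolding Xeq by (auto intro!: derivative_eq_intros)
  qed
  define Mh where "Mh i j = (\<lambda>((x, x'), t). mean_dd (ep j) (\<Phi> i) (J (x, t), J (x', t)))" for i j
  define Xh where "Xh j = (\<lambda>((x, x'), t). integral {0..1} (\<lambda>\<theta>. P j (x + \<theta> * (x' - x), t)))" for j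
  define bh where "bh i q = (\<Sum>j\<in>UNIV. mean_dd (ev j) (\<Phi> i) (J (fst (fst q), snd q), J (snd (fst q), snd q)) * Xh j q)" for i q
  have cm: "continuous_on ((I \<times> I) \<times> I) (\<lambda>q. mean_dd e (\<Phi> i) (J (fst (fst q), snd q), J (snd (fst q), snd q)))"
    if "e \<in> Basis" for e i
  proof (rule continuous_on_compose2[OF continuous_on_mean_dd[of B e "\<Phi> i"]])
    show "continuous_on B (dd e (\<Phi> i))"
      using Ck_on_imp_continuous[OF dd\<Phi>k[OF that, of 0]] B(2) continuous_on_subset by blast
    show "continuous_on ((I \<times> I) \<times> I) (\<lambda>q. (J (fst (fst q), snd q), J (snd (fst q), snd q)))"
      by (intro continuous_intros continuous_on_compose2[OF cJ]) auto
    show "(\<lambda>q. (J (fst (fst q), snd q), J (snd (fst q), snd q))) ` ((I \<times> I) \<times> I) \<subseteq> B \<times> B"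
      using JB' by auto
  qed (rule B(1))
  have seg: "x + \<theta> * (x' - x) \<in> I" if "x \<in> I" "x' \<in> I" "\<theta> \<in> {0..1}" for x x' \<theta>
    using segment_in_convex[of I x x' \<theta>] that by (simp add: I_def)
  have cXh: "continuous_on ((I \<times> I) \<times> I) (Xh j)" for j
  proof -
    have "continuous_on ((I \<times> I) \<times> I) (\<lambda>q. integral {0..1} (\<lambda>\<theta>. P j (fst (fst q) + \<theta> * (snd (fst q) - fst (fst q)), snd q)))"
      by (rule continuous_on_theta_integral, unfold split_def, rule continuous_on_compose2[OF P])
        (use seg in \<open>auto intro!: continuous_intros\<close>)
    then show ?thesis by (simp add: Xh_def split_def)
  qed
  have cdd: "continuous_on B (dd e (\<Phi> i))" if "e \<in> Basis" for e i
    using Ck_on_imp_continuous[OF dd\<Phi>k[OF that, of 0]] B(2) continuous_on_subset by blast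
  have diff: "\<Phi> i differentiable (at p)" if "p \<in> B" for i p
    using \<Phi>k[of "Suc 0" i] that B(2) by auto
  have X_incr: "X j (x', t) - X j (x, t) = (x' - x) * Xh j ((x, x'), t)" if "x \<in> I" "x' \<in> I" "t \<in> I" for j x x' t
    unfolding Xh_def split
    by (rule diff_eq_theta_integral[where \<psi>="\<lambda>x. P j (x, t)"], rule Xx) (use seg that in auto)
  have \<Phi>_incr: "\<Phi> i (J (x', t)) - \<Phi> i (J (x, t))
      = (\<Sum>j\<in>UNIV. Mh i j ((x, x'), t) * (P j (x', t) - P j (x, t))) + (x' - x) * bh i ((x, x'), t)"
    if x: "x \<in> I" "x' \<in> I" "t \<in> I" for i x x' t
  proof -
    let ?q = "J (x, t)" and ?q' = "J (x', t)"
    have in_B: "?q \<in> B" "?q' \<in> B" using JB' x by auto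
    have "\<Phi> i ?q' - \<Phi> i ?q = (\<Sum>e\<in>Basis. ((?q' - ?q) \<bullet> e) * mean_dd e (\<Phi> i) (?q, ?q'))"
      by (rule hadamard_increment[OF B(1) in_B diff cdd])
    also have "\<dots> = (\<Sum>j\<in>UNIV. Mh i j ((x, x'), t) * (P j (x', t) - P j (x, t)))
        + (\<Sum>j\<in>UNIV. (x' - x) * (mean_dd (ev j) (\<Phi> i) (?q, ?q') * Xh j ((x, x'), t)))"
      unfolding sum_Basis_jet' Mh_def
      by (simp add: inner_diff_left J_def pack_inner X_incr[OF x] mult.assoc mult.commute mult.left_commute)
    finally show ?thesis by (simp add: bh_def sum_distrib_left)
  qed
  have Mh_le: "(\<Sum>j\<in>UNIV. \<bar>Mh i j q\<bar>) \<le> 2 * \<kappa>" if "q \<in> (I \<times> I) \<times> I" for i q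
  proof -
    have "\<bar>Mh i j q\<bar> \<le> \<kappa>" for j
      using that JB' unfolding Mh_def split_def
      by (intro abs_mean_dd_le[OF B(1) cdd[OF ev_ep_Basis(2)]] \<kappa>(3)) auto
    from add_mono[OF this[of True] this[of False]] show ?thesis by (simp add: UNIV_bool)
  qed
  have "\<exists>S. (\<forall>i. continuous_on (I \<times> I) (S i)) \<and>
    (\<forall>i. \<forall>x\<in>I. \<forall>t\<in>I. ((\<lambda>x. P i (x, t)) has_real_derivative S i (x, t)) (at x) \<and>
       S i (x, t) = \<alpha> i + t * integral {0..1}
          (\<lambda>\<theta>. (\<Sum>j\<in>UNIV. Mh i j ((x, x), \<theta> * t) * S j (x, \<theta> * t)) + bh i ((x, x), \<theta> * t)))"
    unfolding I_def
  proof (rule parameter_derivative_of_integral_equation[where \<kappa>="2 * \<kappa>"], unfold I_def[symmetric])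
    show "continuous_on ((I \<times> I) \<times> I) (Mh i j)" for i j
      using cm[OF ev_ep_Basis(2), of j i] by (simp add: Mh_def split_def)
    show "continuous_on ((I \<times> I) \<times> I) (bh i)" for i
      unfolding bh_def[abs_def] by (intro continuous_intros cm cXh ev_ep_Basis)
    fix i x x' t assume x: "x \<in> I" "x' \<in> I" "t \<in> I"
    have th: "\<theta> * t \<in> I" if "\<theta> \<in> {0..1}" for \<theta> using star x(3) that by (simp add: theta_closed_def)
    let ?R = "\<lambda>q. \<Phi> i (J q)"
    have "P i (x', t) - P i (x, t)
       = (x' - x) * \<alpha> i + t * (integral {0..1} (\<lambda>\<theta>. ?R (x', \<theta> * t)) - integral {0..1} (\<lambda>\<theta>. ?R (x, \<theta> * t)))"
      using Peq[of x' t i] Peq[of x t i] x by (simp add: mean_t_def J_def algebra_simps)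
    also have "integral {0..1} (\<lambda>\<theta>. ?R (x', \<theta> * t)) - integral {0..1} (\<lambda>\<theta>. ?R (x, \<theta> * t))
       = integral {0..1} (\<lambda>\<theta>. ?R (x', \<theta> * t) - ?R (x, \<theta> * t))"
      using continuous_on_theta_slice(2)[OF star c\<Phi>J x(1,3)] continuous_on_theta_slice(2)[OF star c\<Phi>J x(2,3)]
      by (subst integral_diff) (auto intro!: integrable_continuous_real)
    also have "\<dots> = integral {0..1} (\<lambda>\<theta>. (\<Sum>j\<in>UNIV. Mh i j ((x, x'), \<theta> * t) * (P j (x', \<theta> * t) - P j (x, \<theta> * t)))
            + (x' - x) * bh i ((x, x'), \<theta> * t))"
      by (rule Henstock_Kurzweil_Integration.integral_cong) (rule \<Phi>_incr[OF x(1,2) th])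
    finally show "P i (x', t) - P i (x, t) = (x' - x) * \<alpha> i + t * integral {0..1}
          (\<lambda>\<theta>. (\<Sum>j\<in>UNIV. Mh i j ((x, x'), \<theta> * t) * (P j (x', \<theta> * t) - P j (x, \<theta> * t)))
            + (x' - x) * bh i ((x, x'), \<theta> * t))" .
  qed (use P Mh_le \<kappa> in auto)
  then obtain S where S: "\<And>i. continuous_on (I \<times> I) (S i)"
    and Px: "\<And>i x t. x \<in> I \<Longrightarrow> t \<in> I \<Longrightarrow> ((\<lambda>x. P i (x, t)) has_real_derivative S i (x, t)) (at x)"
    and Seq0: "\<And>i x t. x \<in> I \<Longrightarrow> t \<in> I \<Longrightarrow> S i (x, t) = \<alpha> i + t * integral {0..1}
          (\<lambda>\<theta>. (\<Sum>j\<in>UNIV. Mh i j ((x, x), \<theta> * t) * S j (x, \<theta> * t)) + bh i ((x, x), \<theta> * t))"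
    by blast
  define M where "M i j q = dd (ep j) (\<Phi> i) (J q)" for i j q
  define b where "b i q = (\<Sum>j\<in>UNIV. dd (ev j) (\<Phi> i) (J q) * P j q)" for i q
  have diag: "Mh i j ((x, x), t) = M i j (x, t)" "bh i ((x, x), t) = b i (x, t)" for i j x t
    by (simp_all add: Mh_def M_def bh_def b_def mean_dd_diagonal Xh_def)
  have Seq: "S i (x, t) = \<alpha> i + t * mean_t (\<lambda>q. (\<Sum>j\<in>UNIV. M i j q * S j q) + b i q) (x, t)"
    if "x \<in> I" "t \<in> I" for i x t
    using Seq0[OF that, of i] by (simp add: mean_t_def diag)
  have M_le: "(\<Sum>j\<in>UNIV. \<bar>M i j q\<bar>) \<le> 2 * \<kappa>" if "q \<in> I \<times> I" for i q
    using Mh_le[of "((fst q, fst q), snd q)" i] that by (auto simp: diag)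
  have PXk: "\<forall>i. Ck_on k (I \<times> I) (P i) \<and> Ck_on k (I \<times> I) (X i)" for k
  proof (induction k)
    case 0
    then show ?case using P cX by simp
  next
    case (Suc k)
    have comp_k: "Ck_on k (I \<times> I) (\<lambda>q. f (J q))" if "Ck_on k V f" for f
      unfolding J_def using Suc JB B(2) that by (intro Ck_on_compose_pack[OF op]) auto
    have "Ck_on k (I \<times> I) (S i)" for i
      unfolding I_def
    proof (rule linear_integral_equation_Ck[where \<kappa>="2 * \<kappa>" and M=M and b=b and d=\<alpha>], unfold I_def[symmetric])
      show "Ck_on k (I \<times> I) (M i j)" for i j
        unfolding M_def[abs_def] by (intro comp_k dd\<Phi>k ev_ep_Basis)
      show "Ck_on k (I \<times> I) (b i)" for i
        unfolding b_def[abs_def] using Suc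
        by (intro Ck_on_sum[OF op] Ck_on_mult[OF op] comp_k dd\<Phi>k ev_ep_Basis) auto
    qed (use M_le \<kappa> S Seq in auto)
    then have Pk: "Ck_on (Suc k) (I \<times> I) (P i)" for i
      using Px Pt by (intro Ck_on_SucI_partials[OF op, where ?f1.0="S i" and ?f2.0="\<lambda>q. \<Phi> i (J q)"])
        (auto intro: comp_k \<Phi>k)
    have "Ck_on k (I \<times> I) (\<lambda>q. c i + fst q * mean_x (\<lambda>q. \<Phi> i (J q)) q)" for i
      using Ck_on_x_primitive[of k r "\<lambda>q. \<Phi> i (J q)"] comp_k[OF \<Phi>k, of i]
      by (intro Ck_on_add[OF op] Ck_on_const) (simp add: I_def split_def)
    then have "Ck_on (Suc k) (I \<times> I) (X i)" for i
      using Xx Xt Suc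
      by (intro Ck_on_SucI_partials[OF op, where ?f1.0="P i" and ?f2.0="\<lambda>q. c i + fst q * mean_x (\<lambda>q. \<Phi> i (J q)) q"])
        auto
    with Pk show ?case by blast
  qed
  have diffPX: "P i differentiable (at q)" "X i differentiable (at q)" if "q \<in> I \<times> I" for i q
    using PXk[of "Suc 0"] that by auto
  have zz: "(0, 0) \<in> I \<times> I" using zero by simp
  show thesis
  proof (rule that[of r P X, folded I_def])
    show "0 < r" by (rule r)
    show "smooth_on (I \<times> I) (P i)" "smooth_on (I \<times> I) (X i)" for i using PXk by (auto simp: smooth_on_def)
    show "pack X P ` (I \<times> I) \<subseteq> V" using JB B(2) by blast
    show "D1 (X i) q = P i q" if "q \<in> I \<times> I" for i q
      using Ck_on_partials(1)[of "X i" "fst q" "snd q"] diffPX(2)[OF that] Xx[of "fst q" "snd q" i] that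
      by (auto dest: DERIV_unique)
    show "D2 (P i) q = \<Phi> i (pack X P q)" if "q \<in> I \<times> I" for i q
      using Ck_on_partials(2)[of "P i" "fst q" "snd q"] diffPX(1)[OF that] Pt[of "fst q" "snd q" i] that
      by (auto simp: J_def dest: DERIV_unique)
    show "X i (0, 0) = x0 i" "P i (0, 0) = p0 i" for i using Xeq[of i 0 0] Peq[of 0 0 i] zero by auto
    show "D1 (P i) (0, 0) = \<alpha> i" for i
      using DERIV_unique[OF Ck_on_partials(1)[OF diffPX(1)[OF zz]] Px[OF zero zero]] Seq[OF zero zero, of i] by simp
    show "D2 (X i) (0, 0) = c i" for i
      using DERIV_unique[OF Ck_on_partials(2)[OF diffPX(2)[OF zz]] Xt[OF zero zero]] by simp
  qed
  qed
qed

lemma smooth_on_imp_differentiable: "smooth_on S f \<Longrightarrow> p \<in> S \<Longrightarrow> f differentiable (at p)"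
  unfolding smooth_on_def by (metis Ck_on.simps(2))

text \<open>The values of \<open>u_xx, v_xx, u_t, v_t\<close> at the origin are free because they are the slopes of the affine
Goursat data.\<close>

lemma system_solution_with_data:
  fixes z z1 y y1 :: real
  assumes V: "open V" "(z, z1, y, y1) \<in> V" and sm: "smooth_on V F" "smooth_on V G"
  obtains \<Omega> u v where "open \<Omega>" "(0, 0) \<in> \<Omega>" "smooth_on \<Omega> u" "smooth_on \<Omega> v"
    "jet_of u v ` \<Omega> \<subseteq> V" "solves_system F G \<Omega> u v" "jet_of u v (0, 0) = (z, z1, y, y1)"
    "D1 (D1 u) (0, 0) = uxx" "D1 (D1 v) (0, 0) = vxx" "D2 u (0, 0) = ut" "D2 v (0, 0) = vt"
proof -
  have V': "(if True then z else y, if True then z1 else y1, if False then z else y, if False then z1 else y1) \<in> V"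
    using V(2) by simp
  have sm': "smooth_on V (if i then F else G)" for i using sm by simp
  show thesis
  proof (rule goursat_smooth_solution[where \<Phi>="\<lambda>i. if i then F else G" and ?x0.0="\<lambda>i. if i then z else y" and ?p0.0="\<lambda>i. if i then z1 else y1"
      and \<alpha>="\<lambda>i. if i then uxx else vxx" and c="\<lambda>i. if i then ut else vt", OF V(1) V' sm'])
  fix r :: real and P X
  assume r: "0 < r"
    and P: "\<And>i. smooth_on ({-r<..<r} \<times> {-r<..<r}) (P i)" and X: "\<And>i. smooth_on ({-r<..<r} \<times> {-r<..<r}) (X i)"
    and PV: "pack X P ` ({-r<..<r} \<times> {-r<..<r}) \<subseteq> V"
    and D: "\<And>i q. q \<in> {-r<..<r} \<times> {-r<..<r} \<Longrightarrow> D1 (X i) q = P i q"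
      "\<And>i q. q \<in> {-r<..<r} \<times> {-r<..<r} \<Longrightarrow> D2 (P i) q = (if i then F else G) (pack X P q)"
    and I: "\<And>i. X i (0, 0) = (if i then z else y)" "\<And>i. P i (0, 0) = (if i then z1 else y1)"
      "\<And>i. D1 (P i) (0, 0) = (if i then uxx else vxx)" "\<And>i. D2 (X i) (0, 0) = (if i then ut else vt)"
  define \<Omega> where "\<Omega> = {-r<..<r} \<times> {-r<..<r}"
  note D = D[folded \<Omega>_def]
  have op: "open \<Omega>" by (simp add: \<Omega>_def open_Times)
  have zz: "(0, 0) \<in> \<Omega>" using r by (simp add: \<Omega>_def)
  have jet: "jet_of (X True) (X False) q = pack X P q" if "q \<in> \<Omega>" for q
    using D(1)[OF that] by (simp add: jet_of_def pack_def)
  have DD: "dd e (D1 (X i)) q = dd e (P i) q" if "q \<in> \<Omega>" for e i q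
    by (rule dd_cong_open(1)[OF op that D(1)])
  show thesis
  proof (rule that[of \<Omega> "X True" "X False"])
    show "smooth_on \<Omega> (X True)" "smooth_on \<Omega> (X False)" using X by (simp_all add: \<Omega>_def)
    show "jet_of (X True) (X False) ` \<Omega> \<subseteq> V" using PV jet by (auto simp: \<Omega>_def)
    show "solves_system F G \<Omega> (X True) (X False)"
      unfolding solves_system_def using D(2) jet DD by auto
    show "jet_of (X True) (X False) (0, 0) = (z, z1, y, y1)"
      using jet[OF zz] I by (simp add: pack_def)
  qed (use op zz DD[OF zz] I in auto)
  qed
qed

section \<open>Smooth functions of some of the jet variables\<close>

lemma smooth_onD: "smooth_on S f \<Longrightarrow> Ck_on k S f"
  by (simp add: smooth_on_def)

lemma smooth_on_cong: "open S \<Longrightarrow> (\<And>x. x \<in> S \<Longrightarrow> f x = g x) \<Longrightarrow> smooth_on S f \<Longrightarrow> smooth_on S g"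
  unfolding smooth_on_def using Ck_on_cong by blast

lemma smooth_on_subset: "smooth_on S f \<Longrightarrow> T \<subseteq> S \<Longrightarrow> smooth_on T f"
  unfolding smooth_on_def using Ck_on_subset by blast

lemma smooth_on_const [simp]: "smooth_on S (\<lambda>_. c)"
  by (simp add: smooth_on_def)

lemma smooth_on_add: "open S \<Longrightarrow> smooth_on S f \<Longrightarrow> smooth_on S g \<Longrightarrow> smooth_on S (\<lambda>x. f x + g x)"
  by (simp add: smooth_on_def Ck_on_add)

lemma smooth_on_mult: "open S \<Longrightarrow> smooth_on S f \<Longrightarrow> smooth_on S g \<Longrightarrow> smooth_on S (\<lambda>x. f x * g x)"
  by (simp add: smooth_on_def Ck_on_mult)

lemma smooth_on_diff: "open S \<Longrightarrow> smooth_on S f \<Longrightarrow> smooth_on S g \<Longrightarrow> smooth_on S (\<lambda>x. f x - g x)"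
  using smooth_on_add[of S f "\<lambda>x. - 1 * g x"] smooth_on_mult[of S "\<lambda>_. - 1" g] by simp

lemma smooth_on_linear: "linear l \<Longrightarrow> smooth_on S l"
  by (simp add: smooth_on_def Ck_on_linear)

lemma smooth_on_dd: "smooth_on S f \<Longrightarrow> e \<in> Basis \<Longrightarrow> smooth_on S (dd e f)"
  unfolding smooth_on_def by (metis Ck_on.simps(2))

lemma smooth_on_compose:
  fixes g :: "'a::euclidean_space \<Rightarrow> 'b::euclidean_space"
  assumes "open S" "g ` S \<subseteq> T" "smooth_on T f" "\<And>b. b \<in> Basis \<Longrightarrow> smooth_on S (\<lambda>x. g x \<bullet> b)"
  shows "smooth_on S (\<lambda>x. f (g x))"
  using assms(3,4) unfolding smooth_on_def by (blast intro: Ck_on_compose[OF assms(1,2)])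

lemma smooth_on_compose2:
  fixes g1 g2 :: "'a::euclidean_space \<Rightarrow> real"
  assumes "open S" "\<And>x. x \<in> S \<Longrightarrow> (g1 x, g2 x) \<in> T" "smooth_on T f" "smooth_on S g1" "smooth_on S g2"
  shows "smooth_on S (\<lambda>x. f (g1 x, g2 x))"
  by (rule smooth_on_compose[where g="\<lambda>x. (g1 x, g2 x)" and T=T])
    (use assms in \<open>auto simp: Basis_real2\<close>)

lemma smooth_on_D [intro]: "smooth_on S p \<Longrightarrow> smooth_on S (D1 p)" "smooth_on S p \<Longrightarrow> smooth_on S (D2 p)"
  by (auto intro!: smooth_on_dd simp: Basis_real2)

lemma dd_const: "dd e (\<lambda>_. c) p = 0"
  by (rule dd_has_derivative[where f'="\<lambda>_. 0"]) simp

lemma dd_add: "f differentiable (at p) \<Longrightarrow> g differentiable (at p) \<Longrightarrow>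
    dd e (\<lambda>x. f x + g x) p = dd e f p + dd e g p"
  by (rule dd_has_derivative[OF has_derivative_add[OF has_derivative_dd has_derivative_dd]])

lemma dd_diff: "f differentiable (at p) \<Longrightarrow> g differentiable (at p) \<Longrightarrow>
    dd e (\<lambda>x. f x - g x) p = dd e f p - dd e g p"
  by (rule dd_has_derivative[OF has_derivative_diff[OF has_derivative_dd has_derivative_dd]])

lemma dd_mult: "f differentiable (at p) \<Longrightarrow> g differentiable (at p) \<Longrightarrow>
    dd e (\<lambda>x. f x * g x) p = f p * dd e g p + dd e f p * g p"
  for f g :: "'a::real_normed_vector \<Rightarrow> real"
  by (rule dd_has_derivative[OF has_derivative_mult[OF has_derivative_dd has_derivative_dd]])

lemma dd_cmult: "f differentiable (at p) \<Longrightarrow> dd e (\<lambda>x. c * f x) p = c * dd e f p"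
  for f :: "'a::real_normed_vector \<Rightarrow> real"
  by (simp add: dd_mult dd_const)

lemma has_derivative_D1_D2:
  assumes "f differentiable (at (p :: real \<times> real))"
  shows "(f has_derivative (\<lambda>v. fst v * D1 f p + snd v * D2 f p)) (at p)"
proof -
  have "(\<lambda>v. dd v f p) = (\<lambda>v. fst v * D1 f p + snd v * D2 f p)"
  proof (rule ext)
    fix v :: "real \<times> real"
    show "dd v f p = fst v * D1 f p + snd v * D2 f p"
      using dd_Basis_expansion[OF assms, of v] by (simp add: Basis_real2 inner_prod_def)
  qed
  with has_derivative_dd[OF assms] show ?thesis by (simp only:)
qed

abbreviation "Ez \<equiv> (1, 0, 0, 0) :: jet"
abbreviation "Ez1 \<equiv> (0, 1, 0, 0) :: jet"
abbreviation "Ey \<equiv> (0, 0, 1, 0) :: jet"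
abbreviation "Ey1 \<equiv> (0, 0, 0, 1) :: jet"

definition lift_m :: "(real \<times> real \<Rightarrow> real) \<Rightarrow> jet \<Rightarrow> real" where
  "lift_m g = (\<lambda>(z, z1, y, y1). g (z1, y1))"

definition lift_w :: "(real \<times> real \<Rightarrow> real) \<Rightarrow> jet \<Rightarrow> real" where
  "lift_w p = (\<lambda>(z, z1, y, y1). p (z, y))"

lemma lift_simps [simp]: "lift_m g (z, z1, y, y1) = g (z1, y1)" "lift_w p (z, z1, y, y1) = p (z, y)"
  by (simp_all add: lift_m_def lift_w_def)

lemma lift_m_has_derivative:
  assumes "g differentiable (at (z1, y1))"
  shows "(lift_m g has_derivative (\<lambda>v. fst (snd v) * D1 g (z1, y1) + snd (snd (snd v)) * D2 g (z1, y1)))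
     (at (z, z1, y, y1))"
proof -
  have "((\<lambda>q. (fst (snd q), snd (snd (snd q)))) has_derivative (\<lambda>v. (fst (snd v), snd (snd (snd v)))))
      (at (z, z1, y, y1 :: real))"
    by (intro derivative_intros)
  from has_derivative_compose[OF this, of g "\<lambda>v. fst v * D1 g (z1, y1) + snd v * D2 g (z1, y1)"]
    has_derivative_D1_D2[OF assms]
  show ?thesis by (simp add: lift_m_def split_def)
qed

lemma lift_w_has_derivative:
  assumes "p differentiable (at (z, y))"
  shows "(lift_w p has_derivative (\<lambda>v. fst v * D1 p (z, y) + fst (snd (snd v)) * D2 p (z, y)))
     (at (z, z1, y, y1))"
proof -
  have "((\<lambda>q. (fst q, fst (snd (snd q)))) has_derivative (\<lambda>v. (fst v, fst (snd (snd v)))))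
      (at (z, z1, y, y1 :: real))"
    by (intro derivative_intros)
  from has_derivative_compose[OF this, of p "\<lambda>v. fst v * D1 p (z, y) + snd v * D2 p (z, y)"]
    has_derivative_D1_D2[OF assms]
  show ?thesis by (simp add: lift_w_def split_def)
qed

lemma dd_lift_m:
  assumes "g differentiable (at (z1, y1))"
  shows "dd v (lift_m g) (z, z1, y, y1) = fst (snd v) * D1 g (z1, y1) + snd (snd (snd v)) * D2 g (z1, y1)"
    and "lift_m g differentiable (at (z, z1, y, y1))"
  by (rule dd_has_derivative[OF lift_m_has_derivative[OF assms]])
    (rule differentiableI[OF lift_m_has_derivative[OF assms]])

lemma dd_lift_w:
  assumes "p differentiable (at (z, y))"
  shows "dd v (lift_w p) (z, z1, y, y1) = fst v * D1 p (z, y) + fst (snd (snd v)) * D2 p (z, y)"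
    and "lift_w p differentiable (at (z, z1, y, y1))"
  by (rule dd_has_derivative[OF lift_w_has_derivative[OF assms]])
    (rule differentiableI[OF lift_w_has_derivative[OF assms]])

lemma in_projections: "(z, z1, y, y1) \<in> V \<Longrightarrow> (z1, y1) \<in> proj_z1y1 V" "(z, z1, y, y1) \<in> V \<Longrightarrow> (z, y) \<in> proj_zy V"
  by (force simp: proj_z1y1_def proj_zy_def)+

lemma smooth_on_lift_m:
  assumes "open V" "smooth_on (proj_z1y1 V) g"
  shows "smooth_on V (lift_m g)"
  unfolding lift_m_def split_def
proof (rule smooth_on_compose2[OF assms(1) _ assms(2)])
  show "(fst (snd q), snd (snd (snd q))) \<in> proj_z1y1 V" if "q \<in> V" for q
    using in_projections(1)[of "fst q" "fst (snd q)" "fst (snd (snd q))" "snd (snd (snd q))"] that by simp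
qed (rule smooth_on_linear, rule linearI; simp)+

lemma smooth_on_lift_w:
  assumes "open V" "smooth_on (proj_zy V) p"
  shows "smooth_on V (lift_w p)"
  unfolding lift_w_def split_def
proof (rule smooth_on_compose2[OF assms(1) _ assms(2)])
  show "(fst q, fst (snd (snd q))) \<in> proj_zy V" if "q \<in> V" for q
    using in_projections(2)[of "fst q" "fst (snd q)" "fst (snd (snd q))" "snd (snd (snd q))"] that by simp
qed (rule smooth_on_linear, rule linearI; simp)+

lemma open_projections:
  assumes "open V"
  shows "open (proj_z1y1 V)" "open (proj_zy V)"
proof -
  have 1: "proj_z1y1 V = (\<lambda>q. (fst (snd q), snd (snd (snd q)))) ` V"
    and 2: "proj_zy V = (\<lambda>q. (fst q, fst (snd (snd q)))) ` V"
    by (auto simp: proj_z1y1_def proj_zy_def split_def)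
  show "open (proj_z1y1 V)" unfolding 1
  proof (rule open_surjective_linear_image[OF assms])
    show "linear (\<lambda>q. (fst (snd q), snd (snd (snd q))) :: real \<times> real)" by (rule linearI) auto
    show "surj (\<lambda>q :: jet. (fst (snd q), snd (snd (snd q))))"
      by (rule surjI[of _ "\<lambda>(a, b). (0, a, 0, b)"]) auto
  qed
  show "open (proj_zy V)" unfolding 2
  proof (rule open_surjective_linear_image[OF assms])
    show "linear (\<lambda>q :: jet. (fst q, fst (snd (snd q))) :: real \<times> real)" by (rule linearI) auto
    show "surj (\<lambda>q :: jet. (fst q, fst (snd (snd q))))"
      by (rule surjI[of _ "\<lambda>(a, b). (a, 0, b, 0)"]) auto
  qed
qed

lemma dd_comp_jet_of:
  assumes "open \<Omega>" "q \<in> \<Omega>" "smooth_on \<Omega> u" "smooth_on \<Omega> v" "f differentiable (at (jet_of u v q))"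
  shows "dd e (f \<circ> jet_of u v) q = dd Ez f (jet_of u v q) * dd e u q + dd Ez1 f (jet_of u v q) * dd e (D1 u) q
     + dd Ey f (jet_of u v q) * dd e v q + dd Ey1 f (jet_of u v q) * dd e (D1 v) q"
proof -
  have d: "u differentiable (at q)" "D1 u differentiable (at q)" "v differentiable (at q)" "D1 v differentiable (at q)"
    using smooth_on_imp_differentiable assms by blast+
  have "(jet_of u v has_derivative (\<lambda>e. (dd e u q, dd e (D1 u) q, dd e v q, dd e (D1 v) q))) (at q)"
    unfolding jet_of_def[abs_def] by (intro has_derivative_Pair has_derivative_dd d)
  from has_derivative_compose[OF this has_derivative_dd[OF assms(5)]]
  have "dd e (f \<circ> jet_of u v) q = dd (dd e u q, dd e (D1 u) q, dd e v q, dd e (D1 v) q) f (jet_of u v q)"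
    by (intro dd_has_derivative) (simp add: comp_def)
  then show ?thesis
    using dd_Basis_expansion[OF assms(5), of "(dd e u q, dd e (D1 u) q, dd e v q, dd e (D1 v) q)"]
    by (simp add: sum_Basis_jet)
qed

section \<open>Zero sets of differentiable functions\<close>

text \<open>Near a point where \<open>dd e f\<close> does not vanish, Hadamard's formula shows that two zeros of \<open>f\<close> differ in
direction \<open>e\<close> by at most a constant times their difference orthogonal to \<open>e\<close>. So locally the set is the
image of a subset of a hyperplane under a Lipschitz map.\<close>

lemma negligible_zero_set:
  fixes f :: "'a::euclidean_space \<Rightarrow> real"
  assumes V: "open V" and C1: "Ck_on (Suc 0) V f" and e: "e \<in> Basis"
  shows "negligible {q \<in> V. f q = 0 \<and> dd e f q \<noteq> 0}" (is "negligible ?N")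
proof (subst locally_negligible_alt, intro ballI)
  fix q0 assume q0: "q0 \<in> ?N"
  obtain \<rho> where \<rho>: "\<rho> > 0" "ball q0 \<rho> \<subseteq> V" using V q0 by (auto simp: open_contains_ball)
  let ?B = "ball q0 \<rho>"
  define c where "c = \<bar>dd e f q0\<bar> / 2"
  have c: "c > 0" using q0 by (simp add: c_def)
  have cdd: "continuous_on ?B (dd b f)" if "b \<in> Basis" for b
    by (rule continuous_on_subset[OF _ \<rho>(2)]) (use C1 that in simp)
  have near: "\<forall>\<^sub>F p in nhds (q0, q0). dist (mean_dd b f p) (dd b f q0) < \<epsilon>" if "b \<in> Basis" "\<epsilon> > 0" for b \<epsilon>
  proof -
    have "isCont (mean_dd b f) (q0, q0)"
      using continuous_on_mean_dd[OF convex_ball cdd[OF that(1)]] \<rho>(1)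
      by (simp add: continuous_on_eq_continuous_at open_Times)
    then have "(mean_dd b f \<longlongrightarrow> dd b f q0) (nhds (q0, q0))"
      using tendsto_at_iff_tendsto_nhds[of "mean_dd b f" "(q0, q0)"]
      by (simp add: isCont_def mean_dd_diagonal)
    then show ?thesis using that(2) by (rule tendstoD)
  qed
  define \<epsilon> where "\<epsilon> = min 1 c"
  have \<epsilon>: "\<epsilon> > 0" "\<epsilon> \<le> 1" "\<epsilon> \<le> c" using c by (auto simp: \<epsilon>_def)
  have "\<forall>\<^sub>F p in nhds (q0, q0). \<forall>b\<in>Basis. dist (mean_dd b f p) (dd b f q0) < \<epsilon>"
    using near \<epsilon>(1) by (intro eventually_ball_finite) auto
  then obtain W where W: "open W" "(q0, q0) \<in> W"
    "\<And>p b. p \<in> W \<Longrightarrow> b \<in> Basis \<Longrightarrow> dist (mean_dd b f p) (dd b f q0) < \<epsilon>"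
    by (auto simp: eventually_nhds)
  obtain X Y where XY: "open X" "open Y" "(q0, q0) \<in> X \<times> Y" "X \<times> Y \<subseteq> W"
    using W(1,2) by (rule open_prod_elim)
  define U where "U = X \<inter> Y \<inter> ?B"
  have U: "open U" "q0 \<in> U" "U \<subseteq> ?B" using XY \<rho>(1) by (auto simp: U_def)
  define K where "K = (\<Sum>b\<in>Basis. \<bar>dd b f q0\<bar> + 1)"
  have K_nn: "K \<ge> 0" by (simp add: K_def sum_nonneg)
  have near2: "\<bar>mean_dd b f (q, q') - dd b f q0\<bar> < \<epsilon>" if "q \<in> U" "q' \<in> U" "b \<in> Basis" for q q' b
    using W(3)[of "(q, q')" b] XY(4) that by (auto simp: U_def dist_real_def)
  \<comment> \<open>\<open>\<pi>\<close> is the projection along \<open>e\<close>; it is injective on the zeros near \<open>q0\<close>, with Lipschitz inverse.\<close>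
  define \<pi> where "\<pi> x = x - (x \<bullet> e) *\<^sub>R e" for x :: 'a
  have \<pi>_diff: "\<pi> x - \<pi> y = \<pi> (x - y)" for x y by (simp add: \<pi>_def algebra_simps inner_diff_left)
  have \<pi>_inner: "\<pi> x \<bullet> b = (if b = e then 0 else x \<bullet> b)" if "b \<in> Basis" for x b
    using that e by (simp add: \<pi>_def inner_diff_left inner_Basis)
  define L where "L = 1 + K / c"
  have lip: "norm (q' - q) \<le> L * norm (\<pi> q' - \<pi> q)" if "q \<in> ?N \<inter> U" "q' \<in> ?N \<inter> U" for q q'
  proof -
    let ?v = "q' - q"
    have qU: "q \<in> U" "q' \<in> U" using that by auto
    have "f q' - f q = (\<Sum>b\<in>Basis. (?v \<bullet> b) * mean_dd b f (q, q'))"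
      by (rule hadamard_increment[OF convex_ball, of _ q0 \<rho>]) (use qU U(3) \<rho>(2) C1 cdd in auto)
    then have "0 = (?v \<bullet> e) * mean_dd e f (q, q') + (\<Sum>b\<in>Basis - {e}. (?v \<bullet> b) * mean_dd b f (q, q'))"
      using that e by (simp add: sum.remove[of Basis e])
    then have "\<bar>?v \<bullet> e\<bar> * \<bar>mean_dd e f (q, q')\<bar> = \<bar>\<Sum>b\<in>Basis - {e}. (?v \<bullet> b) * mean_dd b f (q, q')\<bar>"
      by (simp add: abs_mult[symmetric] add_eq_0_iff)
    also have "\<dots> \<le> (\<Sum>b\<in>Basis - {e}. norm (\<pi> ?v) * (\<bar>dd b f q0\<bar> + 1))"
    proof (rule order_trans[OF sum_abs sum_mono])
      fix b :: 'a assume b: "b \<in> Basis - {e}"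
      then have "\<bar>?v \<bullet> b\<bar> \<le> norm (\<pi> ?v)"
        using Basis_le_norm[of b "\<pi> ?v"] \<pi>_inner[of b ?v] by auto
      moreover have "\<bar>mean_dd b f (q, q')\<bar> \<le> \<bar>dd b f q0\<bar> + 1" using near2[OF qU, of b] b \<epsilon>(2) by auto
      ultimately show "\<bar>(?v \<bullet> b) * mean_dd b f (q, q')\<bar> \<le> norm (\<pi> ?v) * (\<bar>dd b f q0\<bar> + 1)"
        unfolding abs_mult by (intro mult_mono) auto
    qed
    also have "\<dots> \<le> norm (\<pi> ?v) * K"
      unfolding K_def sum_distrib_left by (rule sum_mono2) auto
    finally have 1: "\<bar>?v \<bullet> e\<bar> * \<bar>mean_dd e f (q, q')\<bar> \<le> norm (\<pi> ?v) * K" .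
    have "c \<le> \<bar>mean_dd e f (q, q')\<bar>" using near2[OF qU e] \<epsilon>(3) by (simp add: c_def)
    then have "\<bar>?v \<bullet> e\<bar> * c \<le> norm (\<pi> ?v) * K"
      using mult_left_mono[of c "\<bar>mean_dd e f (q, q')\<bar>" "\<bar>?v \<bullet> e\<bar>"] 1 by simp
    then have 2: "\<bar>?v \<bullet> e\<bar> \<le> K / c * norm (\<pi> ?v)" using c by (simp add: field_simps)
    have "norm ?v \<le> norm (\<pi> ?v) + \<bar>?v \<bullet> e\<bar>"
      using norm_triangle_ineq[of "\<pi> ?v" "(?v \<bullet> e) *\<^sub>R e"] e by (simp add: \<pi>_def)
    with 2 have "norm ?v \<le> L * norm (\<pi> ?v)" by (simp add: L_def algebra_simps)
    then show ?thesis by (simp add: \<pi>_diff)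
  qed
  have inj: "inj_on \<pi> (?N \<inter> U)"
  proof (rule inj_onI)
    fix q q' assume "q \<in> ?N \<inter> U" "q' \<in> ?N \<inter> U" "\<pi> q = \<pi> q'"
    with lip[of q q'] show "q = q'" by simp
  qed
  define \<psi> where "\<psi> = inv_into (?N \<inter> U) \<pi>"
  have \<psi>: "\<psi> (\<pi> q) = q" if "q \<in> ?N \<inter> U" for q
    using inv_into_f_f[OF inj that] by (simp add: \<psi>_def)
  have "negligible (\<psi> ` \<pi> ` (?N \<inter> U))"
  proof (rule negligible_locally_Lipschitz_image)
    have "\<pi> ` (?N \<inter> U) \<subseteq> {x. x \<bullet> e = 0}" using \<pi>_inner[OF e] by auto
    then show "negligible (\<pi> ` (?N \<inter> U))"
      using negligible_standard_hyperplane[OF e, of 0] negligible_subset by blast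
    fix x assume "x \<in> \<pi> ` (?N \<inter> U)"
    then obtain q where q: "x = \<pi> q" "q \<in> ?N \<inter> U" by blast
    have "norm (\<psi> y - \<psi> x) \<le> L * norm (y - x)" if "y \<in> \<pi> ` (?N \<inter> U)" for y
    proof -
      obtain q' where q': "y = \<pi> q'" "q' \<in> ?N \<inter> U" using \<open>y \<in> _\<close> by blast
      show ?thesis unfolding q(1) q'(1) \<psi>[OF q(2)] \<psi>[OF q'(2)] by (rule lip[OF q(2) q'(2)])
    qed
    then show "\<exists>T B. open T \<and> x \<in> T \<and> (\<forall>y\<in>\<pi> ` (?N \<inter> U) \<inter> T. norm (\<psi> y - \<psi> x) \<le> B * norm (y - x))"
      by (intro exI[of _ UNIV] exI[of _ L]) auto
  qed simp
  moreover have "\<psi> ` \<pi> ` (?N \<inter> U) = ?N \<inter> U" using \<psi> by (force simp: image_iff)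
  ultimately show "\<exists>S. openin (top_of_set ?N) S \<and> q0 \<in> S \<and> negligible S"
    using U(1,2) q0 by (intro exI[of _ "?N \<inter> U"]) (auto simp: openin_open)
qed

section \<open>The separated form of the structure equations\<close>

text \<open>Here \<open>f11 = g\<close> and \<open>f21 = h\<close> depend on \<open>(z1, y1)\<close> only, while \<open>f12 = A\<close>,
\<open>f22 = B\<close> and \<open>f32 = p\<close> depend on \<open>(z, y)\<close> only. The three equations are the structure
equations after inserting \<open>u_xt = F\<close> and \<open>v_xt = G\<close>; all other second derivatives have dropped out.\<close>

definition separated ::
    "real \<Rightarrow> real \<Rightarrow> (jet \<Rightarrow> real) \<Rightarrow> (jet \<Rightarrow> real) \<Rightarrow> (nat \<Rightarrow> nat \<Rightarrow> jet \<Rightarrow> real) \<Rightarrow> jet set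
      \<Rightarrow> (real \<times> real \<Rightarrow> real) \<Rightarrow> (real \<times> real \<Rightarrow> real)
      \<Rightarrow> (real \<times> real \<Rightarrow> real) \<Rightarrow> (real \<times> real \<Rightarrow> real) \<Rightarrow> (real \<times> real \<Rightarrow> real) \<Rightarrow> bool" where
  "separated \<delta> \<eta> F G f V g h A B p \<longleftrightarrow>
     smooth_on (proj_z1y1 V) g \<and> smooth_on (proj_z1y1 V) h \<and>
     smooth_on (proj_zy V) A \<and> smooth_on (proj_zy V) B \<and> smooth_on (proj_zy V) p \<and>
     (\<forall>z z1 y y1. (z, z1, y, y1) \<in> V \<longrightarrow>
        f 1 1 (z, z1, y, y1) = g (z1, y1) \<and> f 1 2 (z, z1, y, y1) = A (z, y) \<and>
        f 2 1 (z, z1, y, y1) = h (z1, y1) \<and> f 2 2 (z, z1, y, y1) = B (z, y) \<and>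
        f 3 1 (z, z1, y, y1) = \<eta> \<and> f 3 2 (z, z1, y, y1) = p (z, y) \<and>
        D1 g (z1, y1) * F (z, z1, y, y1) + D2 g (z1, y1) * G (z, z1, y, y1)
          = D1 A (z, y) * z1 + D2 A (z, y) * y1 - \<eta> * B (z, y) + p (z, y) * h (z1, y1) \<and>
        D1 h (z1, y1) * F (z, z1, y, y1) + D2 h (z1, y1) * G (z, z1, y, y1)
          = D1 B (z, y) * z1 + D2 B (z, y) * y1 - g (z1, y1) * p (z, y) + \<eta> * A (z, y) \<and>
        D1 p (z, y) * z1 + D2 p (z, y) * y1 = \<delta> * (g (z1, y1) * B (z, y) - A (z, y) * h (z1, y1)))"

lemma separatedD:
  assumes "separated \<delta> \<eta> F G f V g h A B p"
  shows "smooth_on (proj_z1y1 V) g" "smooth_on (proj_z1y1 V) h"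
    "smooth_on (proj_zy V) A" "smooth_on (proj_zy V) B" "smooth_on (proj_zy V) p"
    and "(z, z1, y, y1) \<in> V \<Longrightarrow> f 1 1 (z, z1, y, y1) = g (z1, y1)"
    and "(z, z1, y, y1) \<in> V \<Longrightarrow> f 1 2 (z, z1, y, y1) = A (z, y)"
    and "(z, z1, y, y1) \<in> V \<Longrightarrow> f 2 1 (z, z1, y, y1) = h (z1, y1)"
    and "(z, z1, y, y1) \<in> V \<Longrightarrow> f 2 2 (z, z1, y, y1) = B (z, y)"
    and "(z, z1, y, y1) \<in> V \<Longrightarrow> f 3 1 (z, z1, y, y1) = \<eta>"
    and "(z, z1, y, y1) \<in> V \<Longrightarrow> f 3 2 (z, z1, y, y1) = p (z, y)"
    and "(z, z1, y, y1) \<in> V \<Longrightarrow> D1 g (z1, y1) * F (z, z1, y, y1) + D2 g (z1, y1) * G (z, z1, y, y1)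
          = D1 A (z, y) * z1 + D2 A (z, y) * y1 - \<eta> * B (z, y) + p (z, y) * h (z1, y1)"
    and "(z, z1, y, y1) \<in> V \<Longrightarrow> D1 h (z1, y1) * F (z, z1, y, y1) + D2 h (z1, y1) * G (z, z1, y, y1)
          = D1 B (z, y) * z1 + D2 B (z, y) * y1 - g (z1, y1) * p (z, y) + \<eta> * A (z, y)"
    and "(z, z1, y, y1) \<in> V \<Longrightarrow>
          D1 p (z, y) * z1 + D2 p (z, y) * y1 = \<delta> * (g (z1, y1) * B (z, y) - A (z, y) * h (z1, y1))"
  using assms unfolding separated_def by blast+

lemma dd_comp_jet_of_lift_m:
  assumes "open V" "open \<Omega>" "q \<in> \<Omega>" "smooth_on \<Omega> u" "smooth_on \<Omega> v" "jet_of u v ` \<Omega> \<subseteq> V"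
    "\<And>q. q \<in> V \<Longrightarrow> k q = lift_m g q" "smooth_on (proj_z1y1 V) g"
  shows "dd e (k \<circ> jet_of u v) q = D1 g (D1 u q, D1 v q) * dd e (D1 u) q + D2 g (D1 u q, D1 v q) * dd e (D1 v) q"
proof -
  let ?j = "jet_of u v q"
  have j: "?j \<in> V" "?j = (u q, D1 u q, v q, D1 v q)" using assms(3,6) by (auto simp: jet_of_def)
  have gd: "g differentiable (at (D1 u q, D1 v q))"
    using smooth_on_imp_differentiable[OF assms(8)] in_projections(1) j by metis
  have ddk: "dd e k ?j = dd e (lift_m g) ?j" "k differentiable (at ?j)" for e
    using dd_cong_open[OF assms(1) j(1) assms(7)] dd_lift_m(2)[OF gd] unfolding j(2) by auto
  show ?thesis
    by (simp only: dd_comp_jet_of[OF assms(2-5) ddk(2)] ddk(1)) (simp add: j(2) dd_lift_m(1)[OF gd])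
qed

lemma dd_comp_jet_of_lift_w:
  assumes "open V" "open \<Omega>" "q \<in> \<Omega>" "smooth_on \<Omega> u" "smooth_on \<Omega> v" "jet_of u v ` \<Omega> \<subseteq> V"
    "\<And>q. q \<in> V \<Longrightarrow> k q = lift_w p q" "smooth_on (proj_zy V) p"
  shows "dd e (k \<circ> jet_of u v) q = D1 p (u q, v q) * dd e u q + D2 p (u q, v q) * dd e v q"
proof -
  let ?j = "jet_of u v q"
  have j: "?j \<in> V" "?j = (u q, D1 u q, v q, D1 v q)" using assms(3,6) by (auto simp: jet_of_def)
  have pd: "p differentiable (at (u q, v q))"
    using smooth_on_imp_differentiable[OF assms(8)] in_projections(2) j by metis
  have ddk: "dd e k ?j = dd e (lift_w p) ?j" "k differentiable (at ?j)" for e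
    using dd_cong_open[OF assms(1) j(1) assms(7)] dd_lift_w(2)[OF pd] unfolding j(2) by auto
  show ?thesis
    by (simp only: dd_comp_jet_of[OF assms(2-5) ddk(2)] ddk(1)) (simp add: j(2) dd_lift_w(1)[OF pd])
qed

text \<open>The third structure equation holds automatically, and the first two say that the defect
\<open>(u_xt - F, v_xt - G)\<close> lies in the kernel of the Jacobian matrix of \<open>(g, h)\<close>.\<close>

lemma structure_equations_separated:
  assumes V: "open V" and sep: "separated \<delta> \<eta> F G f V g h A B p"
    and \<Omega>: "open \<Omega>" "smooth_on \<Omega> u" "smooth_on \<Omega> v" "jet_of u v ` \<Omega> \<subseteq> V"
  shows "structure_equations \<delta> \<Omega> (assoc_form f u v) \<longleftrightarrow>
    (\<forall>q\<in>\<Omega>. D1 g (D1 u q, D1 v q) * (D2 (D1 u) q - F (jet_of u v q))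
           + D2 g (D1 u q, D1 v q) * (D2 (D1 v) q - G (jet_of u v q)) = 0 \<and>
          D1 h (D1 u q, D1 v q) * (D2 (D1 u) q - F (jet_of u v q))
           + D2 h (D1 u q, D1 v q) * (D2 (D1 v) q - G (jet_of u v q)) = 0)"
  unfolding structure_equations_def
proof (rule ball_cong[OF refl])
  fix q assume q: "q \<in> \<Omega>"
  let ?j = "jet_of u v q"
  have j: "?j = (u q, D1 u q, v q, D1 v q)" by (simp add: jet_of_def)
  have jV: "(u q, D1 u q, v q, D1 v q) \<in> V" using \<Omega>(4) q j by auto
  note S = separatedD[OF sep]
  have Fm: "f 1 1 q = lift_m g q" "f 2 1 q = lift_m h q" "f 3 1 q = lift_m (\<lambda>_. \<eta>) q"
    and Fw: "f 1 2 q = lift_w A q" "f 2 2 q = lift_w B q" "f 3 2 q = lift_w p q" if "q \<in> V" for q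
    using that S(6-11) by (cases q; simp)+
  note dm = dd_comp_jet_of_lift_m[OF V \<Omega>(1) q \<Omega>(2-4)]
  note dw = dd_comp_jet_of_lift_w[OF V \<Omega>(1) q \<Omega>(2-4)]
  have d31: "dd e (f 3 1 \<circ> jet_of u v) q = 0" for e
    using dm[OF Fm(3) smooth_on_const, of e] by (simp add: dd_const)
  note E = S(12)[OF jV] S(13)[OF jV] S(14)[OF jV]
  let ?m = "(D1 u q, D1 v q)" and ?w = "(u q, v q)"
  have d: "ext_d (assoc_form f u v i) q = D1 (f i 2 \<circ> jet_of u v) q - D2 (f i 1 \<circ> jet_of u v) q" for i
    by (simp only: ext_d_def assoc_form_def fst_conv snd_conv)
  have w: "wedge (assoc_form f u v i) (assoc_form f u v k) q = f i 1 ?j * f k 2 ?j - f i 2 ?j * f k 1 ?j" for i k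
    by (simp only: wedge_def assoc_form_def fst_conv snd_conv comp_apply)
  have d1: "ext_d (assoc_form f u v 1) q = D1 A ?w * D1 u q + D2 A ?w * D1 v q
      - (D1 g ?m * D2 (D1 u) q + D2 g ?m * D2 (D1 v) q)"
    unfolding d by (rule arg_cong2[where f=minus, OF dw[OF Fw(1) S(3)] dm[OF Fm(1) S(1)]])
  have d2: "ext_d (assoc_form f u v 2) q = D1 B ?w * D1 u q + D2 B ?w * D1 v q
      - (D1 h ?m * D2 (D1 u) q + D2 h ?m * D2 (D1 v) q)"
    unfolding d by (rule arg_cong2[where f=minus, OF dw[OF Fw(2) S(4)] dm[OF Fm(2) S(2)]])
  have d3: "ext_d (assoc_form f u v 3) q = D1 p ?w * D1 u q + D2 p ?w * D1 v q - 0"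
    unfolding d by (rule arg_cong2[where f=minus, OF dw[OF Fw(3) S(5)] d31])
  show "ext_d (assoc_form f u v 1) q = wedge (assoc_form f u v 3) (assoc_form f u v 2) q \<and>
        ext_d (assoc_form f u v 2) q = wedge (assoc_form f u v 1) (assoc_form f u v 3) q \<and>
        ext_d (assoc_form f u v 3) q = \<delta> * wedge (assoc_form f u v 1) (assoc_form f u v 2) q \<longleftrightarrow>
      D1 g ?m * (D2 (D1 u) q - F ?j) + D2 g ?m * (D2 (D1 v) q - G ?j) = 0 \<and>
      D1 h ?m * (D2 (D1 u) q - F ?j) + D2 h ?m * (D2 (D1 v) q - G ?j) = 0"
    unfolding d1 d2 d3 w j S(6)[OF jV] S(7)[OF jV] S(8)[OF jV] S(9)[OF jV] S(10)[OF jV] S(11)[OF jV]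
    using E by (auto simp: algebra_simps)
qed

lemma linear_system_trivial:
  fixes a b c d x y :: real
  assumes "a * x + b * y = 0" "c * x + d * y = 0" "a * d - b * c \<noteq> 0"
  shows "x = 0" "y = 0"
proof -
  have "(a * d - b * c) * x = d * (a * x + b * y) - b * (c * x + d * y)"
    "(a * d - b * c) * y = a * (c * x + d * y) - c * (a * x + b * y)" by algebra+
  then show "x = 0" "y = 0" using assms by auto
qed

text \<open>At almost every zero of \<open>\<Delta> = g B - A h\<close> the derivatives of \<open>\<Delta>\<close> in \<open>z1\<close> and
\<open>y1\<close> vanish too, which forces \<open>A = B = 0\<close> since the Jacobian is invertible; and almost everywhere on the
zero set of \<open>A\<close> and \<open>B\<close> their first, then their second derivatives vanish. The third equation gives
\<open>p_z = p_y = 0\<close> at such points. Differentiating the equations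
for \<open>F\<close> and \<open>G\<close> in \<open>z\<close> and \<open>y\<close> then shows that the derivatives of \<open>F\<close> and
\<open>G\<close> in these directions are zero, so such points lie in the null set
that is excluded by nondegeneracy.\<close>

lemma separated_generic_rank:
  assumes V: "open V" and sep: "separated \<delta> \<eta> F G f V g h A B p"
    and J: "\<And>z1 y1. (z1, y1) \<in> proj_z1y1 V \<Longrightarrow> jac g h (z1, y1) \<noteq> 0"
    and FG: "smooth_on V F" "smooth_on V G" and nd: "nondegenerate_on V F G"
  shows "negligible {q\<in>V. f 1 1 q * f 2 2 q - f 1 2 q * f 2 1 q = 0}"
proof -
  note S = separatedD[OF sep]
  define \<Delta> where "\<Delta> q = lift_m g q * lift_w B q - lift_w A q * lift_m h q" for q
  note sw = smooth_on_lift_w[OF V] and sm = smooth_on_lift_m[OF V]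
  \<comment> \<open>At almost all points each function of this list is nonzero or has zero differential.\<close>
  define ks where "ks = {\<Delta>, lift_w A, lift_w B, lift_w (D1 A), lift_w (D2 A), lift_w (D1 B), lift_w (D2 B)}"
  have "smooth_on V \<Delta>"
    unfolding \<Delta>_def[abs_def] by (intro smooth_on_diff smooth_on_mult V sw sm S)
  then have ks: "smooth_on V k" if "k \<in> ks" for k
    using that S(3,4) unfolding ks_def by (auto intro!: sw)
  define N where "N = (\<Union>(k, e)\<in>ks \<times> Basis. {q \<in> V. k q = 0 \<and> dd e k q \<noteq> 0})"
  have "negligible N"
    unfolding N_def
  proof (rule negligible_Union)
    show "finite ((\<lambda>(k, e). {q \<in> V. k q = 0 \<and> dd e k q \<noteq> 0}) ` (ks \<times> Basis))"
      by (simp add: ks_def)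
    fix t assume "t \<in> (\<lambda>(k, e). {q \<in> V. k q = 0 \<and> dd e k q \<noteq> 0}) ` (ks \<times> Basis)"
    then obtain k e where ke: "k \<in> ks" "e \<in> Basis" and t: "t = {q \<in> V. k q = 0 \<and> dd e k q \<noteq> 0}" by auto
    show "negligible t"
      unfolding t by (rule negligible_zero_set[OF V smooth_onD[OF ks[OF ke(1)]] ke(2)])
  qed
  moreover have "{q\<in>V. f 1 1 q * f 2 2 q - f 1 2 q * f 2 1 q = 0} \<subseteq> N \<union>
     {q\<in>V. (dd Ez F q)\<^sup>2 + (dd Ey F q)\<^sup>2 + (dd Ez G q)\<^sup>2 + (dd Ey G q)\<^sup>2 = 0}"
  proof (rule subsetI, rule ccontr)
    fix q assume q0: "q \<in> {q\<in>V. f 1 1 q * f 2 2 q - f 1 2 q * f 2 1 q = 0}"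
      and qN: "q \<notin> N \<union> {q\<in>V. (dd Ez F q)\<^sup>2 + (dd Ey F q)\<^sup>2 + (dd Ez G q)\<^sup>2 + (dd Ey G q)\<^sup>2 = 0}"
    obtain z z1 y y1 where q: "q = (z, z1, y, y1)" by (cases q)
    have qV: "q \<in> V" "(z, z1, y, y1) \<in> V" using q0 q by auto
    have \<Delta>0: "\<Delta> q = 0" using q0 S(6-9)[OF qV(2)] q by (simp add: \<Delta>_def)
    have flat: "dd e k q = 0" if "k \<in> ks" "k q = 0" "e \<in> Basis" for k e
    proof (rule ccontr)
      assume "dd e k q \<noteq> 0"
      then have "q \<in> N" unfolding N_def by (intro UN_I[of "(k, e)"]) (use that qV in auto)
      then show False using qN by blast
    qed
    have E: "Ez \<in> Basis" "Ez1 \<in> Basis" "Ey \<in> Basis" "Ey1 \<in> Basis" by (simp_all add: Basis_jet)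
    have dm: "k differentiable (at (z1, y1))" if "smooth_on (proj_z1y1 V) k" for k
      using smooth_on_imp_differentiable[OF that in_projections(1)[OF qV(2)]] .
    have dw: "k differentiable (at (z, y))" if "smooth_on (proj_zy V) k" for k
      using smooth_on_imp_differentiable[OF that in_projections(2)[OF qV(2)]] .
    note Lm = dd_lift_m[OF dm] and Lw = dd_lift_w[OF dw]
    have d\<Delta>: "dd e \<Delta> q = lift_m g q * dd e (lift_w B) q + dd e (lift_m g) q * lift_w B q
        - (lift_w A q * dd e (lift_m h) q + dd e (lift_w A) q * lift_m h q)" for e
      unfolding \<Delta>_def[abs_def] q
      by (simp add: dd_diff dd_mult Lm(2) Lw(2) S(1-5) differentiable_mult)
    have A0B0: "A (z, y) = 0" "B (z, y) = 0"
    proof -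
      have e1: "D1 g (z1, y1) * B (z, y) + - D1 h (z1, y1) * A (z, y) = 0"
        using flat[of \<Delta> Ez1] \<Delta>0 d\<Delta>[of Ez1] E Lm(1)[OF S(1), of Ez1 z y] Lm(1)[OF S(2), of Ez1 z y]
          Lw(1)[OF S(3), of Ez1 z1 y1] Lw(1)[OF S(4), of Ez1 z1 y1] by (simp add: ks_def q)
      have e2: "D2 g (z1, y1) * B (z, y) + - D2 h (z1, y1) * A (z, y) = 0"
        using flat[of \<Delta> Ey1] \<Delta>0 d\<Delta>[of Ey1] E Lm(1)[OF S(1), of Ey1 z y] Lm(1)[OF S(2), of Ey1 z y]
          Lw(1)[OF S(3), of Ey1 z1 y1] Lw(1)[OF S(4), of Ey1 z1 y1] by (simp add: ks_def q)
      have det: "D1 g (z1, y1) * - D2 h (z1, y1) - - D1 h (z1, y1) * D2 g (z1, y1) \<noteq> 0"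
        using J[OF in_projections(1)[OF qV(2)]] by (simp add: jac_def mult.commute)
      show "A (z, y) = 0" by (rule linear_system_trivial(2)[OF e1 e2 det])
      show "B (z, y) = 0" by (rule linear_system_trivial(1)[OF e1 e2 det])
    qed
    have wflat: "D1 k (z, y) = 0" "D2 k (z, y) = 0"
      if "lift_w k \<in> ks" "k (z, y) = 0" "smooth_on (proj_zy V) k" for k
      using flat[of "lift_w k" Ez] flat[of "lift_w k" Ey] E that
        Lw(1)[OF that(3), of Ez z1 y1] Lw(1)[OF that(3), of Ey z1 y1] by (simp_all add: q)
    have d1: "D1 A (z, y) = 0" "D2 A (z, y) = 0" "D1 B (z, y) = 0" "D2 B (z, y) = 0"
      using wflat[of A] wflat[of B] A0B0 S(3,4) by (simp_all add: ks_def)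
    have d2: "dd e (lift_w (D1 A)) q = 0" "dd e (lift_w (D2 A)) q = 0"
      "dd e (lift_w (D1 B)) q = 0" "dd e (lift_w (D2 B)) q = 0" if "e \<in> Basis" for e
      using flat[of _ e] that d1 by (simp_all add: ks_def q)
    have dAB: "dd e (lift_w A) q = 0" "dd e (lift_w B) q = 0" if "e \<in> Basis" for e
      using flat[of _ e] that A0B0 by (simp_all add: ks_def q)
    have coord: "smooth_on (proj_z1y1 V) fst" "smooth_on (proj_z1y1 V) snd"
      by (auto intro!: smooth_on_linear linearI)
    have dcoord: "D1 fst (z1, y1) = 1" "D2 fst (z1, y1) = 0" "D1 snd (z1, y1) = 0" "D2 snd (z1, y1) = 1"
      by (auto intro!: dd_has_derivative[THEN trans] derivative_eq_intros)
    have sD: "smooth_on (proj_zy V) (D1 p)" "smooth_on (proj_zy V) (D2 p)"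
      "smooth_on (proj_zy V) (D1 A)" "smooth_on (proj_zy V) (D2 A)"
      "smooth_on (proj_zy V) (D1 B)" "smooth_on (proj_zy V) (D2 B)"
      "smooth_on (proj_z1y1 V) (D1 g)" "smooth_on (proj_z1y1 V) (D2 g)"
      "smooth_on (proj_z1y1 V) (D1 h)" "smooth_on (proj_z1y1 V) (D2 h)"
      using S(1-5) by auto
    note diffs = Lm(2)[OF S(1)] Lm(2)[OF S(2)] Lw(2)[OF S(3)] Lw(2)[OF S(4)] Lw(2)[OF S(5)]
      Lw(2)[OF sD(1)] Lw(2)[OF sD(2)] Lw(2)[OF sD(3)] Lw(2)[OF sD(4)] Lw(2)[OF sD(5)] Lw(2)[OF sD(6)]
      Lm(2)[OF sD(7)] Lm(2)[OF sD(8)] Lm(2)[OF sD(9)] Lm(2)[OF sD(10)] Lm(2)[OF coord(1)] Lm(2)[OF coord(2)]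
      smooth_on_imp_differentiable[OF FG(1) qV(2)] smooth_on_imp_differentiable[OF FG(2) qV(2)]
    note dd_rules = dd_add dd_diff dd_mult dd_const diffs differentiable_mult differentiable_add differentiable_diff differentiable_const
    have p1: "D1 p (z, y) = 0" "D2 p (z, y) = 0"
    proof -
      have "dd e (\<lambda>q. lift_w (D1 p) q * lift_m fst q + lift_w (D2 p) q * lift_m snd q) q = dd e (\<lambda>q. \<delta> * \<Delta> q) q" for e
        by (rule dd_cong_open(1)[OF V qV(1)]) (use S(14) in \<open>auto simp: \<Delta>_def\<close>)
      moreover have "dd e (\<lambda>q. \<delta> * \<Delta> q) q = 0" if "e \<in> Basis" for e
        using flat[of \<Delta> e] \<Delta>0 that dd_cmult[of \<Delta> q e \<delta>] smooth_on_imp_differentiable[OF \<open>smooth_on V \<Delta>\<close> qV(1)]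
        by (simp add: ks_def)
      ultimately have "dd e (\<lambda>q. lift_w (D1 p) q * lift_m fst q + lift_w (D2 p) q * lift_m snd q) (z, z1, y, y1) = 0"
        if "e \<in> Basis" for e
        using that q by simp
      from this[OF E(2)] this[OF E(4)] show "D1 p (z, y) = 0" "D2 p (z, y) = 0"
        by (simp_all add: dd_rules Lm(1)[OF coord(1)] Lm(1)[OF coord(2)] Lw(1)[OF sD(1)] Lw(1)[OF sD(2)] dcoord)
    qed
    have FG0: "dd e F q = 0 \<and> dd e G q = 0" if e: "e = Ez \<or> e = Ey" for e
    proof -
      have eB: "e \<in> Basis" using e by (auto simp: Basis_jet)
      have m0: "dd e (lift_m k) (z, z1, y, y1) = 0" if "smooth_on (proj_z1y1 V) k" for k
        using Lm(1)[OF that, of e z y] e by auto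
      have w0: "dd e (lift_w p) (z, z1, y, y1) = 0"
        using Lw(1)[OF S(5), of e z1 y1] p1 by simp
      have z0: "dd e (lift_w (D1 A)) (z, z1, y, y1) = 0" "dd e (lift_w (D2 A)) (z, z1, y, y1) = 0"
        "dd e (lift_w (D1 B)) (z, z1, y, y1) = 0" "dd e (lift_w (D2 B)) (z, z1, y, y1) = 0"
        "dd e (lift_w A) (z, z1, y, y1) = 0" "dd e (lift_w B) (z, z1, y, y1) = 0"
        using d2[OF eB] dAB[OF eB] q by simp_all
      note zeros = m0[OF S(1)] m0[OF S(2)] m0[OF sD(7)] m0[OF sD(8)] m0[OF sD(9)] m0[OF sD(10)]
        m0[OF coord(1)] m0[OF coord(2)] w0 z0
      have "dd e (\<lambda>q. lift_m (D1 g) q * F q + lift_m (D2 g) q * G q) q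
          = dd e (\<lambda>q. lift_w (D1 A) q * lift_m fst q + lift_w (D2 A) q * lift_m snd q - \<eta> * lift_w B q + lift_w p q * lift_m h q) q"
        by (rule dd_cong_open(1)[OF V qV(1)]) (use S(12) in auto)
      then have "D1 g (z1, y1) * dd e F q + D2 g (z1, y1) * dd e G q = 0"
        unfolding q by (simp add: dd_rules zeros)
      moreover have "dd e (\<lambda>q. lift_m (D1 h) q * F q + lift_m (D2 h) q * G q) q
          = dd e (\<lambda>q. lift_w (D1 B) q * lift_m fst q + lift_w (D2 B) q * lift_m snd q - lift_m g q * lift_w p q + \<eta> * lift_w A q) q"
        by (rule dd_cong_open(1)[OF V qV(1)]) (use S(13) in auto)
      then have "D1 h (z1, y1) * dd e F q + D2 h (z1, y1) * dd e G q = 0"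
        unfolding q by (simp add: dd_rules zeros)
      ultimately show ?thesis
        using linear_system_trivial J[OF in_projections(1)[OF qV(2)]] unfolding jac_def by blast
    qed
    show False using FG0[of Ez] FG0[of Ey] qN qV by simp
  qed
  ultimately show ?thesis
    using nd unfolding nondegenerate_on_def by (meson negligible_Un negligible_subset)
qed

lemma separated_describes_surfaces:
  assumes V: "open V" and sep: "separated \<delta> \<eta> F G f V g h A B p"
    and J: "\<And>z1 y1. (z1, y1) \<in> proj_z1y1 V \<Longrightarrow> jac g h (z1, y1) \<noteq> 0"
    and FG: "smooth_on V F" "smooth_on V G" and nd: "nondegenerate_on V F G"
  shows "describes_surfaces \<delta> F G f V" "\<forall>q\<in>V. f 3 1 q = \<eta>"
proof -
  note S = separatedD[OF sep]
  show "\<forall>q\<in>V. f 3 1 q = \<eta>" using S(10) by auto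
  note sw = smooth_on_lift_w[OF V] and sm = smooth_on_lift_m[OF V]
  have "smooth_on V (f 1 1)" "smooth_on V (f 2 1)" "smooth_on V (f 3 1)"
    "smooth_on V (f 1 2)" "smooth_on V (f 2 2)" "smooth_on V (f 3 2)"
    by (rule smooth_on_cong[OF V _ sm[OF S(1)]], use S(6) in auto)
      (rule smooth_on_cong[OF V _ sm[OF S(2)]], use S(8) in auto,
       rule smooth_on_cong[OF V _ smooth_on_const[of V \<eta>]], use S(10) in auto,
       rule smooth_on_cong[OF V _ sw[OF S(3)]], use S(7) in auto,
       rule smooth_on_cong[OF V _ sw[OF S(4)]], use S(9) in auto,
       rule smooth_on_cong[OF V _ sw[OF S(5)]], use S(11) in auto)
  moreover have "solves_system F G \<Omega> u v \<longleftrightarrow> structure_equations \<delta> \<Omega> (assoc_form f u v)"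
    if \<Omega>: "open \<Omega>" "smooth_on \<Omega> u" "smooth_on \<Omega> v" "jet_of u v ` \<Omega> \<subseteq> V" for \<Omega> u v
  proof -
    have jac: "D1 g m * D2 h m - D2 g m * D1 h m \<noteq> 0" if "q \<in> \<Omega>" "m = (D1 u q, D1 v q)" for q m
    proof -
      have "(u q, D1 u q, v q, D1 v q) \<in> V" using \<Omega>(4) that(1) by (auto simp: jet_of_def)
      from J[OF in_projections(1)[OF this]] show ?thesis by (simp add: jac_def that(2))
    qed
    show ?thesis
      unfolding structure_equations_separated[OF V sep \<Omega>] solves_system_def
    proof (rule ball_cong[OF refl])
      fix q assume q: "q \<in> \<Omega>"
      let ?m = "(D1 u q, D1 v q)" and ?a = "D2 (D1 u) q - F (jet_of u v q)" and ?b = "D2 (D1 v) q - G (jet_of u v q)"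
      have "?a = 0 \<and> ?b = 0" if "D1 g ?m * ?a + D2 g ?m * ?b = 0" "D1 h ?m * ?a + D2 h ?m * ?b = 0"
        using linear_system_trivial[OF that jac[OF q refl]] by blast
      then show "D2 (D1 u) q = F (jet_of u v q) \<and> D2 (D1 v) q = G (jet_of u v q) \<longleftrightarrow>
          D1 g ?m * ?a + D2 g ?m * ?b = 0 \<and> D1 h ?m * ?a + D2 h ?m * ?b = 0"
        by auto
    qed
  qed
  ultimately show "describes_surfaces \<delta> F G f V"
    using separated_generic_rank[OF assms] unfolding describes_surfaces_def by auto
qed

section \<open>Both families have the separated form\<close>

text \<open>Write \<open>p\<close> as its value on \<open>x = 0\<close> plus the primitive in \<open>x\<close> of \<open>D1 p\<close>, differentiate in
\<open>t\<close> under the integral sign, and then differentiate in \<open>x\<close>.\<close>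

lemma mixed_partials_commute:
  assumes S: "open S" "(z, y) \<in> S" and p: "smooth_on S p"
  shows "D1 (D2 p) (z, y) = D2 (D1 p) (z, y)"
proof -
  obtain X Y where XY0: "open X" "open Y" "(z, y) \<in> X \<times> Y" "X \<times> Y \<subseteq> S"
    by (rule open_prod_elim[OF S])
  then have XY: "open X" "open Y" "z \<in> X" "y \<in> Y" "X \<times> Y \<subseteq> S" by auto
  obtain r1 r2 where r12: "r1 > 0" "ball z r1 \<subseteq> X" "r2 > 0" "ball y r2 \<subseteq> Y"
    using XY(1-4) by (meson open_contains_ball)
  define r where "r = min r1 r2"
  define I where "I = {-r<..<r}"
  have r: "r > 0" using r12 by (simp add: r_def)
  have in_S: "(z + x, y + t) \<in> S" if "x \<in> I" "t \<in> I" for x t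
  proof -
    have "z + x \<in> ball z r1" "y + t \<in> ball y r2" using that by (auto simp: I_def r_def dist_real_def)
    then show ?thesis using r12 XY(5) by blast
  qed
  have zero: "0 \<in> I" using r by (simp add: I_def)
  define f where "f = (\<lambda>(x, t). D1 p (z + x, y + t))"
  define g where "g = (\<lambda>(x, t). D2 (D1 p) (z + x, y + t))"
  have smD: "smooth_on S (D1 p)" "smooth_on S (D2 p)" "smooth_on S (D2 (D1 p))" using p by auto
  have cont: "continuous_on (I \<times> I) (\<lambda>(x, t). k (z + x, y + t))" if "smooth_on S k" for k
    unfolding split_def
    by (rule continuous_on_compose2[OF Ck_on_imp_continuous[OF smooth_onD[OF that, of 0]]])
      (use in_S in \<open>auto intro!: continuous_intros\<close>)
  have cf: "continuous_on (I \<times> I) f" and cg: "continuous_on (I \<times> I) g"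
    unfolding f_def g_def by (rule cont[OF smD(1)], rule cont[OF smD(3)])
  have dx: "((\<lambda>x. k (z + x, y + t)) has_real_derivative D1 k (z + x, y + t)) (at x)"
    and dt: "((\<lambda>t. k (z + x, y + t)) has_real_derivative D2 k (z + x, y + t)) (at t)"
    if "smooth_on S k" "x \<in> I" "t \<in> I" for k x t
  proof -
    note D = Ck_on_partials[OF smooth_on_imp_differentiable[OF that(1) in_S[OF that(2,3)]]]
    show "((\<lambda>x. k (z + x, y + t)) has_real_derivative D1 k (z + x, y + t)) (at x)"
      using DERIV_shift[of "\<lambda>x. k (x, y + t)" "D1 k (z + x, y + t)" x z] D(1) by (simp add: add.commute)
    show "((\<lambda>t. k (z + x, y + t)) has_real_derivative D2 k (z + x, y + t)) (at t)"
      using DERIV_shift[of "\<lambda>t. k (z + x, t)" "D2 k (z + x, y + t)" t y] D(2) by (simp add: add.commute)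
  qed
  have star: "\<theta> * x \<in> I" if "\<theta> \<in> {0..1}" "x \<in> I" for \<theta> x
    using theta_in(1)[OF that(1)] that(2) by (simp add: I_def)
  have p_eq: "p (z + x, y + t) = p (z + 0, y + t) + x * mean_x f (x, t)" if "x \<in> I" "t \<in> I" for x t
  proof -
    have "(\<lambda>x. p (z + x, y + t)) x - (\<lambda>x. p (z + x, y + t)) 0
        = (x - 0) * integral {0..1} (\<lambda>\<theta>. (\<lambda>x. D1 p (z + x, y + t)) (0 + \<theta> * (x - 0)))"
      by (rule diff_eq_theta_integral) (use dx[OF p] star that in simp)
    then show ?thesis by (simp add: mean_x_def f_def)
  qed
  have D2_eq: "D2 p (z + x, y) = D2 p (z, y) + x * mean_x g (x, 0)" if x: "x \<in> I" for x
  proof -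
    have 1: "((\<lambda>t. p (z + x, y + t)) has_real_derivative D2 p (z + x, y + 0)) (at 0)"
      by (rule dt[OF p x zero])
    have "((\<lambda>t. mean_x f (x, t)) has_real_derivative mean_x g (x, 0)) (at 0)"
      using mean_x_has_t_derivative[of r f g x 0] cf cg dt[OF smD(1)] x zero
      by (simp add: I_def f_def g_def)
    then have "((\<lambda>t. p (z + 0, y + t) + x * mean_x f (x, t)) has_real_derivative D2 p (z + 0, y + 0) + x * mean_x g (x, 0)) (at 0)"
      by (intro DERIV_add dt[OF p zero zero] DERIV_cmult)
    then have "((\<lambda>t. p (z + x, y + t)) has_real_derivative D2 p (z + 0, y + 0) + x * mean_x g (x, 0)) (at 0)"
      by (rule has_field_derivative_transform_within_open[where S=I])
        (use p_eq x zero in \<open>auto simp: I_def\<close>)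
    from DERIV_unique[OF 1 this] show ?thesis by simp
  qed
  have 1: "((\<lambda>x. D2 p (z + x, y + 0)) has_real_derivative D1 (D2 p) (z + 0, y + 0)) (at 0)"
    by (rule dx[OF smD(2) zero zero])
  have "((\<lambda>x. x * mean_x g (x, 0)) has_real_derivative g (0, 0)) (at 0)"
    using primitive_has_derivative(1)[of r g 0 0] cg zero by (simp add: I_def)
  then have "((\<lambda>x. D2 p (z, y) + x * mean_x g (x, 0)) has_real_derivative 0 + g (0, 0)) (at 0)"
    by (intro DERIV_add DERIV_const)
  then have "((\<lambda>x. D2 p (z + x, y + 0)) has_real_derivative 0 + g (0, 0)) (at 0)"
    by (rule has_field_derivative_transform_within_open[where S=I])
      (use D2_eq zero in \<open>auto simp: I_def\<close>)
  from DERIV_unique[OF 1 this] show ?thesis by (simp add: g_def)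
qed

lemma dd_along_xi:
  assumes "\<phi> differentiable (at (a * y + b * z))"
  shows "((\<lambda>w. \<phi> (a * snd w + b * fst w)) has_derivative
      (\<lambda>v. deriv \<phi> (a * y + b * z) * (a * snd v + b * fst v))) (at (z, y))"
    and "D1 (\<lambda>w. \<phi> (a * snd w + b * fst w)) (z, y) = b * deriv \<phi> (a * y + b * z)"
    and "D2 (\<lambda>w. \<phi> (a * snd w + b * fst w)) (z, y) = a * deriv \<phi> (a * y + b * z)"
proof -
  have "(\<phi> has_real_derivative deriv \<phi> (a * y + b * z)) (at (a * y + b * z))"
    using assms by (simp add: DERIV_deriv_iff_real_differentiable)
  then have \<phi>: "(\<phi> has_derivative (\<lambda>h. deriv \<phi> (a * y + b * z) * h)) (at (a * snd (z, y) + b * fst (z, y)))"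
    by (simp add: has_field_derivative_def)
  have lin: "((\<lambda>w. a * snd w + b * fst w) has_derivative (\<lambda>v. a * snd v + b * fst v)) (at (z, y))"
    by (intro derivative_intros)
  show *: "((\<lambda>w. \<phi> (a * snd w + b * fst w)) has_derivative
      (\<lambda>v. deriv \<phi> (a * y + b * z) * (a * snd v + b * fst v))) (at (z, y))"
    using has_derivative_compose[OF lin \<phi>] .
  show "D1 (\<lambda>w. \<phi> (a * snd w + b * fst w)) (z, y) = b * deriv \<phi> (a * y + b * z)"
    "D2 (\<lambda>w. \<phi> (a * snd w + b * fst w)) (z, y) = a * deriv \<phi> (a * y + b * z)"
    using dd_has_derivative[OF *] by simp_all
qed

lemma smooth_on_deriv:
  assumes "open \<Xi>" "smooth_on \<Xi> \<phi>"
  shows "smooth_on \<Xi> (deriv \<phi>)"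
proof (rule smooth_on_cong[OF assms(1)])
  show "smooth_on \<Xi> (dd 1 \<phi>)" using assms(2) by (intro smooth_on_dd) auto
  show "dd 1 \<phi> x = deriv \<phi> x" if "x \<in> \<Xi>" for x
  proof -
    have "(\<phi> has_real_derivative deriv \<phi> x) (at x)"
      using smooth_on_imp_differentiable[OF assms(2) that] by (simp add: DERIV_deriv_iff_real_differentiable)
    then have "(\<phi> has_derivative (*) (deriv \<phi> x)) (at x)" by (simp add: has_field_derivative_def)
    from dd_has_derivative[OF this] show ?thesis by simp
  qed
qed

lemma smooth_on_along_xi:
  fixes S :: "(real \<times> real) set"
  assumes "open S" "smooth_on \<Xi> \<phi>" "\<And>z y. (z, y) \<in> S \<Longrightarrow> a * y + b * z \<in> \<Xi>"
  shows "smooth_on S (\<lambda>w. \<phi> (a * snd w + b * fst w))"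
proof (rule smooth_on_compose[where g="\<lambda>w. a * snd w + b * fst w" and T=\<Xi>])
  show "smooth_on S (\<lambda>x. (a * snd x + b * fst x) \<bullet> e)" if "e \<in> Basis" for e :: real
    using that by (auto intro!: smooth_on_linear linearI simp: algebra_simps)
qed (use assms in auto)

text \<open>Cramer's rule for the two equations of the separated form, with \<open>A = lam \<phi>'\<close> and \<open>B = \<mu> \<phi>'\<close>; the
arguments \<open>\<phi>0, \<phi>1, \<phi>2\<close> stand for the values of \<open>\<phi>\<close> and its first two derivatives.\<close>

lemma case_i_algebra:
  fixes gz gy hz hy lam \<mu> a b \<delta> \<eta> z1 y1 \<phi>0 \<phi>1 \<phi>2 g h W :: real
  assumes "W = gz * hy - gy * hz" "W \<noteq> 0" "\<mu> * gz - lam * hz = \<delta> * b" "\<mu> * gy - lam * hy = \<delta> * a"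
  defines "N1 \<equiv> - \<delta> * a * (b * z1 + a * y1) * \<phi>2 - \<eta> * (\<mu> * hy + lam * gy) * \<phi>1
      + 1 / 2 * (2 * (g * gy + h * hy)) * \<phi>0"
    and "N2 \<equiv> \<delta> * b * (b * z1 + a * y1) * \<phi>2 + \<eta> * (\<mu> * hz + lam * gz) * \<phi>1
      - 1 / 2 * (2 * (g * gz + h * hz)) * \<phi>0"
  shows "gz * (1 / W * N1) + gy * (1 / W * N2)
      = lam * (b * \<phi>2) * z1 + lam * (a * \<phi>2) * y1 - \<eta> * (\<mu> * \<phi>1) + \<phi>0 * h"
    and "hz * (1 / W * N1) + hy * (1 / W * N2)
      = \<mu> * (b * \<phi>2) * z1 + \<mu> * (a * \<phi>2) * y1 - g * \<phi>0 + \<eta> * (lam * \<phi>1)"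
proof -
  have d: "- \<delta> * a = - (\<mu> * gy - lam * hy)" "\<delta> * b = \<mu> * gz - lam * hz" using assms(3,4) by auto
  have "gz * N1 + gy * N2 = W * (lam * (b * \<phi>2) * z1 + lam * (a * \<phi>2) * y1 - \<eta> * (\<mu> * \<phi>1) + \<phi>0 * h)"
    "hz * N1 + hy * N2 = W * (\<mu> * (b * \<phi>2) * z1 + \<mu> * (a * \<phi>2) * y1 - g * \<phi>0 + \<eta> * (lam * \<phi>1))"
    unfolding N1_def N2_def d assms(1) by (simp_all add: algebra_simps)
  moreover have "gz * (1 / W * N1) + gy * (1 / W * N2) = (gz * N1 + gy * N2) / W"
    "hz * (1 / W * N1) + hy * (1 / W * N2) = (hz * N1 + hy * N2) / W"
    by (simp_all add: add_divide_distrib)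
  ultimately show "gz * (1 / W * N1) + gy * (1 / W * N2)
      = lam * (b * \<phi>2) * z1 + lam * (a * \<phi>2) * y1 - \<eta> * (\<mu> * \<phi>1) + \<phi>0 * h"
    and "hz * (1 / W * N1) + hy * (1 / W * N2)
      = \<mu> * (b * \<phi>2) * z1 + \<mu> * (a * \<phi>2) * y1 - g * \<phi>0 + \<eta> * (lam * \<phi>1)"
    using assms(2) by simp_all
qed

text \<open>Cramer's rule for the two equations of the separated form, with linear forms \<open>g = a1 z1 + b1 y1\<close> and
\<open>h = a2 z1 + b2 y1\<close>; \<open>P\<close>, \<open>p1\<close>, \<open>p2\<close>, \<open>p11\<close>, \<open>p12\<close>, \<open>p22\<close>
stand for the values of \<open>p\<close> and its partial derivatives.\<close>

lemma case_ii_algebra: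
  fixes a1 b1 a2 b2 \<gamma> \<alpha> \<beta> \<tau> \<delta> \<eta> P p1 p2 p11 p12 p22 z1 y1 :: real
  assumes \<gamma>: "\<gamma> = a1 * b2 - a2 * b1" "\<gamma> \<noteq> 0"
    and q: "\<alpha> = a1\<^sup>2 + a2\<^sup>2" "\<beta> = b1\<^sup>2 + b2\<^sup>2" "\<tau> = a1 * b1 + a2 * b2"
  defines "Fh \<equiv> - (z1 / \<gamma>) * (\<delta> * p12 - \<tau> * P) + y1 / \<gamma> * (- \<delta> * p22 + \<beta> * P)
            + \<delta> * \<eta> / \<gamma>\<^sup>2 * (- \<beta> * p1 + \<tau> * p2)"
    and "Gh \<equiv> z1 / \<gamma> * (\<delta> * p11 - \<alpha> * P) + y1 / \<gamma> * (\<delta> * p12 - \<tau> * P)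
            + \<delta> * \<eta> / \<gamma>\<^sup>2 * (\<tau> * p1 - \<alpha> * p2)"
  shows "a1 * Fh + b1 * Gh = \<delta> / \<gamma> * (b1 * p11 - a1 * p12) * z1 + \<delta> / \<gamma> * (b1 * p12 - a1 * p22) * y1
      - \<eta> * (\<delta> / \<gamma> * (b2 * p1 - a2 * p2)) + P * (a2 * z1 + b2 * y1)"
    and "a2 * Fh + b2 * Gh = \<delta> / \<gamma> * (b2 * p11 - a2 * p12) * z1 + \<delta> / \<gamma> * (b2 * p12 - a2 * p22) * y1
      - (a1 * z1 + b1 * y1) * P + \<eta> * (\<delta> / \<gamma> * (b1 * p1 - a1 * p2))"
proof -
  \<comment> \<open>With \<open>i = 1 / \<gamma>\<close> both identities are polynomial, up to cancelling \<open>i * \<gamma> = 1\<close>.\<close>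
  define i where "i = 1 / \<gamma>"
  have i: "i * \<gamma> = 1" using \<gamma>(2) by (simp add: i_def)
  have F: "Fh = i * (- z1 * (\<delta> * p12 - \<tau> * P) + y1 * (- \<delta> * p22 + \<beta> * P) + i * (\<delta> * \<eta> * (- \<beta> * p1 + \<tau> * p2)))"
    and G: "Gh = i * (z1 * (\<delta> * p11 - \<alpha> * P) + y1 * (\<delta> * p12 - \<tau> * P) + i * (\<delta> * \<eta> * (\<tau> * p1 - \<alpha> * p2)))"
    by (simp_all add: Fh_def Gh_def i_def power2_eq_square algebra_simps add_divide_distrib diff_divide_distrib)
  have k: "a1 * \<tau> - b1 * \<alpha> = a2 * \<gamma>" "a1 * \<beta> - b1 * \<tau> = b2 * \<gamma>"
    "a2 * \<tau> - b2 * \<alpha> = - a1 * \<gamma>" "a2 * \<beta> - b2 * \<tau> = - b1 * \<gamma>"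
    unfolding \<gamma>(1) q by (simp_all add: algebra_simps power2_eq_square)
  have "a1 * Fh + b1 * Gh = i * (\<delta> * (b1 * p11 - a1 * p12) * z1 + \<delta> * (b1 * p12 - a1 * p22) * y1
      + P * ((a1 * \<tau> - b1 * \<alpha>) * z1 + (a1 * \<beta> - b1 * \<tau>) * y1)
      + i * \<delta> * \<eta> * (- (a1 * \<beta> - b1 * \<tau>) * p1 + (a1 * \<tau> - b1 * \<alpha>) * p2))"
    unfolding F G by (simp add: algebra_simps)
  also have "\<dots> = i * (\<delta> * (b1 * p11 - a1 * p12) * z1 + \<delta> * (b1 * p12 - a1 * p22) * y1)
      + (i * \<gamma>) * (P * (a2 * z1 + b2 * y1)) + (i * \<gamma>) * (i * \<delta> * \<eta> * (- b2 * p1 + a2 * p2))"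
    unfolding k by (simp add: algebra_simps)
  finally show "a1 * Fh + b1 * Gh = \<delta> / \<gamma> * (b1 * p11 - a1 * p12) * z1 + \<delta> / \<gamma> * (b1 * p12 - a1 * p22) * y1
      - \<eta> * (\<delta> / \<gamma> * (b2 * p1 - a2 * p2)) + P * (a2 * z1 + b2 * y1)"
    unfolding i by (simp add: i_def algebra_simps add_divide_distrib diff_divide_distrib)
  have "a2 * Fh + b2 * Gh = i * (\<delta> * (b2 * p11 - a2 * p12) * z1 + \<delta> * (b2 * p12 - a2 * p22) * y1
      + P * ((a2 * \<tau> - b2 * \<alpha>) * z1 + (a2 * \<beta> - b2 * \<tau>) * y1)
      + i * \<delta> * \<eta> * (- (a2 * \<beta> - b2 * \<tau>) * p1 + (a2 * \<tau> - b2 * \<alpha>) * p2))"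
    unfolding F G by (simp add: algebra_simps)
  also have "\<dots> = i * (\<delta> * (b2 * p11 - a2 * p12) * z1 + \<delta> * (b2 * p12 - a2 * p22) * y1)
      - (i * \<gamma>) * (P * (a1 * z1 + b1 * y1)) + (i * \<gamma>) * (i * \<delta> * \<eta> * (b1 * p1 - a1 * p2))"
    unfolding k by (simp add: algebra_simps)
  finally show "a2 * Fh + b2 * Gh = \<delta> / \<gamma> * (b2 * p11 - a2 * p12) * z1 + \<delta> / \<gamma> * (b2 * p12 - a2 * p22) * y1
      - (a1 * z1 + b1 * y1) * P + \<eta> * (\<delta> / \<gamma> * (b1 * p1 - a1 * p2))"
    unfolding i by (simp add: i_def algebra_simps add_divide_distrib diff_divide_distrib)
qed

lemma dd_sum_of_squares:
  fixes g h :: "real \<times> real \<Rightarrow> real"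
  assumes "g differentiable (at w)" "h differentiable (at w)"
  shows "dd e (\<lambda>w. (g w)\<^sup>2 + (h w)\<^sup>2) w = 2 * (g w * dd e g w + h w * dd e h w)"
  by (simp add: power2_eq_square dd_add dd_mult differentiable_mult assms)

lemma dd_linear_relation:
  fixes g h :: "real \<times> real \<Rightarrow> real"
  assumes "open M" "w \<in> M" "g differentiable (at w)" "h differentiable (at w)"
    and rel: "\<And>z1 y1. (z1, y1) \<in> M \<Longrightarrow> \<mu> * g (z1, y1) - lam * h (z1, y1) = \<delta> * a * y1 + \<delta> * b * z1"
  shows "\<mu> * D1 g w - lam * D1 h w = \<delta> * b" "\<mu> * D2 g w - lam * D2 h w = \<delta> * a"
proof -
  have lin: "((\<lambda>w. \<delta> * a * snd w + \<delta> * b * fst w) has_derivative (\<lambda>v. \<delta> * a * snd v + \<delta> * b * fst v)) (at w)"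
    by (intro derivative_intros)
  have "dd e (\<lambda>w. \<mu> * g w - lam * h w) w = dd e (\<lambda>w. \<delta> * a * snd w + \<delta> * b * fst w) w" for e
    by (rule dd_cong_open(1)[OF assms(1,2)]) (use rel in auto)
  then have "\<mu> * dd e g w - lam * dd e h w = \<delta> * a * snd e + \<delta> * b * fst e" for e
    using dd_has_derivative[OF lin, of e] assms(3,4) by (simp add: dd_diff dd_cmult differentiable_mult)
  from this[of "(1, 0)"] this[of "(0, 1)"]
  show "\<mu> * D1 g w - lam * D1 h w = \<delta> * b" "\<mu> * D2 g w - lam * D2 h w = \<delta> * a" by simp_all
qed

lemma open_xi_range:
  assumes "open V" "a\<^sup>2 + b\<^sup>2 \<noteq> 0"
  shows "open (xi_range a b V)"
proof -
  have *: "xi_range a b V = (\<lambda>q. a * fst (snd (snd q)) + b * fst q) ` V"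
    by (auto simp: xi_range_def split_def)
  show ?thesis unfolding *
  proof (rule open_surjective_linear_image[OF assms(1)])
    show "linear (\<lambda>q :: jet. a * fst (snd (snd q)) + b * fst q)" by (rule linearI) (auto simp: algebra_simps)
    show "surj (\<lambda>q :: jet. a * fst (snd (snd q)) + b * fst q)"
    proof (rule surjI[of _ "\<lambda>s. (b * s / (a\<^sup>2 + b\<^sup>2), 0, a * s / (a\<^sup>2 + b\<^sup>2), 0)"])
      fix s :: real
      have "a * (a * s / (a\<^sup>2 + b\<^sup>2)) + b * (b * s / (a\<^sup>2 + b\<^sup>2)) = (a\<^sup>2 + b\<^sup>2) * s / (a\<^sup>2 + b\<^sup>2)"
        by (simp add: add_divide_distrib power2_eq_square algebra_simps)
      also have "\<dots> = s" using assms(2) by (rule nonzero_mult_div_cancel_left)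
      finally show "a * fst (snd (snd (b * s / (a\<^sup>2 + b\<^sup>2), 0::real, a * s / (a\<^sup>2 + b\<^sup>2), 0::real)))
          + b * fst (b * s / (a\<^sup>2 + b\<^sup>2), 0::real, a * s / (a\<^sup>2 + b\<^sup>2), 0::real) = s"
        by (simp only: fst_conv snd_conv)
    qed
  qed
qed

lemma case_i_separated:
  assumes \<delta>: "\<delta> = 1 \<or> \<delta> = -1" and V: "open V" and c: "case_i \<delta> \<eta> F G f V"
  shows "\<exists>g h A B p. separated \<delta> \<eta> F G f V g h A B p \<and> (\<forall>z1 y1. (z1, y1) \<in> proj_z1y1 V \<longrightarrow> jac g h (z1, y1) \<noteq> 0)"
proof -
  from c obtain a b lam \<mu> :: real and g h \<phi> where ab: "a\<^sup>2 + b\<^sup>2 \<noteq> 0"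
    and g: "smooth_on (proj_z1y1 V) g" and h: "smooth_on (proj_z1y1 V) h"
    and rel0: "\<forall>(z1, y1) \<in> proj_z1y1 V. \<mu> * g (z1, y1) - lam * h (z1, y1) = \<delta> * a * y1 + \<delta> * b * z1 \<and> jac g h (z1, y1) \<noteq> 0"
    and \<phi>: "smooth_on (xi_range a b V) \<phi>"
    and E0: "\<forall>(z, z1, y, y1) \<in> V. let \<xi> = a * y + b * z; w = (z1, y1); W = jac g h w in
          F (z, z1, y, y1) = 1 / W *
            (- \<delta> * a * (b * z1 + a * y1) * deriv (deriv \<phi>) \<xi>
             - \<eta> * (\<mu> * D2 h w + lam * D2 g w) * deriv \<phi> \<xi>
             + 1 / 2 * D2 (\<lambda>w. (g w)\<^sup>2 + (h w)\<^sup>2) w * \<phi> \<xi>) \<and>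
          G (z, z1, y, y1) = 1 / W *
            (\<delta> * b * (b * z1 + a * y1) * deriv (deriv \<phi>) \<xi>
             + \<eta> * (\<mu> * D1 h w + lam * D1 g w) * deriv \<phi> \<xi>
             - 1 / 2 * D1 (\<lambda>w. (g w)\<^sup>2 + (h w)\<^sup>2) w * \<phi> \<xi>) \<and>
          f 1 1 (z, z1, y, y1) = g w \<and> f 1 2 (z, z1, y, y1) = lam * deriv \<phi> \<xi> \<and>
          f 2 1 (z, z1, y, y1) = h w \<and> f 2 2 (z, z1, y, y1) = \<mu> * deriv \<phi> \<xi> \<and>
          f 3 1 (z, z1, y, y1) = \<eta> \<and> f 3 2 (z, z1, y, y1) = \<phi> \<xi>"
    unfolding case_i_def by blast
  have rel: "\<mu> * g (z1, y1) - lam * h (z1, y1) = \<delta> * a * y1 + \<delta> * b * z1" and J: "jac g h (z1, y1) \<noteq> 0"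
    if "(z1, y1) \<in> proj_z1y1 V" for z1 y1
    using bspec[OF rel0 that] by simp_all
  let ?\<Xi> = "xi_range a b V"
  have op\<Xi>: "open ?\<Xi>" by (rule open_xi_range[OF V ab])
  have \<phi>1: "smooth_on ?\<Xi> (deriv \<phi>)" by (rule smooth_on_deriv[OF op\<Xi> \<phi>])
  define P where "P k w = k (a * snd w + b * fst w)" for k :: "real \<Rightarrow> real" and w :: "real \<times> real"
  have in_\<Xi>: "a * y + b * z \<in> ?\<Xi>" if "(z, y) \<in> proj_zy V" for z y
    using that by (force simp: proj_zy_def xi_range_def)
  have smP: "smooth_on (proj_zy V) (P k)" if "smooth_on ?\<Xi> k" for k
    unfolding P_def[abs_def] by (rule smooth_on_along_xi[OF open_projections(2)[OF V] that in_\<Xi>])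
  have dP: "D1 (P k) (z, y) = b * deriv k (a * y + b * z)" "D2 (P k) (z, y) = a * deriv k (a * y + b * z)"
    "P k differentiable (at (z, y))"
    if "smooth_on ?\<Xi> k" "(z, y) \<in> proj_zy V" for k z y
  proof -
    have "k differentiable (at (a * y + b * z))"
      by (rule smooth_on_imp_differentiable[OF that(1) in_\<Xi>[OF that(2)]])
    from dd_along_xi[OF this]
    show "D1 (P k) (z, y) = b * deriv k (a * y + b * z)" "D2 (P k) (z, y) = a * deriv k (a * y + b * z)"
      "P k differentiable (at (z, y))"
      unfolding P_def[abs_def] by (auto intro: differentiableI)
  qed
  have "separated \<delta> \<eta> F G f V g h (\<lambda>w. lam * P (deriv \<phi>) w) (\<lambda>w. \<mu> * P (deriv \<phi>) w) (P \<phi>)"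
    unfolding separated_def
  proof (intro conjI allI impI)
    show "smooth_on (proj_zy V) (\<lambda>w. lam * P (deriv \<phi>) w)" "smooth_on (proj_zy V) (\<lambda>w. \<mu> * P (deriv \<phi>) w)"
      by (intro smooth_on_mult open_projections V smooth_on_const smP \<phi>1)+
    show "smooth_on (proj_zy V) (P \<phi>)" by (rule smP[OF \<phi>])
    fix z z1 y y1 assume q: "(z, z1, y, y1) \<in> V"
    let ?\<xi> = "a * y + b * z" and ?w = "(z1, y1)" and ?W = "jac g h (z1, y1)"
    note m = in_projections(1)[OF q] and w = in_projections(2)[OF q]
    have gd: "g differentiable (at ?w)" and hd: "h differentiable (at ?w)"
      using smooth_on_imp_differentiable g h m by blast+
    have E: "F (z, z1, y, y1) = 1 / ?W *
            (- \<delta> * a * (b * z1 + a * y1) * deriv (deriv \<phi>) ?\<xi>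
             - \<eta> * (\<mu> * D2 h ?w + lam * D2 g ?w) * deriv \<phi> ?\<xi>
             + 1 / 2 * (2 * (g ?w * D2 g ?w + h ?w * D2 h ?w)) * \<phi> ?\<xi>)"
      "G (z, z1, y, y1) = 1 / ?W *
            (\<delta> * b * (b * z1 + a * y1) * deriv (deriv \<phi>) ?\<xi>
             + \<eta> * (\<mu> * D1 h ?w + lam * D1 g ?w) * deriv \<phi> ?\<xi>
             - 1 / 2 * (2 * (g ?w * D1 g ?w + h ?w * D1 h ?w)) * \<phi> ?\<xi>)"
      "f 1 1 (z, z1, y, y1) = g ?w" "f 1 2 (z, z1, y, y1) = lam * deriv \<phi> ?\<xi>"
      "f 2 1 (z, z1, y, y1) = h ?w" "f 2 2 (z, z1, y, y1) = \<mu> * deriv \<phi> ?\<xi>"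
      "f 3 1 (z, z1, y, y1) = \<eta>" "f 3 2 (z, z1, y, y1) = \<phi> ?\<xi>"
      using bspec[OF E0 q] unfolding Let_def split dd_sum_of_squares[OF gd hd] by blast+
    have D: "D1 (\<lambda>w. c * P (deriv \<phi>) w) (z, y) = c * (b * deriv (deriv \<phi>) ?\<xi>)"
      "D2 (\<lambda>w. c * P (deriv \<phi>) w) (z, y) = c * (a * deriv (deriv \<phi>) ?\<xi>)" for c
      by (simp_all add: dd_cmult dP[OF \<phi>1 w])
    have Pv: "P k (z, y) = k ?\<xi>" for k by (simp add: P_def)
    note R = dd_linear_relation[OF open_projections(1)[OF V] m gd hd rel]
    note alg = case_i_algebra[of ?W "D1 g ?w" "D2 h ?w" "D2 g ?w" "D1 h ?w" \<mu> lam \<delta> b a, OF _ J[OF m] R]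
    show "f 1 1 (z, z1, y, y1) = g ?w" "f 2 1 (z, z1, y, y1) = h ?w" "f 3 1 (z, z1, y, y1) = \<eta>" by fact+
    show "f 1 2 (z, z1, y, y1) = lam * P (deriv \<phi>) (z, y)" "f 2 2 (z, z1, y, y1) = \<mu> * P (deriv \<phi>) (z, y)"
      "f 3 2 (z, z1, y, y1) = P \<phi> (z, y)" unfolding Pv by fact+
    show "D1 g ?w * F (z, z1, y, y1) + D2 g ?w * G (z, z1, y, y1)
        = D1 (\<lambda>w. lam * P (deriv \<phi>) w) (z, y) * z1 + D2 (\<lambda>w. lam * P (deriv \<phi>) w) (z, y) * y1
          - \<eta> * (\<mu> * P (deriv \<phi>) (z, y)) + P \<phi> (z, y) * h ?w"
      unfolding E(1,2) D Pv by (rule alg(1)) (simp add: jac_def)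
    show "D1 h ?w * F (z, z1, y, y1) + D2 h ?w * G (z, z1, y, y1)
        = D1 (\<lambda>w. \<mu> * P (deriv \<phi>) w) (z, y) * z1 + D2 (\<lambda>w. \<mu> * P (deriv \<phi>) w) (z, y) * y1
          - g ?w * P \<phi> (z, y) + \<eta> * (lam * P (deriv \<phi>) (z, y))"
      unfolding E(1,2) D Pv by (rule alg(2)) (simp add: jac_def)
    have "\<delta> * (g ?w * (\<mu> * deriv \<phi> ?\<xi>) - lam * deriv \<phi> ?\<xi> * h ?w)
        = \<delta> * (\<mu> * g ?w - lam * h ?w) * deriv \<phi> ?\<xi>" by (simp add: algebra_simps)
    also have "\<dots> = \<delta> * \<delta> * (a * y1 + b * z1) * deriv \<phi> ?\<xi>"
      unfolding rel[OF m] by (simp add: algebra_simps)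
    also have "\<delta> * \<delta> = 1" using \<delta> by auto
    finally show "D1 (P \<phi>) (z, y) * z1 + D2 (P \<phi>) (z, y) * y1
        = \<delta> * (g ?w * (\<mu> * P (deriv \<phi>) (z, y)) - lam * P (deriv \<phi>) (z, y) * h ?w)"
      unfolding dP[OF \<phi> w] Pv by (simp add: algebra_simps)
  qed (use g h in auto)
  with J show ?thesis by blast
qed

lemma dd_linear_form:
  "D1 (\<lambda>m. c1 * fst m + c2 * snd m) w = c1" "D2 (\<lambda>m. c1 * fst m + c2 * snd m) w = c2"
  for c1 c2 :: real and w :: "real \<times> real"
proof -
  have "((\<lambda>m. c1 * fst m + c2 * snd m) has_derivative (\<lambda>v. c1 * fst v + c2 * snd v)) (at w)"
    by (intro derivative_intros)
  from dd_has_derivative[OF this]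
  show "D1 (\<lambda>m. c1 * fst m + c2 * snd m) w = c1" "D2 (\<lambda>m. c1 * fst m + c2 * snd m) w = c2" by simp_all
qed

lemma dd_combination:
  fixes f g :: "'a::real_normed_vector \<Rightarrow> real"
  assumes "f differentiable (at w)" "g differentiable (at w)"
  shows "dd e (\<lambda>w. k * (c * f w - c' * g w)) w = k * (c * dd e f w - c' * dd e g w)"
proof -
  have d: "(\<lambda>w. c * f w) differentiable (at w)" "(\<lambda>w. c' * g w) differentiable (at w)"
    by (intro differentiable_mult differentiable_const assms)+
  show ?thesis
    by (simp only: dd_cmult[OF differentiable_diff[OF d]] dd_diff[OF d] dd_cmult[OF assms(1)] dd_cmult[OF assms(2)])
qed

lemma case_ii_separated:
  assumes \<delta>: "\<delta> = 1 \<or> \<delta> = -1" and V: "open V" and c: "case_ii \<delta> \<eta> F G f V"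
  shows "\<exists>g h A B p. separated \<delta> \<eta> F G f V g h A B p \<and> (\<forall>z1 y1. (z1, y1) \<in> proj_z1y1 V \<longrightarrow> jac g h (z1, y1) \<noteq> 0)"
proof -
  from c obtain a1 b1 a2 b2 \<gamma> \<alpha> \<beta> \<tau> :: real and p where \<gamma>: "\<gamma> = a1 * b2 - a2 * b1" "\<gamma> \<noteq> 0"
    and q: "\<alpha> = a1\<^sup>2 + a2\<^sup>2" "\<beta> = b1\<^sup>2 + b2\<^sup>2" "\<tau> = a1 * b1 + a2 * b2"
    and p: "smooth_on (proj_zy V) p"
    and E0: "\<forall>(z, z1, y, y1) \<in> V.
          let w = (z, y) in
          F (z, z1, y, y1) =
            - (z1 / \<gamma>) * (\<delta> * D2 (D1 p) w - \<tau> * p w)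
            + y1 / \<gamma> * (- \<delta> * D2 (D2 p) w + \<beta> * p w)
            + \<delta> * \<eta> / \<gamma>\<^sup>2 * (- \<beta> * D1 p w + \<tau> * D2 p w) \<and>
          G (z, z1, y, y1) =
            z1 / \<gamma> * (\<delta> * D1 (D1 p) w - \<alpha> * p w)
            + y1 / \<gamma> * (\<delta> * D2 (D1 p) w - \<tau> * p w)
            + \<delta> * \<eta> / \<gamma>\<^sup>2 * (\<tau> * D1 p w - \<alpha> * D2 p w) \<and>
          f 1 1 (z, z1, y, y1) = a1 * z1 + b1 * y1 \<and>
          f 1 2 (z, z1, y, y1) = \<delta> / \<gamma> * (b1 * D1 p w - a1 * D2 p w) \<and>
          f 2 1 (z, z1, y, y1) = a2 * z1 + b2 * y1 \<and>
          f 2 2 (z, z1, y, y1) = \<delta> / \<gamma> * (b2 * D1 p w - a2 * D2 p w) \<and>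
          f 3 1 (z, z1, y, y1) = \<eta> \<and> f 3 2 (z, z1, y, y1) = p w"
    unfolding case_ii_def by blast
  let ?g = "\<lambda>m. a1 * fst m + b1 * snd m" and ?h = "\<lambda>m. a2 * fst m + b2 * snd m"
  define K where "K c1 c2 w = \<delta> / \<gamma> * (c2 * D1 p w - c1 * D2 p w)" for c1 c2 w
  have D1p: "smooth_on (proj_zy V) (D1 p)" "smooth_on (proj_zy V) (D2 p)" using p by auto
  have smK: "smooth_on (proj_zy V) (K c1 c2)" for c1 c2
    unfolding K_def[abs_def] by (intro smooth_on_mult smooth_on_diff open_projections V smooth_on_const D1p)
  have dK: "D1 (K c1 c2) (z, y) = \<delta> / \<gamma> * (c2 * D1 (D1 p) (z, y) - c1 * D2 (D1 p) (z, y))"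
    "D2 (K c1 c2) (z, y) = \<delta> / \<gamma> * (c2 * D2 (D1 p) (z, y) - c1 * D2 (D2 p) (z, y))"
    if w: "(z, y) \<in> proj_zy V" for c1 c2 z y
  proof -
    have d: "D1 p differentiable (at (z, y))" "D2 p differentiable (at (z, y))"
      using smooth_on_imp_differentiable D1p w by blast+
    have "dd e (K c1 c2) (z, y) = \<delta> / \<gamma> * (c2 * dd e (D1 p) (z, y) - c1 * dd e (D2 p) (z, y))" for e
      unfolding K_def[abs_def] by (rule dd_combination[OF d])
    then show "D1 (K c1 c2) (z, y) = \<delta> / \<gamma> * (c2 * D1 (D1 p) (z, y) - c1 * D2 (D1 p) (z, y))"
      "D2 (K c1 c2) (z, y) = \<delta> / \<gamma> * (c2 * D2 (D1 p) (z, y) - c1 * D2 (D2 p) (z, y))"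
      using mixed_partials_commute[OF open_projections(2)[OF V] w p] by simp_all
  qed
  have "separated \<delta> \<eta> F G f V ?g ?h (K a1 b1) (K a2 b2) p"
    unfolding separated_def
  proof (intro conjI allI impI)
    show "smooth_on (proj_z1y1 V) ?g" "smooth_on (proj_z1y1 V) ?h"
      by (auto intro!: smooth_on_linear linearI simp: algebra_simps)
    fix z z1 y y1 assume qV: "(z, z1, y, y1) \<in> V"
    note w = in_projections(2)[OF qV]
    let ?w = "(z, y)"
    have E: "F (z, z1, y, y1) =
            - (z1 / \<gamma>) * (\<delta> * D2 (D1 p) ?w - \<tau> * p ?w)
            + y1 / \<gamma> * (- \<delta> * D2 (D2 p) ?w + \<beta> * p ?w)
            + \<delta> * \<eta> / \<gamma>\<^sup>2 * (- \<beta> * D1 p ?w + \<tau> * D2 p ?w)"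
         "G (z, z1, y, y1) =
            z1 / \<gamma> * (\<delta> * D1 (D1 p) ?w - \<alpha> * p ?w)
            + y1 / \<gamma> * (\<delta> * D2 (D1 p) ?w - \<tau> * p ?w)
            + \<delta> * \<eta> / \<gamma>\<^sup>2 * (\<tau> * D1 p ?w - \<alpha> * D2 p ?w)"
         "f 1 1 (z, z1, y, y1) = a1 * z1 + b1 * y1"
         "f 1 2 (z, z1, y, y1) = K a1 b1 ?w" "f 2 1 (z, z1, y, y1) = a2 * z1 + b2 * y1"
         "f 2 2 (z, z1, y, y1) = K a2 b2 ?w" "f 3 1 (z, z1, y, y1) = \<eta>" "f 3 2 (z, z1, y, y1) = p ?w"
      using bspec[OF E0 qV] unfolding Let_def split K_def by blast+
    note alg = case_ii_algebra[OF \<gamma> q]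
    show "f 1 1 (z, z1, y, y1) = ?g (z1, y1)" "f 2 1 (z, z1, y, y1) = ?h (z1, y1)"
      using E(3,5) by simp_all
    show "f 1 2 (z, z1, y, y1) = K a1 b1 ?w" "f 2 2 (z, z1, y, y1) = K a2 b2 ?w"
      "f 3 1 (z, z1, y, y1) = \<eta>" "f 3 2 (z, z1, y, y1) = p ?w" by fact+
    show "D1 ?g (z1, y1) * F (z, z1, y, y1) + D2 ?g (z1, y1) * G (z, z1, y, y1)
        = D1 (K a1 b1) ?w * z1 + D2 (K a1 b1) ?w * y1 - \<eta> * K a2 b2 ?w + p ?w * ?h (z1, y1)"
      unfolding dd_linear_form dK[OF w] E(1,2) fst_conv snd_conv K_def by (rule alg(1))
    show "D1 ?h (z1, y1) * F (z, z1, y, y1) + D2 ?h (z1, y1) * G (z, z1, y, y1)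
        = D1 (K a2 b2) ?w * z1 + D2 (K a2 b2) ?w * y1 - ?g (z1, y1) * p ?w + \<eta> * K a1 b1 ?w"
      unfolding dd_linear_form dK[OF w] E(1,2) fst_conv snd_conv K_def by (rule alg(2))
    have pull: "s * (k * X) - k * Y * t = k * (s * X - Y * t)" for s t k X Y :: real
      by (simp add: algebra_simps)
    have inner: "?g (z1, y1) * (b2 * D1 p ?w - a2 * D2 p ?w) - (b1 * D1 p ?w - a1 * D2 p ?w) * ?h (z1, y1)
        = \<gamma> * (D1 p ?w * z1 + D2 p ?w * y1)"
      by (simp add: \<gamma>(1) algebra_simps)
    have "\<delta> * (?g (z1, y1) * K a2 b2 ?w - K a1 b1 ?w * ?h (z1, y1))
        = \<delta> * \<delta> * (D1 p ?w * z1 + D2 p ?w * y1)"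
      unfolding K_def pull inner using \<gamma>(2) by simp
    also have "\<delta> * \<delta> = 1" using \<delta> by auto
    finally show "D1 p ?w * z1 + D2 p ?w * y1 = \<delta> * (?g (z1, y1) * K a2 b2 ?w - K a1 b1 ?w * ?h (z1, y1))"
      by simp
  qed (use smK p in auto)
  moreover have "jac ?g ?h m \<noteq> 0" for m
    using \<gamma> unfolding jac_def dd_linear_form by (simp add: mult.commute)
  ultimately show ?thesis by blast
qed

section \<open>From surfaces to the separated form\<close>

text \<open>On a solution with prescribed \<open>u_xx, v_xx, u_t, v_t\<close> at a point, each structure equation at this point is an
affine relation in these four numbers. They are arbitrary, so all coefficients vanish.\<close>

lemma describes_surfaces_identities:
  assumes V: "open V" and FG: "smooth_on V F" "smooth_on V G"
    and ds: "describes_surfaces \<delta> F G f V" and eta: "\<forall>q\<in>V. f 3 1 q = \<eta>" and q: "(z, z1, y, y1) \<in> V"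
  defines "j \<equiv> (z, z1, y, y1)"
  shows "dd Ez1 (f 1 2) j = 0" "dd Ey1 (f 1 2) j = 0" "dd Ez1 (f 2 2) j = 0" "dd Ey1 (f 2 2) j = 0"
    "dd Ez1 (f 3 2) j = 0" "dd Ey1 (f 3 2) j = 0"
    "dd Ez (f 1 1) j = 0" "dd Ey (f 1 1) j = 0" "dd Ez (f 2 1) j = 0" "dd Ey (f 2 1) j = 0"
    and "dd Ez1 (f 1 1) j * F j + dd Ey1 (f 1 1) j * G j
      = dd Ez (f 1 2) j * z1 + dd Ey (f 1 2) j * y1 - \<eta> * f 2 2 j + f 3 2 j * f 2 1 j"
    and "dd Ez1 (f 2 1) j * F j + dd Ey1 (f 2 1) j * G j
      = dd Ez (f 2 2) j * z1 + dd Ey (f 2 2) j * y1 - f 1 1 j * f 3 2 j + \<eta> * f 1 2 j"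
    and "dd Ez (f 3 2) j * z1 + dd Ey (f 3 2) j * y1 = \<delta> * (f 1 1 j * f 2 2 j - f 1 2 j * f 2 1 j)"
proof -
  have sm: "smooth_on V (f i k)" if "i \<in> {1, 2, 3}" "k \<in> {1, 2}" for i k
    using ds that unfolding describes_surfaces_def by blast
  have jV: "j \<in> V" using q by (simp add: j_def)
  have d31: "dd e (f 3 1) j = 0" for e
    using dd_cong_open(1)[OF V jV, of "f 3 1" "\<lambda>_. \<eta>"] eta dd_const by metis
  define H1 where "H1 i a c = dd Ez (f i 2) j * z1 + dd Ez1 (f i 2) j * a + dd Ey (f i 2) j * y1 + dd Ey1 (f i 2) j * c" for i a c
  define H2 where "H2 i s t = dd Ez (f i 1) j * s + dd Ez1 (f i 1) j * F j + dd Ey (f i 1) j * t + dd Ey1 (f i 1) j * G j" for i s t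
  have key: "H1 1 a c - H2 1 s t = f 3 1 j * f 2 2 j - f 3 2 j * f 2 1 j \<and>
     H1 2 a c - H2 2 s t = f 1 1 j * f 3 2 j - f 1 2 j * f 3 1 j \<and>
     H1 3 a c - H2 3 s t = \<delta> * (f 1 1 j * f 2 2 j - f 1 2 j * f 2 1 j)" for a c s t :: real
  proof (rule system_solution_with_data[OF V q FG, of a c s t])
    fix \<Omega> u v
    assume \<Omega>: "open \<Omega>" "(0, 0) \<in> \<Omega>" and uv: "smooth_on \<Omega> u" "smooth_on \<Omega> v" "jet_of u v ` \<Omega> \<subseteq> V"
      and sol: "solves_system F G \<Omega> u v" and j0: "jet_of u v (0, 0) = (z, z1, y, y1)"
      and D: "D1 (D1 u) (0, 0) = a" "D1 (D1 v) (0, 0) = c" "D2 u (0, 0) = s" "D2 v (0, 0) = t"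
    have j0': "jet_of u v (0, 0) = j" and u0: "D1 u (0, 0) = z1" "D1 v (0, 0) = y1"
      using j0 by (simp_all add: jet_of_def j_def)
    have t2: "D2 (D1 u) (0, 0) = F j" "D2 (D1 v) (0, 0) = G j"
      using sol \<Omega>(2) unfolding solves_system_def by (simp_all add: j0')
    have dif: "f i k differentiable (at (jet_of u v (0, 0)))" if "i \<in> {1, 2, 3}" "k \<in> {1, 2}" for i k
      unfolding j0' by (rule smooth_on_imp_differentiable[OF sm[OF that] jV])
    have d1: "D1 (f i 2 \<circ> jet_of u v) (0, 0) = H1 i a c" if "i \<in> {1, 2, 3}" for i
      using dd_comp_jet_of[OF \<Omega> uv(1,2) dif[OF that, of 2], of "(1, 0)"]
      unfolding j0' D u0 H1_def by simp
    have d2: "D2 (f i 1 \<circ> jet_of u v) (0, 0) = H2 i s t" if "i \<in> {1, 2, 3}" for i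
      using dd_comp_jet_of[OF \<Omega> uv(1,2) dif[OF that, of 1], of "(0, 1)"]
      unfolding j0' D t2 H2_def by simp
    have "structure_equations \<delta> \<Omega> (assoc_form f u v)"
      using ds \<Omega>(1) uv sol unfolding describes_surfaces_def by blast
    from bspec[OF this[unfolded structure_equations_def] \<Omega>(2)]
    show ?thesis
      unfolding ext_d_def wedge_def assoc_form_def fst_conv snd_conv
      unfolding comp_apply[of _ _ "(0, 0)"] j0'
      using d1[of 1] d1[of 2] d1[of 3] d2[of 1] d2[of 2] d2[of 3] by (simp add: comp_def)
  qed
  have H23: "H2 3 s t = 0" for s t unfolding H2_def d31 by simp
  have e: "f 3 1 j = \<eta>" using eta jV by blast
  note k0 = key[of 0 0 0 0] and ka = key[of 1 0 0 0] and kc = key[of 0 1 0 0] and ks = key[of 0 0 1 0] and kt = key[of 0 0 0 1]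
  note H = H1_def H2_def
  show "dd Ez1 (f 1 2) j = 0" "dd Ez1 (f 2 2) j = 0" "dd Ez1 (f 3 2) j = 0"
    using k0 ka unfolding H23 by (simp_all add: H)
  show "dd Ey1 (f 1 2) j = 0" "dd Ey1 (f 2 2) j = 0" "dd Ey1 (f 3 2) j = 0"
    using k0 kc unfolding H23 by (simp_all add: H)
  show "dd Ez (f 1 1) j = 0" "dd Ez (f 2 1) j = 0"
    using k0 ks unfolding H23 by (simp_all add: H)
  show "dd Ey (f 1 1) j = 0" "dd Ey (f 2 1) j = 0"
    using k0 kt unfolding H23 by (simp_all add: H)
  show "dd Ez1 (f 1 1) j * F j + dd Ey1 (f 1 1) j * G j
      = dd Ez (f 1 2) j * z1 + dd Ey (f 1 2) j * y1 - \<eta> * f 2 2 j + f 3 2 j * f 2 1 j"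
    and "dd Ez1 (f 2 1) j * F j + dd Ey1 (f 2 1) j * G j
      = dd Ez (f 2 2) j * z1 + dd Ey (f 2 2) j * y1 - f 1 1 j * f 3 2 j + \<eta> * f 1 2 j"
    and "dd Ez (f 3 2) j * z1 + dd Ey (f 3 2) j * y1 = \<delta> * (f 1 1 j * f 2 2 j - f 1 2 j * f 2 1 j)"
    using k0 unfolding H23 e by (simp_all add: H algebra_simps)
qed

text \<open>Products of a disc in the \<open>(z, y)\<close>-plane and a disc in the \<open>(z1, y1)\<close>-plane. On them functions that do
not depend on one pair of variables descend to the other plane, and convexity makes the levels of
\<open>a y + b z\<close> connected.\<close>

definition bi_ball :: "real \<times> real \<Rightarrow> real \<times> real \<Rightarrow> real \<Rightarrow> jet set" where
  "bi_ball w m \<rho> = {(z, z1, y, y1). (z, y) \<in> ball w \<rho> \<and> (z1, y1) \<in> ball m \<rho>}"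

lemma in_bi_ball [simp]: "(z, z1, y, y1) \<in> bi_ball w m \<rho> \<longleftrightarrow> (z, y) \<in> ball w \<rho> \<and> (z1, y1) \<in> ball m \<rho>"
  by (simp add: bi_ball_def)

lemma bi_ball_alt:
  "bi_ball w m \<rho> = (\<lambda>q. ((fst q, fst (snd (snd q))), (fst (snd q), snd (snd (snd q))))) -` (ball w \<rho> \<times> ball m \<rho>)"
  by (auto simp: bi_ball_def)

lemma open_bi_ball: "open (bi_ball w m \<rho>)"
  unfolding bi_ball_alt
  by (intro open_vimage open_Times open_ball continuous_intros)

lemma convex_bi_ball: "convex (bi_ball w m \<rho>)"
  unfolding bi_ball_alt
  by (intro convex_linear_vimage linearI convex_Times convex_ball) auto

lemma domain4_bi_ball: "\<rho> > 0 \<Longrightarrow> domain4 (bi_ball w m \<rho>)"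
proof -
  assume "\<rho> > 0"
  then have "(fst w, fst m, snd w, snd m) \<in> bi_ball w m \<rho>" by simp
  then show ?thesis
    unfolding domain4_def using open_bi_ball convex_connected[OF convex_bi_ball] by blast
qed

lemma bi_ball_projections:
  assumes "\<rho> > 0"
  shows "proj_zy (bi_ball w m \<rho>) = ball w \<rho>" "proj_z1y1 (bi_ball w m \<rho>) = ball m \<rho>"
proof -
  have c: "w \<in> ball w \<rho>" "m \<in> ball m \<rho>" using assms by auto
  show "proj_zy (bi_ball w m \<rho>) = ball w \<rho>"
  proof (intro equalityI subsetI)
    fix x assume "x \<in> ball w \<rho>"
    then have "(fst x, fst m, snd x, snd m) \<in> bi_ball w m \<rho>" using c by simp
    from in_projections(2)[OF this] show "x \<in> proj_zy (bi_ball w m \<rho>)" by simp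
  qed (auto simp: proj_zy_def bi_ball_def)
  show "proj_z1y1 (bi_ball w m \<rho>) = ball m \<rho>"
  proof (intro equalityI subsetI)
    fix x assume "x \<in> ball m \<rho>"
    then have "(fst w, fst x, snd w, snd x) \<in> bi_ball w m \<rho>" using c by simp
    from in_projections(1)[OF this] show "x \<in> proj_z1y1 (bi_ball w m \<rho>)" by simp
  qed (auto simp: proj_z1y1_def bi_ball_def)
qed

lemma bi_ball_in_open:
  assumes "open V" "(z, z1, y, y1) \<in> V"
  obtains \<rho> where "\<rho> > 0" "bi_ball (z, y) (z1, y1) \<rho> \<subseteq> V"
proof -
  let ?T = "\<lambda>p. (fst (fst p), fst (snd p), snd (fst p), snd (snd p)) :: jet"
  have "open (?T -` V)" by (intro open_vimage assms continuous_intros)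
  moreover have "((z, y), (z1, y1)) \<in> ?T -` V" using assms(2) by simp
  ultimately obtain X Y where XY: "open X" "open Y" "((z, y), (z1, y1)) \<in> X \<times> Y" "X \<times> Y \<subseteq> ?T -` V"
    by (rule open_prod_elim)
  obtain r1 r2 where r: "r1 > 0" "ball (z, y) r1 \<subseteq> X" "r2 > 0" "ball (z1, y1) r2 \<subseteq> Y"
    using XY(1-3) by (meson mem_Sigma_iff open_contains_ball)
  have "bi_ball (z, y) (z1, y1) (min r1 r2) \<subseteq> V"
  proof
    fix q assume q: "q \<in> bi_ball (z, y) (z1, y1) (min r1 r2)"
    obtain a b c d where q': "q = (a, b, c, d)" by (cases q)
    have "(a, c) \<in> ball (z, y) r1" "(b, d) \<in> ball (z1, y1) r2" using q by (simp_all add: q')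
    then have "((a, c), (b, d)) \<in> X \<times> Y" using r by blast
    then show "q \<in> V" using XY(4) by (auto simp: q')
  qed
  then show ?thesis using that[of "min r1 r2"] r by simp
qed

lemma eq_if_partials_vanish:
  assumes S: "convex S" and q: "q \<in> S" "q' \<in> S" and f: "smooth_on S f"
    and dir: "\<And>e. e \<in> Basis \<Longrightarrow> (q' - q) \<bullet> e = 0 \<or> (\<forall>p\<in>S. dd e f p = 0)"
  shows "f q' = f q"
proof -
  have "f q' - f q = (\<Sum>e\<in>Basis. ((q' - q) \<bullet> e) * mean_dd e f (q, q'))"
    by (rule hadamard_increment[OF S q])
      (use f smooth_on_imp_differentiable Ck_on_imp_continuous[OF smooth_onD[OF smooth_on_dd[OF f], of _ 0]] in auto)
  also have "\<dots> = 0"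
  proof (rule sum.neutral, rule ballI)
    fix e :: 'a assume e: "e \<in> Basis"
    have "mean_dd e f (q, q') = 0" if "\<forall>p\<in>S. dd e f p = 0"
    proof -
      have "integral {0..1} (\<lambda>\<theta>. dd e f (q + \<theta> *\<^sub>R (q' - q))) = integral {0..1} (\<lambda>_ :: real. 0 :: real)"
        by (rule Henstock_Kurzweil_Integration.integral_cong) (use that segment_in_convex[OF S q] in auto)
      then show ?thesis by (simp add: mean_dd_def)
    qed
    then show "((q' - q) \<bullet> e) * mean_dd e f (q, q') = 0" using dir[OF e] by auto
  qed
  finally show ?thesis by simp
qed

lemma describes_surfaces_separated:
  assumes \<rho>: "\<rho> > 0" and VV: "bi_ball w0 m0 \<rho> \<subseteq> V" and V: "open V" and FG: "smooth_on V F" "smooth_on V G"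
    and ds: "describes_surfaces \<delta> F G f V" and eta: "\<forall>q\<in>V. f 3 1 q = \<eta>"
  shows "\<exists>g h A B p. separated \<delta> \<eta> F G f (bi_ball w0 m0 \<rho>) g h A B p"
proof -
  let ?S = "bi_ball w0 m0 \<rho>"
  note op = open_bi_ball[of w0 m0 \<rho>] and pr = bi_ball_projections[OF \<rho>, of w0 m0]
  have c: "(fst w0, snd w0) \<in> ball w0 \<rho>" "(fst m0, snd m0) \<in> ball m0 \<rho>" using \<rho> by auto
  have sm: "smooth_on ?S (f i k)" if "i \<in> {1, 2, 3}" "k \<in> {1, 2}" for i k
    using ds that VV smooth_on_subset unfolding describes_surfaces_def by blast
  note ids = describes_surfaces_identities[OF V FG ds eta subsetD[OF VV]]
  define gm where "gm i = (\<lambda>m. f i 1 (fst w0, fst m, snd w0, snd m))" for i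
  define pw where "pw i = (\<lambda>w. f i 2 (fst w, fst m0, snd w, snd m0))" for i
  have lin: "smooth_on S fst" "smooth_on S snd" for S :: "(real \<times> real) set"
    by (auto intro!: smooth_on_linear linearI)
  have smg: "smooth_on (proj_z1y1 ?S) (gm i)" if "i \<in> {1, 2}" for i
    unfolding gm_def pr
  proof (rule smooth_on_compose[where g="\<lambda>m. (fst w0, fst m, snd w0, snd m)" and T="?S"])
    show "smooth_on (ball m0 \<rho>) (\<lambda>m. (fst w0, fst m, snd w0, snd m) \<bullet> e)" if "e \<in> Basis" for e :: jet
      using that by (auto simp: Basis_jet lin)
  qed (use c sm that in auto)
  have smp: "smooth_on (proj_zy ?S) (pw i)" if "i \<in> {1, 2, 3}" for i
    unfolding pw_def pr
  proof (rule smooth_on_compose[where g="\<lambda>w. (fst w, fst m0, snd w, snd m0)" and T="?S"])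
    show "smooth_on (ball w0 \<rho>) (\<lambda>w. (fst w, fst m0, snd w, snd m0) \<bullet> e)" if "e \<in> Basis" for e :: jet
      using that by (auto simp: Basis_jet lin)
  qed (use c sm that in auto)
  have fg: "f i 1 (z, z1, y, y1) = gm i (z1, y1)" if i: "i \<in> {1, 2}" and q: "(z, z1, y, y1) \<in> ?S" for i z z1 y y1
    unfolding gm_def
  proof (rule eq_if_partials_vanish[OF convex_bi_ball[of w0 m0 \<rho>] _ q sm])
    show "(fst w0, fst (z1, y1), snd w0, snd (z1, y1)) \<in> ?S" using c q by simp
    show "((z, z1, y, y1) - (fst w0, fst (z1, y1), snd w0, snd (z1, y1))) \<bullet> e = 0 \<or> (\<forall>p\<in>?S. dd e (f i 1) p = 0)"
      if "e \<in> Basis" for e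
      using that i ids(7-10) by (auto simp: Basis_jet)
  qed (use i in auto)
  have fp: "f i 2 (z, z1, y, y1) = pw i (z, y)" if i: "i \<in> {1, 2, 3}" and q: "(z, z1, y, y1) \<in> ?S" for i z z1 y y1
    unfolding pw_def
  proof (rule eq_if_partials_vanish[OF convex_bi_ball[of w0 m0 \<rho>] _ q sm])
    show "(fst (z, y), fst m0, snd (z, y), snd m0) \<in> ?S" using c q by simp
    show "((z, z1, y, y1) - (fst (z, y), fst m0, snd (z, y), snd m0)) \<bullet> e = 0 \<or> (\<forall>p\<in>?S. dd e (f i 2) p = 0)"
      if "e \<in> Basis" for e
      using that i ids(1-6) by (auto simp: Basis_jet)
  qed (use i in auto)
  have dg: "dd Ez1 (f i 1) (z, z1, y, y1) = D1 (gm i) (z1, y1)" "dd Ey1 (f i 1) (z, z1, y, y1) = D2 (gm i) (z1, y1)"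
    if i: "i \<in> {1, 2}" and q: "(z, z1, y, y1) \<in> ?S" for i z z1 y y1
  proof -
    have "dd e (f i 1) (z, z1, y, y1) = dd e (lift_m (gm i)) (z, z1, y, y1)" for e
      by (rule dd_cong_open(1)[OF op q]) (use fg[OF i] in \<open>auto simp: lift_m_def\<close>)
    with dd_lift_m(1)[OF smooth_on_imp_differentiable[OF smg[OF i] in_projections(1)[OF q]]]
    show "dd Ez1 (f i 1) (z, z1, y, y1) = D1 (gm i) (z1, y1)" "dd Ey1 (f i 1) (z, z1, y, y1) = D2 (gm i) (z1, y1)"
      by simp_all
  qed
  have dp: "dd Ez (f i 2) (z, z1, y, y1) = D1 (pw i) (z, y)" "dd Ey (f i 2) (z, z1, y, y1) = D2 (pw i) (z, y)"
    if i: "i \<in> {1, 2, 3}" and q: "(z, z1, y, y1) \<in> ?S" for i z z1 y y1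
  proof -
    have "dd e (f i 2) (z, z1, y, y1) = dd e (lift_w (pw i)) (z, z1, y, y1)" for e
      by (rule dd_cong_open(1)[OF op q]) (use fp[OF i] in \<open>auto simp: lift_w_def\<close>)
    with dd_lift_w(1)[OF smooth_on_imp_differentiable[OF smp[OF i] in_projections(2)[OF q]]]
    show "dd Ez (f i 2) (z, z1, y, y1) = D1 (pw i) (z, y)" "dd Ey (f i 2) (z, z1, y, y1) = D2 (pw i) (z, y)"
      by simp_all
  qed
  have I: "(1::nat) \<in> {1, 2}" "(2::nat) \<in> {1, 2}" "(1::nat) \<in> {1, 2, 3}" "(2::nat) \<in> {1, 2, 3}" "(3::nat) \<in> {1, 2, 3}"
    by auto
  have "separated \<delta> \<eta> F G f ?S (gm 1) (gm 2) (pw 1) (pw 2) (pw 3)"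
    unfolding separated_def
  proof (intro conjI allI impI)
    fix z z1 y y1 assume q: "(z, z1, y, y1) \<in> ?S"
    note rew = fg[OF I(1) q] fg[OF I(2) q] fp[OF I(3) q] fp[OF I(4) q] fp[OF I(5) q]
      dg[OF I(1) q] dg[OF I(2) q] dp[OF I(3) q] dp[OF I(4) q] dp[OF I(5) q]
    show "f 1 1 (z, z1, y, y1) = gm 1 (z1, y1)" "f 2 1 (z, z1, y, y1) = gm 2 (z1, y1)"
      "f 1 2 (z, z1, y, y1) = pw 1 (z, y)" "f 2 2 (z, z1, y, y1) = pw 2 (z, y)" "f 3 2 (z, z1, y, y1) = pw 3 (z, y)"
      by (fact rew)+
    show "f 3 1 (z, z1, y, y1) = \<eta>" using eta VV q by blast
    show "D1 (gm 1) (z1, y1) * F (z, z1, y, y1) + D2 (gm 1) (z1, y1) * G (z, z1, y, y1)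
          = D1 (pw 1) (z, y) * z1 + D2 (pw 1) (z, y) * y1 - \<eta> * pw 2 (z, y) + pw 3 (z, y) * gm 2 (z1, y1)"
      using ids(11)[OF q] unfolding rew .
    show "D1 (gm 2) (z1, y1) * F (z, z1, y, y1) + D2 (gm 2) (z1, y1) * G (z, z1, y, y1)
          = D1 (pw 2) (z, y) * z1 + D2 (pw 2) (z, y) * y1 - gm 1 (z1, y1) * pw 3 (z, y) + \<eta> * pw 1 (z, y)"
      using ids(12)[OF q] unfolding rew .
    show "D1 (pw 3) (z, y) * z1 + D2 (pw 3) (z, y) * y1
        = \<delta> * (gm 1 (z1, y1) * pw 2 (z, y) - pw 1 (z, y) * gm 2 (z1, y1))"
      using ids(13)[OF q] unfolding rew .
  qed (use smg smp I in auto)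
  then show ?thesis by blast
qed

lemma describes_surfaces_subset:
  assumes "describes_surfaces \<delta> F G f V" "S \<subseteq> V"
  shows "describes_surfaces \<delta> F G f S"
proof -
  have "negligible {q\<in>S. f 1 1 q * f 2 2 q - f 1 2 q * f 2 1 q = 0}"
    by (rule negligible_subset[of "{q\<in>V. f 1 1 q * f 2 2 q - f 1 2 q * f 2 1 q = 0}"])
      (use assms in \<open>auto simp: describes_surfaces_def\<close>)
  moreover have "smooth_on S (f i j)" if "i \<in> {1, 2, 3}" "j \<in> {1, 2}" for i j
    using assms that smooth_on_subset unfolding describes_surfaces_def by blast
  ultimately show ?thesis
    using assms unfolding describes_surfaces_def by (meson order_trans)
qed

text \<open>A solution of the system perturbed by a field in the kernel of the Jacobian still satisfies the structure equations,
hence solves the original system; so the perturbation is zero at each jet through which such a solution passes.\<close>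

lemma kernel_field_vanishes:
  assumes V: "open V" and FG: "smooth_on V F" "smooth_on V G"
    and ds: "describes_surfaces \<delta> F G f V" and sep: "separated \<delta> \<eta> F G f V g h A B p"
    and k: "smooth_on V k1" "smooth_on V k2"
    and ker: "\<And>z z1 y y1. (z, z1, y, y1) \<in> V \<Longrightarrow>
        D1 g (z1, y1) * k1 (z, z1, y, y1) + D2 g (z1, y1) * k2 (z, z1, y, y1) = 0 \<and>
        D1 h (z1, y1) * k1 (z, z1, y, y1) + D2 h (z1, y1) * k2 (z, z1, y, y1) = 0"
    and q: "(z, z1, y, y1) \<in> V"
  shows "k1 (z, z1, y, y1) = 0 \<and> k2 (z, z1, y, y1) = 0"
proof (rule system_solution_with_data[OF V q, of "\<lambda>q. F q + k1 q" "\<lambda>q. G q + k2 q" 0 0 0 0])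
  show "smooth_on V (\<lambda>q. F q + k1 q)" "smooth_on V (\<lambda>q. G q + k2 q)"
    by (intro smooth_on_add V FG k)+
  fix \<Omega> u v
  assume \<Omega>: "open \<Omega>" "(0, 0) \<in> \<Omega>" and uv: "smooth_on \<Omega> u" "smooth_on \<Omega> v" "jet_of u v ` \<Omega> \<subseteq> V"
    and sol: "solves_system (\<lambda>q. F q + k1 q) (\<lambda>q. G q + k2 q) \<Omega> u v" and j0: "jet_of u v (0, 0) = (z, z1, y, y1)"
  have "structure_equations \<delta> \<Omega> (assoc_form f u v)"
    unfolding structure_equations_separated[OF V sep \<Omega>(1) uv]
  proof
    fix q assume q: "q \<in> \<Omega>"
    have j: "jet_of u v q = (u q, D1 u q, v q, D1 v q)" by (simp add: jet_of_def)
    have "(u q, D1 u q, v q, D1 v q) \<in> V" using uv(3) q j by auto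
    from ker[OF this] show "D1 g (D1 u q, D1 v q) * (D2 (D1 u) q - F (jet_of u v q))
           + D2 g (D1 u q, D1 v q) * (D2 (D1 v) q - G (jet_of u v q)) = 0 \<and>
          D1 h (D1 u q, D1 v q) * (D2 (D1 u) q - F (jet_of u v q))
           + D2 h (D1 u q, D1 v q) * (D2 (D1 v) q - G (jet_of u v q)) = 0"
      using sol q unfolding solves_system_def by (simp add: j)
  qed
  then have "solves_system F G \<Omega> u v"
    using ds \<Omega>(1) uv unfolding describes_surfaces_def by blast
  then show ?thesis
    using sol \<Omega>(2) unfolding solves_system_def by (metis add_cancel_left_right j0)
qed

text \<open>If the Jacobian determinant vanished identically, \<open>(g_y1, - g_z1)\<close> and \<open>(h_y1, - h_z1)\<close> would be kernel
fields, hence zero. Then the matrix is zero and even \<open>(1, 0)\<close> is a kernel field.\<close>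

lemma jacobian_nonzero_somewhere:
  assumes V: "open V" "V \<noteq> {}" and FG: "smooth_on V F" "smooth_on V G"
    and ds: "describes_surfaces \<delta> F G f V" and sep: "separated \<delta> \<eta> F G f V g h A B p"
  shows "\<exists>z z1 y y1. (z, z1, y, y1) \<in> V \<and> jac g h (z1, y1) \<noteq> 0"
proof (rule ccontr)
  assume "\<not> ?thesis"
  then have J: "jac g h (z1, y1) = 0" if "(z, z1, y, y1) \<in> V" for z z1 y y1 using that by blast
  note S = separatedD(1,2)[OF sep]
  note ker = kernel_field_vanishes[OF V(1) FG ds sep]
  have sm: "smooth_on V (lift_m k)" "smooth_on V (\<lambda>q. - 1 * lift_m k q)" if "smooth_on (proj_z1y1 V) k" for k
    using smooth_on_lift_m[OF V(1) that] smooth_on_mult[OF V(1) smooth_on_const[of V "- 1"], of "lift_m k"]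
    by simp_all
  have g0: "D2 g (z1, y1) = 0 \<and> D1 g (z1, y1) = 0" if "(z, z1, y, y1) \<in> V" for z z1 y y1
    using ker[of "lift_m (D2 g)" "\<lambda>q. - 1 * lift_m (D1 g) q", OF sm(1) sm(2) _ that] S J
    by (auto simp: jac_def algebra_simps smooth_on_D)
  have h0: "D2 h (z1, y1) = 0 \<and> D1 h (z1, y1) = 0" if "(z, z1, y, y1) \<in> V" for z z1 y y1
    using ker[of "lift_m (D2 h)" "\<lambda>q. - 1 * lift_m (D1 h) q", OF sm(1) sm(2) _ that] S J
    by (auto simp: jac_def algebra_simps smooth_on_D)
  obtain z z1 y y1 where q: "(z, z1, y, y1) \<in> V" using V(2) by (metis ex_in_conv prod.exhaust)
  have "(1::real) = 0 \<and> (0::real) = 0"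
    using ker[of "\<lambda>_. 1" "\<lambda>_. 0", OF smooth_on_const smooth_on_const _ q] g0 h0 by auto
  then show False by simp
qed

section \<open>From the separated form to the two families\<close>

lemma linear_form_zero:
  fixes c1 c2 :: real
  assumes "open M" "m0 \<in> M" "\<And>m. m \<in> M \<Longrightarrow> c1 * fst m + c2 * snd m = 0"
  shows "c1 = 0" "c2 = 0"
proof -
  have "dd e (\<lambda>m. c1 * fst m + c2 * snd m) m0 = dd e (\<lambda>_. 0) m0" for e
    by (rule dd_cong_open(1)[OF assms])
  then show "c1 = 0" "c2 = 0" using dd_linear_form[of c1 c2 m0] by (metis dd_const)+
qed

lemma linear_system_unique:
  fixes a b c d x y x' y' :: real
  assumes "a * x + b * y = r" "c * x + d * y = s" "a * x' + b * y' = r" "c * x' + d * y' = s"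
    and "a * d - b * c \<noteq> 0"
  shows "x = x'" "y = y'"
proof -
  have "a * (x - x') + b * (y - y') = 0" "c * (x - x') + d * (y - y') = 0"
    using assms(1-4) by (simp_all add: algebra_simps)
  from linear_system_trivial[OF this assms(5)] show "x = x'" "y = y'" by simp_all
qed

lemma separated_subset:
  assumes "separated \<delta> \<eta> F G f V g h A B p" "S \<subseteq> V"
  shows "separated \<delta> \<eta> F G f S g h A B p"
proof -
  have "proj_z1y1 S \<subseteq> proj_z1y1 V" "proj_zy S \<subseteq> proj_zy V"
    unfolding proj_z1y1_def proj_zy_def using assms(2) by (intro image_mono; assumption)+
  then show ?thesis
    using assms smooth_on_subset unfolding separated_def by (meson subsetD)
qed

lemma bi_ball_where_positive:
  assumes "open S" "continuous_on S k" "(z, z1, y, y1) \<in> S" "k (z, z1, y, y1) > (0 :: real)"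
  obtains \<rho> where "\<rho> > 0" "bi_ball (z, y) (z1, y1) \<rho> \<subseteq> S" "\<And>q. q \<in> bi_ball (z, y) (z1, y1) \<rho> \<Longrightarrow> k q > 0"
proof -
  have "open (S \<inter> k -` {0<..})"
    using assms(1,2) by (intro continuous_open_preimage) auto
  moreover have "(z, z1, y, y1) \<in> S \<inter> k -` {0<..}" using assms(3,4) by simp
  ultimately obtain \<rho> where "\<rho> > 0" "bi_ball (z, y) (z1, y1) \<rho> \<subseteq> S \<inter> k -` {0<..}"
    by (rule bi_ball_in_open)
  then show ?thesis using that by blast
qed

text \<open>Linear independence of \<open>p_z\<close> and \<open>p_y\<close> provides points \<open>w1, w2\<close> with independent gradients of
\<open>p\<close>. The third equation at these two points is a linear system for \<open>g\<close> and \<open>h\<close> with constant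
matrix and linear forms on the other side. The matrix is invertible, since a relation between its rows would be a
relation between the linear forms.\<close>

lemma separated_case_ii:
  assumes \<delta>: "\<delta> = 1 \<or> \<delta> = -1" and \<rho>: "\<rho> > 0"
    and sep: "separated \<delta> \<eta> F G f (bi_ball w0 m0 \<rho>) g h A B p"
    and J: "\<And>m. m \<in> ball m0 \<rho> \<Longrightarrow> jac g h m \<noteq> 0"
    and indep: "\<And>c1 c2. (\<And>w. w \<in> ball w0 \<rho> \<Longrightarrow> c1 * D1 p w + c2 * D2 p w = 0) \<Longrightarrow> c1 = 0 \<and> c2 = 0"
  shows "case_ii \<delta> \<eta> F G f (bi_ball w0 m0 \<rho>)"
proof -
  let ?S = "bi_ball w0 m0 \<rho>"
  note pr = bi_ball_projections[OF \<rho>, of w0 m0]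
  note S = separatedD[OF sep]
  have \<delta>\<delta>: "\<delta> * \<delta> = 1" using \<delta> by auto
  have m0: "m0 \<in> ball m0 \<rho>" using \<rho> by simp
  have eq3: "D1 p w * fst m + D2 p w * snd m = \<delta> * (g m * B w - A w * h m)"
    if "w \<in> ball w0 \<rho>" "m \<in> ball m0 \<rho>" for w m
    using S(14)[of "fst w" "fst m" "snd w" "snd m"] that by simp
  obtain w1 w2 where w: "w1 \<in> ball w0 \<rho>" "w2 \<in> ball w0 \<rho>"
    and det: "D1 p w1 * - D2 p w2 - - D1 p w2 * D2 p w1 \<noteq> 0"
  proof (rule ccontr)
    assume contra: "\<not> thesis"
    have z: "D1 p w1 * D2 p w2 = D1 p w2 * D2 p w1" if "w1 \<in> ball w0 \<rho>" "w2 \<in> ball w0 \<rho>" for w1 w2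
      using contra that(1) that(2) \<open>\<And>w1 w2. \<lbrakk>w1 \<in> ball w0 \<rho>; w2 \<in> ball w0 \<rho>; D1 p w1 * - D2 p w2 - - D1 p w2 * D2 p w1 \<noteq> 0\<rbrakk> \<Longrightarrow> thesis\<close>
      by fastforce
    have "D1 p w1 = 0 \<and> D2 p w1 = 0" if w1: "w1 \<in> ball w0 \<rho>" for w1
      using indep[of "D2 p w1" "- D1 p w1"] z[OF w1] by (simp add: mult.commute)
    then show False using indep[of 1 0] by simp
  qed
  \<comment> \<open>\<open>d\<close> is the determinant of the linear system for \<open>g\<close> and \<open>h\<close>.\<close>
  define d where "d = A w2 * B w1 - A w1 * B w2"
  have dg: "d * g m = \<delta> * (A w2 * (D1 p w1 * fst m + D2 p w1 * snd m) - A w1 * (D1 p w2 * fst m + D2 p w2 * snd m))"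
    and dh: "d * h m = \<delta> * (B w2 * (D1 p w1 * fst m + D2 p w1 * snd m) - B w1 * (D1 p w2 * fst m + D2 p w2 * snd m))"
    if "m \<in> ball m0 \<rho>" for m
  proof -
    have "\<delta> * (A w2 * (D1 p w1 * fst m + D2 p w1 * snd m) - A w1 * (D1 p w2 * fst m + D2 p w2 * snd m))
       = (\<delta> * \<delta>) * (d * g m)"
      unfolding eq3[OF w(1) that] eq3[OF w(2) that] d_def by (simp add: algebra_simps)
    then show "d * g m = \<delta> * (A w2 * (D1 p w1 * fst m + D2 p w1 * snd m) - A w1 * (D1 p w2 * fst m + D2 p w2 * snd m))"
      by (simp add: \<delta>\<delta>)
    have "\<delta> * (B w2 * (D1 p w1 * fst m + D2 p w1 * snd m) - B w1 * (D1 p w2 * fst m + D2 p w2 * snd m))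
       = (\<delta> * \<delta>) * (d * h m)"
      unfolding eq3[OF w(1) that] eq3[OF w(2) that] d_def by (simp add: algebra_simps)
    then show "d * h m = \<delta> * (B w2 * (D1 p w1 * fst m + D2 p w1 * snd m) - B w1 * (D1 p w2 * fst m + D2 p w2 * snd m))"
      by (simp add: \<delta>\<delta>)
  qed
  have \<delta>0: "\<delta> \<noteq> 0" using \<delta> by auto
  have d: "d \<noteq> 0"
  proof
    assume d0: "d = 0"
    have zero: "a2 = 0 \<and> a1 = 0" if z: "\<And>m. m \<in> ball m0 \<rho> \<Longrightarrow>
        a2 * (D1 p w1 * fst m + D2 p w1 * snd m) - a1 * (D1 p w2 * fst m + D2 p w2 * snd m) = 0" for a1 a2
    proof -
      have "(D1 p w1 * a2 + - D1 p w2 * a1) * fst m + (D2 p w1 * a2 + - D2 p w2 * a1) * snd m = 0"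
        if "m \<in> ball m0 \<rho>" for m
        using z[OF that] by (simp add: algebra_simps)
      note lz = linear_form_zero[OF open_ball m0 this]
      have det': "D1 p w1 * - D2 p w2 - - D1 p w2 * D2 p w1 \<noteq> 0" by (rule det)
      show ?thesis using linear_system_trivial[OF lz det'] by blast
    qed
    have AB: "A w2 = 0 \<and> A w1 = 0" "B w2 = 0 \<and> B w1 = 0"
      using dg dh d0 \<delta>0 by (intro zero; simp)+
    have "D1 p w1 * fst m + D2 p w1 * snd m = 0" if "m \<in> ball m0 \<rho>" for m
      using eq3[OF w(1) that] AB by simp
    from linear_form_zero[OF open_ball m0 this] det show False by simp
  qed
  define a1 where "a1 = \<delta> * (A w2 * D1 p w1 - A w1 * D1 p w2) / d"
  define b1 where "b1 = \<delta> * (A w2 * D2 p w1 - A w1 * D2 p w2) / d"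
  define a2 where "a2 = \<delta> * (B w2 * D1 p w1 - B w1 * D1 p w2) / d"
  define b2 where "b2 = \<delta> * (B w2 * D2 p w1 - B w1 * D2 p w2) / d"
  have g_eq: "g m = a1 * fst m + b1 * snd m" and h_eq: "h m = a2 * fst m + b2 * snd m" if "m \<in> ball m0 \<rho>" for m
  proof -
    have "d * g m = d * (a1 * fst m + b1 * snd m)" "d * h m = d * (a2 * fst m + b2 * snd m)"
      unfolding dg[OF that] dh[OF that] using d
      by (simp_all add: a1_def b1_def a2_def b2_def distrib_left) (simp_all add: algebra_simps)
    then show "g m = a1 * fst m + b1 * snd m" "h m = a2 * fst m + b2 * snd m" using d by simp_all
  qed
  have Dg: "D1 g m = a1" "D2 g m = b1" "D1 h m = a2" "D2 h m = b2" if m: "m \<in> ball m0 \<rho>" for m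
  proof -
    have "dd e g m = dd e (\<lambda>m. a1 * fst m + b1 * snd m) m" "dd e h m = dd e (\<lambda>m. a2 * fst m + b2 * snd m) m" for e
      by (rule dd_cong_open(1)[OF open_ball m g_eq], assumption, rule dd_cong_open(1)[OF open_ball m h_eq])
    then show "D1 g m = a1" "D2 g m = b1" "D1 h m = a2" "D2 h m = b2" by (simp_all add: dd_linear_form)
  qed
  define \<gamma> where "\<gamma> = a1 * b2 - a2 * b1"
  have \<gamma>: "\<gamma> \<noteq> 0" using J[OF m0] by (simp add: jac_def Dg[OF m0] \<gamma>_def mult.commute)
  have Dp: "D1 p w = \<delta> * (a1 * B w - a2 * A w)" "D2 p w = \<delta> * (b1 * B w - b2 * A w)" if w: "w \<in> ball w0 \<rho>" for w
  proof -
    have "(D1 p w - \<delta> * (a1 * B w - a2 * A w)) * fst m + (D2 p w - \<delta> * (b1 * B w - b2 * A w)) * snd m = 0"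
      if "m \<in> ball m0 \<rho>" for m
      using eq3[OF w that] unfolding g_eq[OF that] h_eq[OF that] by (simp add: algebra_simps)
    from linear_form_zero[OF open_ball m0 this]
    show "D1 p w = \<delta> * (a1 * B w - a2 * A w)" "D2 p w = \<delta> * (b1 * B w - b2 * A w)" by simp_all
  qed
  have AB: "A w = \<delta> / \<gamma> * (b1 * D1 p w - a1 * D2 p w)" "B w = \<delta> / \<gamma> * (b2 * D1 p w - a2 * D2 p w)"
    if w: "w \<in> ball w0 \<rho>" for w
  proof -
    have "b1 * D1 p w - a1 * D2 p w = \<delta> * \<gamma> * A w" "b2 * D1 p w - a2 * D2 p w = \<delta> * \<gamma> * B w"
      unfolding Dp[OF w] \<gamma>_def by (simp_all add: algebra_simps)
    then have "\<delta> / \<gamma> * (b1 * D1 p w - a1 * D2 p w) = (\<delta> * \<delta>) * A w"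
      "\<delta> / \<gamma> * (b2 * D1 p w - a2 * D2 p w) = (\<delta> * \<delta>) * B w"
      using \<gamma> by simp_all
    then show "A w = \<delta> / \<gamma> * (b1 * D1 p w - a1 * D2 p w)" "B w = \<delta> / \<gamma> * (b2 * D1 p w - a2 * D2 p w)"
      by (simp_all add: \<delta>\<delta>)
  qed
  have smp: "smooth_on (ball w0 \<rho>) p" using S(5) unfolding pr .
  have dK: "D1 K w = \<delta> / \<gamma> * (c2 * D1 (D1 p) w - c1 * D2 (D1 p) w)"
    "D2 K w = \<delta> / \<gamma> * (c2 * D2 (D1 p) w - c1 * D2 (D2 p) w)"
    if w: "w \<in> ball w0 \<rho>" and K: "\<And>w. w \<in> ball w0 \<rho> \<Longrightarrow> K w = \<delta> / \<gamma> * (c2 * D1 p w - c1 * D2 p w)" for K c1 c2 w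
  proof -
    have d: "D1 p differentiable (at w)" "D2 p differentiable (at w)"
      using smooth_on_imp_differentiable smooth_on_D smp w by blast+
    have "dd e K w = \<delta> / \<gamma> * (c2 * dd e (D1 p) w - c1 * dd e (D2 p) w)" for e
      using dd_cong_open(1)[OF open_ball w K] dd_combination[OF d] by (rule trans)
    then show "D1 K w = \<delta> / \<gamma> * (c2 * D1 (D1 p) w - c1 * D2 (D1 p) w)"
      "D2 K w = \<delta> / \<gamma> * (c2 * D2 (D1 p) w - c1 * D2 (D2 p) w)"
      using mixed_partials_commute[OF open_ball _ smp, of "fst w" "snd w"] w by simp_all
  qed
  define \<alpha> where "\<alpha> = a1\<^sup>2 + a2\<^sup>2"
  define \<beta> where "\<beta> = b1\<^sup>2 + b2\<^sup>2"
  define \<tau> where "\<tau> = a1 * b1 + a2 * b2"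
  note alg = case_ii_algebra[OF \<gamma>_def \<gamma> \<alpha>_def \<beta>_def \<tau>_def]
  have FG: "F (z, z1, y, y1) =
            - (z1 / \<gamma>) * (\<delta> * D2 (D1 p) (z, y) - \<tau> * p (z, y))
            + y1 / \<gamma> * (- \<delta> * D2 (D2 p) (z, y) + \<beta> * p (z, y))
            + \<delta> * \<eta> / \<gamma>\<^sup>2 * (- \<beta> * D1 p (z, y) + \<tau> * D2 p (z, y)) \<and>
          G (z, z1, y, y1) =
            z1 / \<gamma> * (\<delta> * D1 (D1 p) (z, y) - \<alpha> * p (z, y))
            + y1 / \<gamma> * (\<delta> * D2 (D1 p) (z, y) - \<tau> * p (z, y))
            + \<delta> * \<eta> / \<gamma>\<^sup>2 * (\<tau> * D1 p (z, y) - \<alpha> * D2 p (z, y))"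
    if q: "(z, z1, y, y1) \<in> ?S" for z z1 y y1
  proof -
    have w: "(z, y) \<in> ball w0 \<rho>" and m: "(z1, y1) \<in> ball m0 \<rho>" using q by auto
    have dA: "D1 A (z, y) = \<delta> / \<gamma> * (b1 * D1 (D1 p) (z, y) - a1 * D2 (D1 p) (z, y))"
      "D2 A (z, y) = \<delta> / \<gamma> * (b1 * D2 (D1 p) (z, y) - a1 * D2 (D2 p) (z, y))"
      by (rule dK[OF w AB(1)], assumption)+
    have dB: "D1 B (z, y) = \<delta> / \<gamma> * (b2 * D1 (D1 p) (z, y) - a2 * D2 (D1 p) (z, y))"
      "D2 B (z, y) = \<delta> / \<gamma> * (b2 * D2 (D1 p) (z, y) - a2 * D2 (D2 p) (z, y))"
      by (rule dK[OF w AB(2)], assumption)+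
    note e1 = S(12)[OF q, unfolded Dg[OF m] dA AB[OF w] g_eq[OF m] h_eq[OF m] fst_conv snd_conv]
    note e2 = S(13)[OF q, unfolded Dg[OF m] dB AB[OF w] g_eq[OF m] h_eq[OF m] fst_conv snd_conv]
    have det: "a1 * b2 - b1 * a2 \<noteq> 0" using \<gamma> by (simp add: \<gamma>_def mult.commute)
    show ?thesis
      using linear_system_unique[OF e1 e2 alg[of z1 \<delta> "D2 (D1 p) (z, y)" "p (z, y)" y1 "D2 (D2 p) (z, y)" \<eta> "D1 p (z, y)" "D2 p (z, y)" "D1 (D1 p) (z, y)"] det]
      by blast
  qed
  have rest: "f 1 1 (z, z1, y, y1) = a1 * z1 + b1 * y1 \<and>
          f 1 2 (z, z1, y, y1) = \<delta> / \<gamma> * (b1 * D1 p (z, y) - a1 * D2 p (z, y)) \<and>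
          f 2 1 (z, z1, y, y1) = a2 * z1 + b2 * y1 \<and>
          f 2 2 (z, z1, y, y1) = \<delta> / \<gamma> * (b2 * D1 p (z, y) - a2 * D2 p (z, y)) \<and>
          f 3 1 (z, z1, y, y1) = \<eta> \<and> f 3 2 (z, z1, y, y1) = p (z, y)"
    if q: "(z, z1, y, y1) \<in> ?S" for z z1 y y1
  proof -
    have w: "(z, y) \<in> ball w0 \<rho>" and m: "(z1, y1) \<in> ball m0 \<rho>" using q by auto
    show ?thesis
      using S(6-11)[OF q] g_eq[OF m] h_eq[OF m] AB[OF w] unfolding fst_conv snd_conv by (metis (no_types))
  qed
  show ?thesis
    unfolding case_ii_def pr
  proof (rule exI[of _ a1], rule exI[of _ b1], rule exI[of _ a2], rule exI[of _ b2], rule exI[of _ \<gamma>],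
      rule exI[of _ \<alpha>], rule exI[of _ \<beta>], rule exI[of _ \<tau>], rule exI[of _ p],
      intro conjI \<gamma>_def \<gamma> \<alpha>_def \<beta>_def \<tau>_def smp)
    show "\<forall>c1 c2. (\<forall>w\<in>ball w0 \<rho>. c1 * D1 p w + c2 * D2 p w = 0) \<longrightarrow> c1 = 0 \<and> c2 = 0"
      using indep by blast
    show "\<forall>(z, z1, y, y1)\<in>?S. let w = (z, y) in
          F (z, z1, y, y1) =
            - (z1 / \<gamma>) * (\<delta> * D2 (D1 p) w - \<tau> * p w)
            + y1 / \<gamma> * (- \<delta> * D2 (D2 p) w + \<beta> * p w)
            + \<delta> * \<eta> / \<gamma>\<^sup>2 * (- \<beta> * D1 p w + \<tau> * D2 p w) \<and>
          G (z, z1, y, y1) =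
            z1 / \<gamma> * (\<delta> * D1 (D1 p) w - \<alpha> * p w)
            + y1 / \<gamma> * (\<delta> * D2 (D1 p) w - \<tau> * p w)
            + \<delta> * \<eta> / \<gamma>\<^sup>2 * (\<tau> * D1 p w - \<alpha> * D2 p w) \<and>
          f 1 1 (z, z1, y, y1) = a1 * z1 + b1 * y1 \<and>
          f 1 2 (z, z1, y, y1) = \<delta> / \<gamma> * (b1 * D1 p w - a1 * D2 p w) \<and>
          f 2 1 (z, z1, y, y1) = a2 * z1 + b2 * y1 \<and>
          f 2 2 (z, z1, y, y1) = \<delta> / \<gamma> * (b2 * D1 p w - a2 * D2 p w) \<and>
          f 3 1 (z, z1, y, y1) = \<eta> \<and> f 3 2 (z, z1, y, y1) = p w"
      unfolding Let_def using FG rest by blast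
  qed
qed

lemma constant_along_direction:
  fixes p :: "real \<times> real \<Rightarrow> real"
  assumes "convex S" "P \<in> S" "P + s *\<^sub>R c \<in> S" "smooth_on S p"
    and "\<And>w. w \<in> S \<Longrightarrow> fst c * D1 p w + snd c * D2 p w = 0"
  shows "p (P + s *\<^sub>R c) = p P"
proof -
  have "(\<lambda>\<tau>. p (P + \<tau> *\<^sub>R c)) s - (\<lambda>\<tau>. p (P + \<tau> *\<^sub>R c)) 0
      = (s - 0) * integral {0..1} (\<lambda>\<theta>. (\<lambda>_. 0) (0 + \<theta> * (s - 0)))"
  proof (rule diff_eq_theta_integral)
    fix \<theta> :: real assume th: "\<theta> \<in> {0..1}"
    let ?\<tau> = "0 + \<theta> * (s - 0)"
    have in_S: "P + ?\<tau> *\<^sub>R c \<in> S"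
      using segment_in_convex[OF assms(1-3) th] by simp
    have "((\<lambda>\<tau>. P + \<tau> *\<^sub>R c) has_derivative (\<lambda>h. h *\<^sub>R c)) (at ?\<tau>)"
      by (auto intro!: derivative_eq_intros)
    from has_derivative_compose[OF this has_derivative_D1_D2[OF smooth_on_imp_differentiable[OF assms(4) in_S]]]
    have "((\<lambda>\<tau>. p (P + \<tau> *\<^sub>R c)) has_derivative
        (\<lambda>h. h * (fst c * D1 p (P + ?\<tau> *\<^sub>R c) + snd c * D2 p (P + ?\<tau> *\<^sub>R c)))) (at ?\<tau>)"
      by (simp add: algebra_simps)
    then show "((\<lambda>\<tau>. p (P + \<tau> *\<^sub>R c)) has_real_derivative (\<lambda>_. 0) ?\<tau>) (at ?\<tau>)"
      unfolding assms(5)[OF in_S] has_field_derivative_def by (rule has_derivative_eq_rhs) auto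
  qed
  then show ?thesis by simp
qed

text \<open>After normalising the relation between \<open>p_z\<close> and \<open>p_y\<close>, \<open>p\<close> is a function \<open>\<phi>\<close> of the
Euclidean coordinate \<open>\<xi> = a y + b z\<close> with \<open>a^2 + b^2 = 1\<close>. The domain is then shrunk to a product of
discs on which \<open>\<phi>'\<close> keeps the sign that it has at the given point with \<open>\<Delta> \<noteq> 0\<close>.\<close>

lemma separated_case_i:
  assumes \<delta>: "\<delta> = 1 \<or> \<delta> = -1" and \<rho>: "\<rho> > 0"
    and sep: "separated \<delta> \<eta> F G f (bi_ball w0 m0 \<rho>) g h A B p"
    and J: "\<And>m. m \<in> ball m0 \<rho> \<Longrightarrow> jac g h m \<noteq> 0"
    and c: "c1 \<noteq> 0 \<or> c2 \<noteq> 0" and dep: "\<And>w. w \<in> ball w0 \<rho> \<Longrightarrow> c1 * D1 p w + c2 * D2 p w = 0"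
    and qs: "(zs, z1s, ys, y1s) \<in> bi_ball w0 m0 \<rho>"
    and \<Delta>: "g (z1s, y1s) * B (zs, ys) - A (zs, ys) * h (z1s, y1s) \<noteq> 0"
  shows "\<exists>V. domain4 V \<and> V \<subseteq> bi_ball w0 m0 \<rho> \<and> case_i \<delta> \<eta> F G f V"
proof -
  let ?S = "bi_ball w0 m0 \<rho>" and ?W = "ball w0 \<rho>"
  note pr = bi_ball_projections[OF \<rho>, of w0 m0]
  have \<delta>\<delta>: "\<delta> * \<delta> = 1" using \<delta> by auto
  have smp: "smooth_on ?W p" using separatedD(5)[OF sep] unfolding pr .
  define n where "n = sqrt (c1\<^sup>2 + c2\<^sup>2)"
  have n: "n > 0" "n\<^sup>2 = c1\<^sup>2 + c2\<^sup>2" using c by (auto simp: n_def sum_power2_gt_zero_iff)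
  define a where "a = - c1 / n"
  define b where "b = c2 / n"
  have ab: "a\<^sup>2 + b\<^sup>2 = 1"
  proof -
    have "a\<^sup>2 + b\<^sup>2 = (c1\<^sup>2 + c2\<^sup>2) / n\<^sup>2" by (simp add: a_def b_def power_divide add_divide_distrib)
    then show ?thesis using n(1) unfolding n(2)[symmetric] by simp
  qed
  have dir: "- a * D1 p w + b * D2 p w = 0" if "w \<in> ?W" for w
  proof -
    have "- a * D1 p w + b * D2 p w = (c1 * D1 p w + c2 * D2 p w) / n"
      by (simp add: a_def b_def add_divide_distrib)
    then show ?thesis using dep[OF that] by simp
  qed
  define \<xi> where "\<xi> w = a * snd w + b * fst w" for w :: "real \<times> real"
  \<comment> \<open>\<open>P s\<close> is the point with \<open>\<xi> = s\<close> on the diameter of the disc in direction \<open>(b, a)\<close>.\<close>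
  define P where "P s = (fst w0 + (s - \<xi> w0) * b, snd w0 + (s - \<xi> w0) * a)" for s
  define \<phi> where "\<phi> s = p (P s)" for s
  define \<Xi> where "\<Xi> = {\<xi> w0 - \<rho><..<\<xi> w0 + \<rho>}"
  have op\<Xi>: "open \<Xi>" by (simp add: \<Xi>_def)
  have P_in: "P s \<in> ?W" if "s \<in> \<Xi>" for s
  proof -
    have "P s - w0 = (s - \<xi> w0) *\<^sub>R (b, a)" by (simp add: P_def prod_eq_iff)
    then have "norm (P s - w0) = \<bar>s - \<xi> w0\<bar> * norm (b, a)" by (simp only: norm_scaleR)
    moreover have "norm (b, a) = 1" using ab by (simp add: norm_Pair add.commute)
    ultimately have "norm (P s - w0) = \<bar>s - \<xi> w0\<bar>" by simp
    then show ?thesis using that by (simp add: \<Xi>_def dist_norm norm_minus_commute abs_less_iff)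
  qed
  have \<xi>_in: "\<xi> w \<in> \<Xi>" if "w \<in> ?W" for w
  proof -
    have "\<xi> w - \<xi> w0 = (w - w0) \<bullet> (b, a)" by (simp add: \<xi>_def inner_prod_def algebra_simps)
    moreover have "norm (b, a) = 1" using ab by (simp add: norm_Pair add.commute)
    ultimately have "\<bar>\<xi> w - \<xi> w0\<bar> \<le> norm (w - w0)"
      using Cauchy_Schwarz_ineq2[of "w - w0" "(b, a)"] by simp
    then show ?thesis using that by (simp add: \<Xi>_def dist_norm norm_minus_commute abs_le_iff abs_less_iff)
  qed
  have sm\<phi>: "smooth_on \<Xi> \<phi>"
    unfolding \<phi>_def[abs_def] P_def
  proof (rule smooth_on_compose2[OF op\<Xi> _ smp])
    show "(fst w0 + (s - \<xi> w0) * b, snd w0 + (s - \<xi> w0) * a) \<in> ?W" if "s \<in> \<Xi>" for s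
      using P_in[OF that] by (simp add: P_def)
    have id: "smooth_on \<Xi> (\<lambda>s :: real. s)" by (rule smooth_on_linear) (rule linearI; simp)
    show "smooth_on \<Xi> (\<lambda>s. fst w0 + (s - \<xi> w0) * b)" "smooth_on \<Xi> (\<lambda>s. snd w0 + (s - \<xi> w0) * a)"
      by (intro smooth_on_add smooth_on_mult smooth_on_diff op\<Xi> smooth_on_const id)+
  qed
  have sm\<phi>1: "smooth_on \<Xi> (deriv \<phi>)" by (rule smooth_on_deriv[OF op\<Xi> sm\<phi>])
  have p_eq: "p w = \<phi> (\<xi> w)" if w: "w \<in> ?W" for w
  proof -
    let ?s = "b * (snd w - snd w0) - a * (fst w - fst w0)"
    have "fst w - fst w0 - (\<xi> w - \<xi> w0) * b = (a\<^sup>2 + b\<^sup>2) * (fst w - fst w0) - (\<xi> w - \<xi> w0) * b"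
      "snd w - snd w0 - (\<xi> w - \<xi> w0) * a = (a\<^sup>2 + b\<^sup>2) * (snd w - snd w0) - (\<xi> w - \<xi> w0) * a"
      by (simp_all add: ab)
    then have "w = P (\<xi> w) + ?s *\<^sub>R (- a, b)"
      by (simp add: prod_eq_iff P_def \<xi>_def algebra_simps power2_eq_square)
    moreover have "p (P (\<xi> w) + ?s *\<^sub>R (- a, b)) = p (P (\<xi> w))"
      by (rule constant_along_direction[OF convex_ball P_in[OF \<xi>_in[OF w]] _ smp])
        (use dir w calculation in auto)
    ultimately show ?thesis by (simp add: \<phi>_def)
  qed
  have d\<xi>: "D1 (\<lambda>w. k (\<xi> w)) w = b * deriv k (\<xi> w)" "D2 (\<lambda>w. k (\<xi> w)) w = a * deriv k (\<xi> w)"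
    "(\<lambda>w. k (\<xi> w)) differentiable (at w)"
    if "smooth_on \<Xi> k" "w \<in> ?W" for k w
  proof -
    have "k differentiable (at (a * snd w + b * fst w))"
      using smooth_on_imp_differentiable[OF that(1) \<xi>_in[OF that(2)]] by (simp add: \<xi>_def)
    from dd_along_xi[OF this]
    show "D1 (\<lambda>w. k (\<xi> w)) w = b * deriv k (\<xi> w)" "D2 (\<lambda>w. k (\<xi> w)) w = a * deriv k (\<xi> w)"
      "(\<lambda>w. k (\<xi> w)) differentiable (at w)"
      unfolding \<xi>_def by (auto intro: differentiableI)
  qed
  have Dp: "D1 p w = b * deriv \<phi> (\<xi> w)" "D2 p w = a * deriv \<phi> (\<xi> w)" if w: "w \<in> ?W" for w
  proof -
    have "dd e p w = dd e (\<lambda>w. \<phi> (\<xi> w)) w" for e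
      by (rule dd_cong_open(1)[OF open_ball w p_eq])
    then show "D1 p w = b * deriv \<phi> (\<xi> w)" "D2 p w = a * deriv \<phi> (\<xi> w)" by (simp_all add: d\<xi>[OF sm\<phi> w])
  qed
  have eq3: "deriv \<phi> (\<xi> w) * (b * fst m + a * snd m) = \<delta> * (g m * B w - A w * h m)"
    if "w \<in> ?W" "m \<in> ball m0 \<rho>" for w m
    using separatedD(14)[OF sep, of "fst w" "fst m" "snd w" "snd m"] that Dp[OF that(1)]
    by (simp add: algebra_simps)
  define ws where "ws = (zs, ys)"
  define ms where "ms = (z1s, y1s)"
  define \<phi>s where "\<phi>s = deriv \<phi> (\<xi> ws)"
  have ws: "ws \<in> ?W" and ms: "ms \<in> ball m0 \<rho>" using qs by (auto simp: ws_def ms_def)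
  have \<phi>s: "\<phi>s \<noteq> 0"
  proof
    assume "\<phi>s = 0"
    then have "\<delta> * (g ms * B ws - A ws * h ms) = 0"
      using eq3[OF ws ms] by (simp add: \<phi>s_def)
    then show False using \<Delta> \<delta> by (auto simp: ws_def ms_def)
  qed
  \<comment> \<open>Positivity of \<open>k\<close> says that \<open>\<phi>'\<close> has the same sign as at the given point.\<close>
  define k where "k = lift_w (\<lambda>w. deriv \<phi> (\<xi> w) * \<phi>s)"
  have "continuous_on ?S k"
  proof -
    have "smooth_on ?W (\<lambda>w. deriv \<phi> (\<xi> w))"
      unfolding \<xi>_def by (rule smooth_on_along_xi[OF open_ball sm\<phi>1]) (use \<xi>_in in \<open>auto simp: \<xi>_def\<close>)
    then have "smooth_on (proj_zy ?S) (\<lambda>w. deriv \<phi> (\<xi> w) * \<phi>s)"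
      unfolding pr by (intro smooth_on_mult open_ball smooth_on_const)
    from smooth_on_lift_w[OF open_bi_ball this] show ?thesis
      unfolding k_def by (rule Ck_on_imp_continuous[OF smooth_onD])
  qed
  moreover have "k (zs, z1s, ys, y1s) > 0"
  proof -
    have "k (zs, z1s, ys, y1s) = \<phi>s * \<phi>s" by (simp add: k_def \<phi>s_def ws_def)
    then show ?thesis using \<phi>s not_real_square_gt_zero[of \<phi>s] by metis
  qed
  ultimately obtain \<rho>' where \<rho>': "\<rho>' > 0" "bi_ball ws ms \<rho>' \<subseteq> ?S"
    and kpos: "\<And>q. q \<in> bi_ball ws ms \<rho>' \<Longrightarrow> k q > 0"
    unfolding ws_def ms_def using bi_ball_where_positive[OF open_bi_ball _ qs] by metis
  let ?V = "bi_ball ws ms \<rho>'"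
  note pr' = bi_ball_projections[OF \<rho>'(1), of ws ms]
  have cen: "ws \<in> ball ws \<rho>'" "ms \<in> ball ms \<rho>'" using \<rho>'(1) by simp_all
  have subW: "w \<in> ?W" if "w \<in> ball ws \<rho>'" for w
    using subsetD[OF \<rho>'(2), of "(fst w, fst ms, snd w, snd ms)"] that cen by simp
  have subM: "m \<in> ball m0 \<rho>" if "m \<in> ball ms \<rho>'" for m
    using subsetD[OF \<rho>'(2), of "(fst ws, fst m, snd ws, snd m)"] that cen by simp
  have \<phi>pos: "deriv \<phi> (\<xi> w) * \<phi>s > 0" if "w \<in> ball ws \<rho>'" for w
    using kpos[of "(fst w, fst ms, snd w, snd ms)"] that cen by (simp add: k_def)
  note S = separatedD[OF separated_subset[OF sep \<rho>'(2)]]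
  have smg: "smooth_on (ball ms \<rho>') g" "smooth_on (ball ms \<rho>') h" using S(1,2) unfolding pr' .
  have gd: "g differentiable (at m)" "h differentiable (at m)" if "m \<in> ball ms \<rho>'" for m
    using smooth_on_imp_differentiable smg that by blast+
  define \<mu> where "\<mu> = B ws / \<phi>s"
  define lam where "lam = A ws / \<phi>s"
  have rel: "\<mu> * g m - lam * h m = \<delta> * (b * fst m + a * snd m)" if "m \<in> ball ms \<rho>'" for m
  proof -
    have "\<delta> * (\<phi>s * (b * fst m + a * snd m)) = (\<delta> * \<delta>) * (g m * B ws - A ws * h m)"
      using eq3[OF ws subM[OF that]] by (simp add: \<phi>s_def)
    then have "\<phi>s * (\<delta> * (b * fst m + a * snd m)) = g m * B ws - A ws * h m" by (simp add: \<delta>\<delta> mult.left_commute)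
    then show ?thesis using \<phi>s by (simp add: \<mu>_def lam_def field_simps)
  qed
  have rel': "\<mu> * g (z1, y1) - lam * h (z1, y1) = \<delta> * a * y1 + \<delta> * b * z1" if "(z1, y1) \<in> ball ms \<rho>'" for z1 y1
    using rel[OF that] by (simp add: algebra_simps)
  have lam\<mu>: "lam\<^sup>2 + \<mu>\<^sup>2 \<noteq> 0"
  proof
    assume "lam\<^sup>2 + \<mu>\<^sup>2 = 0"
    then have "lam = 0" "\<mu> = 0" by (simp_all add: sum_power2_eq_zero_iff)
    then have "b * fst m + a * snd m = 0" if "m \<in> ball ms \<rho>'" for m using rel[OF that] \<delta> by auto
    from linear_form_zero[OF open_ball cen(2) this] ab show False by simp
  qed
  have AB: "A w = lam * deriv \<phi> (\<xi> w)" "B w = \<mu> * deriv \<phi> (\<xi> w)" if w: "w \<in> ball ws \<rho>'" for w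
  proof -
    let ?f = "deriv \<phi> (\<xi> w)"
    let ?x = "B w - \<mu> * ?f" and ?y = "A w - lam * ?f"
    have z: "g m * ?x + - h m * ?y = 0" if m: "m \<in> ball ms \<rho>'" for m
    proof -
      have "g m * B w - A w * h m = (\<delta> * \<delta>) * (g m * B w - A w * h m)" by (simp add: \<delta>\<delta>)
      also have "\<dots> = \<delta> * (?f * (b * fst m + a * snd m))" using eq3[OF subW[OF w] subM[OF m]] by simp
      also have "\<dots> = ?f * (\<mu> * g m - lam * h m)" unfolding rel[OF m] by simp
      finally show ?thesis by (simp add: algebra_simps)
    qed
    have "1 * (?x * dd e g ms - ?y * dd e h ms) = 0" for e
    proof -
      have "dd e (\<lambda>m. 1 * (?x * g m - ?y * h m)) ms = dd e (\<lambda>_. 0) ms"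
        by (rule dd_cong_open(1)[OF open_ball cen(2)]) (use z in \<open>simp add: mult.commute\<close>)
      then show ?thesis unfolding dd_combination[OF gd[OF cen(2)]] dd_const .
    qed
    then have "dd e g ms * ?x + - dd e h ms * ?y = 0" for e
      by (simp add: mult.commute)
    note e12 = this[of "(1, 0)"] this[of "(0, 1)"]
    have "D1 g ms * - D2 h ms - - D1 h ms * D2 g ms \<noteq> 0"
      using J[OF subM[OF cen(2)]] by (simp add: jac_def mult.commute)
    from linear_system_trivial[OF e12 this]
    show "A w = lam * deriv \<phi> (\<xi> w)" "B w = \<mu> * deriv \<phi> (\<xi> w)" by simp_all
  qed
  have dAB: "D1 A w = lam * (b * deriv (deriv \<phi>) (\<xi> w))" "D2 A w = lam * (a * deriv (deriv \<phi>) (\<xi> w))"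
    "D1 B w = \<mu> * (b * deriv (deriv \<phi>) (\<xi> w))" "D2 B w = \<mu> * (a * deriv (deriv \<phi>) (\<xi> w))"
    if w: "w \<in> ball ws \<rho>'" for w
  proof -
    have "dd e A w = dd e (\<lambda>w. lam * deriv \<phi> (\<xi> w)) w" "dd e B w = dd e (\<lambda>w. \<mu> * deriv \<phi> (\<xi> w)) w" for e
      by (rule dd_cong_open(1)[OF open_ball w AB(1)], assumption, rule dd_cong_open(1)[OF open_ball w AB(2)])
    then show "D1 A w = lam * (b * deriv (deriv \<phi>) (\<xi> w))" "D2 A w = lam * (a * deriv (deriv \<phi>) (\<xi> w))"
      "D1 B w = \<mu> * (b * deriv (deriv \<phi>) (\<xi> w))" "D2 B w = \<mu> * (a * deriv (deriv \<phi>) (\<xi> w))"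
      by (simp_all add: dd_cmult d\<xi>[OF sm\<phi>1 subW[OF w]])
  qed
  have xr: "xi_range a b ?V = \<xi> ` ball ws \<rho>'"
  proof -
    have "xi_range a b ?V = \<xi> ` proj_zy ?V"
      by (force simp: xi_range_def proj_zy_def \<xi>_def image_image split_def)
    then show ?thesis by (simp only: pr')
  qed
  have sub\<Xi>: "xi_range a b ?V \<subseteq> \<Xi>" unfolding xr using \<xi>_in subW by blast
  have xcv: "is_interval (xi_range a b ?V)"
    unfolding xr is_interval_convex_1 \<xi>_def
    by (intro convex_linear_image linearI convex_ball) (auto simp: algebra_simps)
  have mono: "(\<phi> t - \<phi> s) * \<phi>s > 0" if st: "s \<in> xi_range a b ?V" "t \<in> xi_range a b ?V" "s < t" for s t
  proof -
    have "\<phi> s * \<phi>s < \<phi> t * \<phi>s"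
    proof (rule DERIV_pos_imp_increasing[OF st(3)])
      fix x assume "s \<le> x" "x \<le> t"
      then have x: "x \<in> xi_range a b ?V" using xcv st(1,2) mem_is_interval_1_I by blast
      then obtain w where w: "w \<in> ball ws \<rho>'" "x = \<xi> w" unfolding xr by blast
      have "(\<phi> has_real_derivative deriv \<phi> x) (at x)"
        using smooth_on_imp_differentiable[OF sm\<phi>] x sub\<Xi> by (auto simp: DERIV_deriv_iff_real_differentiable)
      then have "((\<lambda>x. \<phi> x * \<phi>s) has_real_derivative deriv \<phi> x * \<phi>s) (at x)"
        by (rule DERIV_cmult_right)
      then show "\<exists>D. ((\<lambda>x. \<phi> x * \<phi>s) has_real_derivative D) (at x) \<and> 0 < D"
        using \<phi>pos[OF w(1)] w(2) by blast
    qed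
    then show ?thesis by (simp add: algebra_simps)
  qed
  have monotone: "strict_mono_on (xi_range a b ?V) \<phi> \<or> strict_antimono_on (xi_range a b ?V) \<phi>"
  proof (cases "\<phi>s > 0")
    case True
    then have "\<phi> s < \<phi> t" if "s \<in> xi_range a b ?V" "t \<in> xi_range a b ?V" "s < t" for s t
      using mono[OF that] by (simp add: zero_less_mult_iff)
    then show ?thesis by (auto intro!: monotone_onI)
  next
    case False
    then have "\<phi> t < \<phi> s" if "s \<in> xi_range a b ?V" "t \<in> xi_range a b ?V" "s < t" for s t
      using mono[OF that] by (simp add: zero_less_mult_iff)
    then show ?thesis by (auto intro!: monotone_onI)
  qed
  have body: "F (z, z1, y, y1) = 1 / jac g h (z1, y1) *
            (- \<delta> * a * (b * z1 + a * y1) * deriv (deriv \<phi>) (a * y + b * z)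
             - \<eta> * (\<mu> * D2 h (z1, y1) + lam * D2 g (z1, y1)) * deriv \<phi> (a * y + b * z)
             + 1 / 2 * D2 (\<lambda>w. (g w)\<^sup>2 + (h w)\<^sup>2) (z1, y1) * \<phi> (a * y + b * z)) \<and>
          G (z, z1, y, y1) = 1 / jac g h (z1, y1) *
            (\<delta> * b * (b * z1 + a * y1) * deriv (deriv \<phi>) (a * y + b * z)
             + \<eta> * (\<mu> * D1 h (z1, y1) + lam * D1 g (z1, y1)) * deriv \<phi> (a * y + b * z)
             - 1 / 2 * D1 (\<lambda>w. (g w)\<^sup>2 + (h w)\<^sup>2) (z1, y1) * \<phi> (a * y + b * z)) \<and>
          f 1 1 (z, z1, y, y1) = g (z1, y1) \<and> f 1 2 (z, z1, y, y1) = lam * deriv \<phi> (a * y + b * z) \<and>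
          f 2 1 (z, z1, y, y1) = h (z1, y1) \<and> f 2 2 (z, z1, y, y1) = \<mu> * deriv \<phi> (a * y + b * z) \<and>
          f 3 1 (z, z1, y, y1) = \<eta> \<and> f 3 2 (z, z1, y, y1) = \<phi> (a * y + b * z)"
    if q: "(z, z1, y, y1) \<in> ?V" for z z1 y y1
  proof -
    let ?m = "(z1, y1)" and ?\<xi> = "a * y + b * z"
    have w: "(z, y) \<in> ball ws \<rho>'" and m: "?m \<in> ball ms \<rho>'" using q by auto
    have \<xi>: "\<xi> (z, y) = ?\<xi>" by (simp add: \<xi>_def)
    note e1 = S(12)[OF q, unfolded dAB[OF w] AB[OF w] p_eq[OF subW[OF w]] \<xi>]
    note e2 = S(13)[OF q, unfolded dAB[OF w] AB[OF w] p_eq[OF subW[OF w]] \<xi>]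
    have R: "\<mu> * D1 g ?m - lam * D1 h ?m = \<delta> * b" "\<mu> * D2 g ?m - lam * D2 h ?m = \<delta> * a"
      by (rule dd_linear_relation[OF open_ball m gd[OF m] rel'], assumption)+
    note alg = case_i_algebra[of "jac g h ?m" "D1 g ?m" "D2 h ?m" "D2 g ?m" "D1 h ?m" \<mu> lam \<delta> b a
        z1 y1 "deriv (deriv \<phi>) ?\<xi>" \<eta> "deriv \<phi> ?\<xi>" "g ?m" "h ?m" "\<phi> ?\<xi>",
        OF _ J[OF subM[OF m]] R]
    have jd: "jac g h ?m = D1 g ?m * D2 h ?m - D2 g ?m * D1 h ?m" by (simp add: jac_def)
    have det: "D1 g ?m * D2 h ?m - D2 g ?m * D1 h ?m \<noteq> 0" using J[OF subM[OF m]] by (simp add: jac_def)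
    note FG = linear_system_unique[OF e1 e2 alg(1)[OF jd] alg(2)[OF jd] det]
    show ?thesis
      unfolding dd_sum_of_squares[OF gd[OF m]]
      using FG S(6-11)[OF q] AB[OF w] p_eq[OF subW[OF w]] by (simp only: \<xi>)
  qed
  have "case_i \<delta> \<eta> F G f ?V"
    unfolding case_i_def pr'
  proof (rule exI[of _ a], rule exI[of _ b], rule exI[of _ lam], rule exI[of _ \<mu>], rule exI[of _ g],
      rule exI[of _ h], rule exI[of _ \<phi>], intro conjI lam\<mu> smg monotone)
    show "\<forall>(z1, y1)\<in>ball ms \<rho>'. \<mu> * g (z1, y1) - lam * h (z1, y1) = \<delta> * a * y1 + \<delta> * b * z1 \<and> jac g h (z1, y1) \<noteq> 0"
      using rel' J subM by blast
    show "smooth_on (xi_range a b ?V) \<phi>" by (rule smooth_on_subset[OF sm\<phi> sub\<Xi>])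
    show "a\<^sup>2 + b\<^sup>2 \<noteq> 0" using ab by simp
    show "\<forall>(z, z1, y, y1)\<in>?V. let \<xi> = a * y + b * z; w = (z1, y1); W = jac g h w in
          F (z, z1, y, y1) = 1 / W *
            (- \<delta> * a * (b * z1 + a * y1) * deriv (deriv \<phi>) \<xi>
             - \<eta> * (\<mu> * D2 h w + lam * D2 g w) * deriv \<phi> \<xi>
             + 1 / 2 * D2 (\<lambda>w. (g w)\<^sup>2 + (h w)\<^sup>2) w * \<phi> \<xi>) \<and>
          G (z, z1, y, y1) = 1 / W *
            (\<delta> * b * (b * z1 + a * y1) * deriv (deriv \<phi>) \<xi>
             + \<eta> * (\<mu> * D1 h w + lam * D1 g w) * deriv \<phi> \<xi>
             - 1 / 2 * D1 (\<lambda>w. (g w)\<^sup>2 + (h w)\<^sup>2) w * \<phi> \<xi>) \<and>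
          f 1 1 (z, z1, y, y1) = g w \<and> f 1 2 (z, z1, y, y1) = lam * deriv \<phi> \<xi> \<and>
          f 2 1 (z, z1, y, y1) = h w \<and> f 2 2 (z, z1, y, y1) = \<mu> * deriv \<phi> \<xi> \<and>
          f 3 1 (z, z1, y, y1) = \<eta> \<and> f 3 2 (z, z1, y, y1) = \<phi> \<xi>"
      unfolding Let_def using body by blast
  qed
  with domain4_bi_ball[OF \<rho>'(1)] \<rho>'(2) show ?thesis by blast
qed

lemma describes_surfaces_locally_case:
  assumes \<delta>: "\<delta> = 1 \<or> \<delta> = -1" and V: "domain4 V" and FG: "smooth_on V F" "smooth_on V G"
    and ds: "describes_surfaces \<delta> F G f V" and eta: "\<forall>q\<in>V. f 3 1 q = \<eta>"
  shows "\<exists>V'. domain4 V' \<and> V' \<subseteq> V \<and> (case_i \<delta> \<eta> F G f V' \<or> case_ii \<delta> \<eta> F G f V')"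
proof -
  have op: "open V" and ne: "V \<noteq> {}" using V by (auto simp: domain4_def)
  obtain z z1 y y1 where q: "(z, z1, y, y1) \<in> V" using ne by (metis ex_in_conv prod.exhaust)
  obtain r where r: "r > 0" "bi_ball (z, y) (z1, y1) r \<subseteq> V" by (rule bi_ball_in_open[OF op q])
  let ?S = "bi_ball (z, y) (z1, y1) r"
  obtain g h A B p where sep: "separated \<delta> \<eta> F G f ?S g h A B p"
    using describes_surfaces_separated[OF r op FG ds eta] by blast
  have ne': "?S \<noteq> {}" using domain4_bi_ball[OF r(1)] by (simp add: domain4_def)
  obtain zs z1s ys y1s where qs: "(zs, z1s, ys, y1s) \<in> ?S" and J0: "jac g h (z1s, y1s) \<noteq> 0"
    using jacobian_nonzero_somewhere[OF open_bi_ball ne' smooth_on_subset[OF FG(1) r(2)]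
        smooth_on_subset[OF FG(2) r(2)] describes_surfaces_subset[OF ds r(2)] sep] by blast
  have smJ: "smooth_on (proj_z1y1 ?S) (\<lambda>m. jac g h m * jac g h m)"
    unfolding jac_def using separatedD(1,2)[OF sep]
    by (intro smooth_on_mult smooth_on_diff smooth_on_D open_projections open_bi_ball)
  obtain \<rho> where \<rho>: "\<rho> > 0" "bi_ball (zs, ys) (z1s, y1s) \<rho> \<subseteq> ?S"
    and Jpos: "\<And>q. q \<in> bi_ball (zs, ys) (z1s, y1s) \<rho> \<Longrightarrow> lift_m (\<lambda>m. jac g h m * jac g h m) q > 0"
    using bi_ball_where_positive[OF open_bi_ball
        Ck_on_imp_continuous[OF smooth_onD[OF smooth_on_lift_m[OF open_bi_ball smJ], of 0]] qs] J0
    by (metis lift_simps(1) not_real_square_gt_zero)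
  let ?B = "bi_ball (zs, ys) (z1s, y1s) \<rho>"
  have J: "jac g h m \<noteq> 0" if "m \<in> ball (z1s, y1s) \<rho>" for m
    using Jpos[of "(zs, fst m, ys, snd m)"] that \<rho>(1) by auto
  have sepB: "separated \<delta> \<eta> F G f ?B g h A B p" by (rule separated_subset[OF sep \<rho>(2)])
  have BV: "?B \<subseteq> V" using \<rho>(2) r(2) by blast
  have domB: "domain4 ?B" by (rule domain4_bi_ball[OF \<rho>(1)])
  show ?thesis
  proof (cases "\<forall>c1 c2. (\<forall>w\<in>ball (zs, ys) \<rho>. c1 * D1 p w + c2 * D2 p w = 0) \<longrightarrow> c1 = 0 \<and> c2 = 0")
    case True
    then have "case_ii \<delta> \<eta> F G f ?B"
      by (intro separated_case_ii[OF \<delta> \<rho>(1) sepB J]) blast+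
    with domB BV show ?thesis by blast
  next
    case False
    then obtain c1 c2 where c: "c1 \<noteq> 0 \<or> c2 \<noteq> 0"
      and dep: "\<And>w. w \<in> ball (zs, ys) \<rho> \<Longrightarrow> c1 * D1 p w + c2 * D2 p w = 0" by blast
    have "\<not> negligible ?B" using open_not_negligible[OF open_bi_ball] domB by (simp add: domain4_def)
    moreover have "negligible {q\<in>?B. f 1 1 q * f 2 2 q - f 1 2 q * f 2 1 q = 0}"
      using describes_surfaces_subset[OF ds BV] by (simp add: describes_surfaces_def)
    ultimately obtain q where q: "q \<in> ?B" "f 1 1 q * f 2 2 q - f 1 2 q * f 2 1 q \<noteq> 0"
      using negligible_subset[of "{q\<in>?B. f 1 1 q * f 2 2 q - f 1 2 q * f 2 1 q = 0}" ?B] by blast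
    obtain za z1a ya y1a where qa: "q = (za, z1a, ya, y1a)" by (cases q)
    have \<Delta>: "g (z1a, y1a) * B (za, ya) - A (za, ya) * h (z1a, y1a) \<noteq> 0"
      using q(2) separatedD(6-9)[OF sepB q(1)[unfolded qa]] unfolding qa by simp
    from separated_case_i[OF \<delta> \<rho>(1) sepB J c dep q(1)[unfolded qa] \<Delta>]
    show ?thesis using BV by blast
  qed
qed

lemma case_describes_surfaces:
  assumes \<delta>: "\<delta> = 1 \<or> \<delta> = -1" and V: "open V" and FG: "smooth_on V F" "smooth_on V G"
    and nd: "nondegenerate_on V F G" and c: "case_i \<delta> \<eta> F G f V \<or> case_ii \<delta> \<eta> F G f V"
  shows "describes_surfaces \<delta> F G f V \<and> (\<forall>q\<in>V. f 3 1 q = \<eta>)"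
proof -
  obtain g h A B p where "separated \<delta> \<eta> F G f V g h A B p"
    and "\<And>z1 y1. (z1, y1) \<in> proj_z1y1 V \<Longrightarrow> jac g h (z1, y1) \<noteq> 0"
    using c case_i_separated[OF \<delta> V] case_ii_separated[OF \<delta> V] by metis
  from separated_describes_surfaces[OF V this FG nd] show ?thesis by blast
qed

theorem theorem3p11:
  fixes \<delta> \<eta> :: real
    and U :: "jet set"
    and F G :: "jet \<Rightarrow> real"
    and f :: "nat \<Rightarrow> nat \<Rightarrow> jet \<Rightarrow> real"
  assumes "\<delta> = 1 \<or> \<delta> = -1"
    and "domain4 U"
    and "smooth_on U F" and "smooth_on U G"
    and "nondegenerate_on U F G"
  shows "(generically_locally U
            (\<lambda>V. describes_surfaces \<delta> F G f V \<and> (\<forall>q\<in>V. f 3 1 q = \<eta>))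
          \<longleftrightarrow> generically_locally U
            (\<lambda>V. case_i \<delta> \<eta> F G f V \<or> case_ii \<delta> \<eta> F G f V))
       \<and> (case_i \<delta> \<eta> F G f U \<or> case_ii \<delta> \<eta> F G f U
            \<longrightarrow> describes_surfaces \<delta> F G f U \<and> (\<forall>q\<in>U. f 3 1 q = \<eta>))"
proof (intro conjI iffI impI)
  have sub: "smooth_on V F" "smooth_on V G" "nondegenerate_on V F G" if "V \<subseteq> U" for V
  proof -
    show "smooth_on V F" "smooth_on V G" using assms(3,4) smooth_on_subset that by blast+
    show "nondegenerate_on V F G"
      unfolding nondegenerate_on_def
      by (rule negligible_subset[OF assms(5)[unfolded nondegenerate_on_def]]) (use that in auto)
  qed
  have cds: "describes_surfaces \<delta> F G f V \<and> (\<forall>q\<in>V. f 3 1 q = \<eta>)"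
    if "domain4 V" "V \<subseteq> U" "case_i \<delta> \<eta> F G f V \<or> case_ii \<delta> \<eta> F G f V" for V
    by (rule case_describes_surfaces[OF assms(1) _ sub[OF that(2)] that(3)])
      (use that(1) in \<open>simp add: domain4_def\<close>)
  show "describes_surfaces \<delta> F G f U" "\<forall>q\<in>U. f 3 1 q = \<eta>"
    if "case_i \<delta> \<eta> F G f U \<or> case_ii \<delta> \<eta> F G f U"
    using cds[OF assms(2) subset_refl that] by blast+
  show "generically_locally U (\<lambda>V. case_i \<delta> \<eta> F G f V \<or> case_ii \<delta> \<eta> F G f V)"
    if L: "generically_locally U (\<lambda>V. describes_surfaces \<delta> F G f V \<and> (\<forall>q\<in>V. f 3 1 q = \<eta>))"
    unfolding generically_locally_def
  proof (intro allI impI)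
    fix V' assume "domain4 V' \<and> V' \<subseteq> U"
    then obtain V where V: "domain4 V" "V \<subseteq> V'" "V \<subseteq> U"
      and ds: "describes_surfaces \<delta> F G f V" "\<forall>q\<in>V. f 3 1 q = \<eta>"
      using L unfolding generically_locally_def by (meson subset_trans)
    from describes_surfaces_locally_case[OF assms(1) V(1) sub(1,2)[OF V(3)] ds] V(2)
    show "\<exists>V. domain4 V \<and> V \<subseteq> V' \<and> (case_i \<delta> \<eta> F G f V \<or> case_ii \<delta> \<eta> F G f V)"
      by (meson subset_trans)
  qed
  show "generically_locally U (\<lambda>V. describes_surfaces \<delta> F G f V \<and> (\<forall>q\<in>V. f 3 1 q = \<eta>))"
    if L: "generically_locally U (\<lambda>V. case_i \<delta> \<eta> F G f V \<or> case_ii \<delta> \<eta> F G f V)"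
    unfolding generically_locally_def
  proof (intro allI impI)
    fix V' assume V': "domain4 V' \<and> V' \<subseteq> U"
    then obtain V where V: "domain4 V" "V \<subseteq> V'" and c: "case_i \<delta> \<eta> F G f V \<or> case_ii \<delta> \<eta> F G f V"
      using L unfolding generically_locally_def by blast
    from cds[OF V(1) _ c] V V'
    show "\<exists>V. domain4 V \<and> V \<subseteq> V' \<and> describes_surfaces \<delta> F G f V \<and> (\<forall>q\<in>V. f 3 1 q = \<eta>)"
      by (meson subset_trans)
  qed
qed

end
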